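(* Let $P$ be a strictly convex Poncelet $n$-gon in $\mathbb{R}^2$, $n\ge5$, labeled in cyclic order, that is not projectively regular. Let $G$ be its cyclically aligned Darboux–Schwartz projectivity, i.e. the projectivity with $T^2(P)=\Sigma_3(G(P))$. Then $G$ has three positive, pairwise distinct eigenvalues which, after a common normalization (rescaling of the matrix of $G$), are $1,a,b$ with $1>a>b>0$. With $\mathfrak s=a+b$ and $\mathfrak d=ab$, $$\chi_G(t)=(t-1)(t^2-\mathfrak st+\mathfrak d),\qquad \operatorname{disc}(\chi_G)=(\mathfrak s^2-4\mathfrak d)(1-\mathfrak s+\mathfrak d)^2 ,$$ and $\mathfrak d>0$, $\mathfrak s^2>4\mathfrak d$, $1-\mathfrak s+\mathfrak d>0$ (so the spectrum lies in the positive real simple-spectrum chamber below $\mathfrak d=\mathfrak s^2/4$). Moreover, let $X_1,X_2$ be the eigenpoints of $G$ for the eigenvalues $1$ and $a$, and let $u$ be the affine direction of the line $X_1X_2$. Then, as $k\to\infty$, the area-normalized iterates flatten to the spectral line $C(P)+\mathbb{R}u$: $$\max_i\operatorname{dist}\bigl((\widehat T^k(P))_i,\,C(P)+\mathbb{R}u\bigr)\to0,\qquad\operatorname{diam}\bigl(\widehat T^k(P)\bigr)\to\infty .$$ The compensated vertex subsequences have hyperbolic asymptotics: for each $r\in\{0,1\}$ the polygon $T^r(P)$ has an area-nondegenerate centered two-scale asymptotic under $G$ in the direction $u$; and, with its data $v_r,\alpha_j^{(r)},\beta_j^{(r)},a_i^{(r)},b_i^{(r)},B_r$, if one writes $$\bigl(\Sigma_{-3j}(\widehat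 T^{2j+r}(P))\bigr)_i-C(P)=X_{j,i}^{(r)}u+Y_{j,i}^{(r)}v_r ,$$ then along every subsequence of indices $j$ on which $\operatorname{sgn}(\alpha_j^{(r)}\beta_j^{(r)})$ has a constant value $\sigma\in\{-1,1\}$ one has $$X_{j,i}^{(r)}Y_{j,i}^{(r)}\to\sigma\frac{\operatorname{Area}(P)}{|B_r|}a_i^{(r)}b_i^{(r)} ,$$ so that whenever $a_i^{(r)}b_i^{(r)}\neq0$ the vertex subsequence is asymptotic to a hyperbola with asymptotes $C(P)+\mathbb{R}u$ and $C(P)+\mathbb{R}v_r$. If $P=P(u_0)$ is in Jacobi normal form, the corresponding hyperbolas are exact: with $u=(1,0)$ and $v_r=(0,1)$, each nondegenerate compensated vertex trajectory (fixed $r$ and $i$, $j\ge 0$) lies exactly on the corresponding hyperbola.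
   Context: Labeled polygons: $P=(p_1,\dots,p_n)$, $p_i\in\mathbb{R}^2$, indices modulo $n$; $\mathbb{R}^2\subset\mathbb{RP}^2$ via $x\mapsto[x:1]$. Pentagram map: $T(P)_i=(p_ip_{i+2})\cap(p_{i+1}p_{i+3})$. $C(P)=\frac1n\sum_ip_i$, $\operatorname{Area}(P)=\bigl|\frac12\sum_i\det(p_i,p_{i+1})\bigr|$. Area-normalized map: $\widehat T(P)_i=C(P)+\sqrt{\operatorname{Area}(P)/\operatorname{Area}(T(P))}\,(T(P)_i-C(T(P)))$. $\Sigma_s(P)_i=p_{i+s}$. Projectivities (given by real invertible $3\times3$ matrices) act on polygons vertexwise. Poncelet polygon: a labeled polygon for which there exist two nondegenerate conics $\mathcal C_{\mathrm{out}},\mathcal C_{\mathrm{in}}$ such that all vertices lie on $\mathcal C_{\mathrm{out}}$ and every side line $p_ip_{i+1}$ is tangent to $\mathcal C_{\mathrm{in}}$. A strictly convex Poncelet $n$-gon is projectively regular if, with its cyclic labeling, it is projectively equivalent to the regular $n$-gon $\bigl((\cos\frac{2\pi j}n,\sin\frac{2\pi j}n)\bigr)_{j=0}^{n-1}$. By Schwartz's theorem, for a Poncelet polygon $T^2(P)$ is the image of $P$ under a projectivity up to cyclic relabelling; in the present labeling the shift is $\Sigma_3$. Jacobi normal form (strictly convex case): for $\varepsilon\in(0,1)$, $u_0\in\mathbb{R}$ and $h=4K(\varepsilon)/n$, where $K(\varepsilon)=\int_0^{\pi/2}(1-\varepsilon^2\sin^2\theta)^{-1/2}d\theta$, the polygon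 $P(u_0)$ has vertices $(\operatorname{sn}(u_0+ih,\varepsilon),\operatorname{cn}(u_0+ih,\varepsilon))$, $i=0,\dots,n-1$ (Jacobi elliptic functions of modulus $\varepsilon$). Centered two-scale asymptotic: a sequence $(Q_j)$ of labeled $n$-gons with nonzero area, $Q_j=(q_{j,1},\dots,q_{j,n})$, has a centered two-scale asymptotic in the direction $u$ if there exist a vector $v$ transverse to $u$, nonzero real sequences $\alpha_j,\beta_j$, and real numbers $a_i,b_i$ such that, writing $q_{j,i}-C(Q_j)=x_{j,i}u+y_{j,i}v$, one has $x_{j,i}/\alpha_j\to a_i$, $y_{j,i}/\beta_j\to b_i$ for all $i$ and $|\beta_j|/|\alpha_j|\to0$. It is area-nondegenerate if $B=\frac12\sum_i\det(a_iu+b_iv,\,a_{i+1}u+b_{i+1}v)\neq0$. When $Q_j=G^j(Q)$, one says that $Q$ has the asymptotic under $G$. *)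

theory Defs
  imports "Subresultants.Resultant_Prelim" "HOL-Analysis.Analysis"
begin

no_notation vec_index (infixl "$" 100)

text \<open>A labeled polygon with indices modulo n is an n-periodic function on the integers.\<close>

type_synonym polygon = "int \<Rightarrow> real^2"

definition ngon :: "nat \<Rightarrow> polygon \<Rightarrow> bool" where
  "ngon n P \<longleftrightarrow> (\<forall>i. P (i + int n) = P i)"

abbreviation det2 :: "real^2 \<Rightarrow> real^2 \<Rightarrow> real" where
  "det2 p q \<equiv> Determinants.det (vector [p, q] :: real^2^2)"

definition shift :: "int \<Rightarrow> polygon \<Rightarrow> polygon" where
  "shift s P = (\<lambda>i. P (i + s))"

definition pentagram :: "polygon \<Rightarrow> polygon" where
  "pentagram P = (\<lambda>i. THE x. x \<in> affine hull {P i, P (i + 2)} \<inter> affine hull {P (i + 1), P (i + 3)})"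

definition centroid :: "nat \<Rightarrow> polygon \<Rightarrow> real^2" where
  "centroid n P = (1 / real n) *\<^sub>R (\<Sum>i = 0..<int n. P i)"

definition area :: "nat \<Rightarrow> polygon \<Rightarrow> real" where
  "area n P = \<bar>1 / 2 * (\<Sum>i = 0..<int n. det2 (P i) (P (i + 1)))\<bar>"

definition normalized_pentagram :: "nat \<Rightarrow> polygon \<Rightarrow> polygon" where
  "normalized_pentagram n P = (\<lambda>i. centroid n P +
     sqrt (area n P / area n (pentagram P)) *\<^sub>R (pentagram P i - centroid n (pentagram P)))"

text \<open>Strict convexity together with the cyclic labeling, in either orientation: all vertices
  other than the two endpoints lie strictly on one and the same side of every directed side.\<close>

definition strictly_convex_ngon :: "nat \<Rightarrow> polygon \<Rightarrow> bool" where
  "strictly_convex_ngon n P \<longleftrightarrow> ngon n P \<and>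
     (\<exists>\<sigma>\<in>{-1, 1}. \<forall>i j. j mod int n \<noteq> i mod int n \<and> j mod int n \<noteq> (i + 1) mod int n \<longrightarrow>
        \<sigma> * det2 (P (i + 1) - P i) (P j - P i) > 0)"

text \<open>Points of the projective plane are nonzero vectors of real^3 up to scaling.\<close>

definition hom_coords :: "real^2 \<Rightarrow> real^3" where
  "hom_coords p = vector [p $ 1, p $ 2, 1]"

text \<open>The projectivity of the matrix A maps the vertices of P to those of Q; in particular no vertex
  of P is sent to infinity.\<close>

definition proj_maps :: "real^3^3 \<Rightarrow> polygon \<Rightarrow> polygon \<Rightarrow> bool" where
  "proj_maps A P Q \<longleftrightarrow> (\<forall>i. \<exists>c. c \<noteq> 0 \<and> A *v hom_coords (P i) = c *\<^sub>R hom_coords (Q i))"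

text \<open>A nondegenerate conic is given by an invertible symmetric matrix S, as the locus
  of x with x \<bullet> (S *v x) = 0. Definite S need no separate exclusion: they
  have no real points and hence no real tangent lines.\<close>

definition nondegenerate_conic :: "real^3^3 \<Rightarrow> bool" where
  "nondegenerate_conic S \<longleftrightarrow> Finite_Cartesian_Product.transpose S = S \<and> invertible S"

definition on_conic :: "real^3 \<Rightarrow> real^3^3 \<Rightarrow> bool" where
  "on_conic x S \<longleftrightarrow> x \<bullet> (S *v x) = 0"

text \<open>The tangent line at a point x of the conic is the set of y with x \<bullet> (S *v y) = 0.\<close>

definition line_tangent_to_conic :: "real^2 \<Rightarrow> real^2 \<Rightarrow> real^3^3 \<Rightarrow> bool" where
  "line_tangent_to_conic p q S \<longleftrightarrow> p \<noteq> q \<and>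
     (\<exists>x. x \<noteq> 0 \<and> on_conic x S \<and> x \<bullet> (S *v hom_coords p) = 0 \<and> x \<bullet> (S *v hom_coords q) = 0)"

definition poncelet_polygon :: "nat \<Rightarrow> polygon \<Rightarrow> bool" where
  "poncelet_polygon n P \<longleftrightarrow> ngon n P \<and>
     (\<exists>Sout Sin. nondegenerate_conic Sout \<and> nondegenerate_conic Sin \<and>
        (\<forall>i. on_conic (hom_coords (P i)) Sout) \<and>
        (\<forall>i. line_tangent_to_conic (P i) (P (i + 1)) Sin))"

definition regular_ngon :: "nat \<Rightarrow> polygon" where
  "regular_ngon n = (\<lambda>j. vector [cos (2 * pi * of_int j / real n), sin (2 * pi * of_int j / real n)])"

definition projectively_regular :: "nat \<Rightarrow> polygon \<Rightarrow> bool" where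
  "projectively_regular n P \<longleftrightarrow> (\<exists>A. invertible A \<and> proj_maps A (regular_ngon n) P)"

text \<open>The matrix G represents the projectivity with T^2(P) = shift 3 (G(P)).\<close>

definition darboux_schwartz :: "real^3^3 \<Rightarrow> polygon \<Rightarrow> bool" where
  "darboux_schwartz G P \<longleftrightarrow> invertible G \<and>
     (\<exists>Q. proj_maps G P Q \<and> pentagram (pentagram P) = shift 3 Q)"

definition char_polynomial :: "real^3^3 \<Rightarrow> real poly" where
  "char_polynomial M = Determinants.det (\<chi> i j. (if i = j then [:0, 1:] else 0) - [:M $ i $ j:])"

definition poly_disc :: "'a :: field poly \<Rightarrow> 'a" where
  "poly_disc p = (-1) ^ (degree p * (degree p - 1) div 2) * resultant p (pderiv p) / lead_coeff p"

definition eigenvec :: "real^3^3 \<Rightarrow> real \<Rightarrow> real^3 \<Rightarrow> bool" where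
  "eigenvec M t x \<longleftrightarrow> x \<noteq> 0 \<and> M *v x = t *\<^sub>R x"

text \<open>The projective line through X and Y is not the line at infinity, and u is a direction
  vector of its affine part: [u : 0] is the point at infinity of the line.\<close>

definition affine_direction :: "real^3 \<Rightarrow> real^3 \<Rightarrow> real^2 \<Rightarrow> bool" where
  "affine_direction X Y u \<longleftrightarrow> u \<noteq> 0 \<and> \<not> (X $ 3 = 0 \<and> Y $ 3 = 0) \<and>
     (vector [u $ 1, u $ 2, 0] :: real^3) \<in> span {X, Y}"

definition affine_line :: "real^2 \<Rightarrow> real^2 \<Rightarrow> (real^2) set" where
  "affine_line p u = range (\<lambda>t. p + t *\<^sub>R u)"

definition two_scale ::
  "nat \<Rightarrow> (nat \<Rightarrow> polygon) \<Rightarrow> real^2 \<Rightarrow> real^2 \<Rightarrow> (nat \<Rightarrow> real) \<Rightarrow> (nat \<Rightarrow> real) \<Rightarrow>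
    (int \<Rightarrow> real) \<Rightarrow> (int \<Rightarrow> real) \<Rightarrow> bool" where
  "two_scale n Q u v \<alpha> \<beta> a b \<longleftrightarrow>
     (\<forall>j. ngon n (Q j) \<and> area n (Q j) \<noteq> 0) \<and> det2 u v \<noteq> 0 \<and>
     (\<forall>j. \<alpha> j \<noteq> 0 \<and> \<beta> j \<noteq> 0) \<and>
     (\<exists>x y. (\<forall>j i. Q j i - centroid n (Q j) = x j i *\<^sub>R u + y j i *\<^sub>R v) \<and>
        (\<forall>i. (\<lambda>j. x j i / \<alpha> j) \<longlonglongrightarrow> a i) \<and> (\<forall>i. (\<lambda>j. y j i / \<beta> j) \<longlonglongrightarrow> b i)) \<and>
     (\<lambda>j. \<bar>\<beta> j\<bar> / \<bar>\<alpha> j\<bar>) \<longlonglongrightarrow> 0"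

definition limit_area ::
  "nat \<Rightarrow> real^2 \<Rightarrow> real^2 \<Rightarrow> (int \<Rightarrow> real) \<Rightarrow> (int \<Rightarrow> real) \<Rightarrow> real" where
  "limit_area n u v a b = 1 / 2 * (\<Sum>i = 0..<int n.
     det2 (a i *\<^sub>R u + b i *\<^sub>R v) (a (i + 1) *\<^sub>R u + b (i + 1) *\<^sub>R v))"

text \<open>Area-nondegenerate centered two-scale asymptotic, with the stated data, of Q under the
  projectivity G; R j is the polygon G^j(Q).\<close>

definition nondeg_two_scale_under ::
  "nat \<Rightarrow> real^3^3 \<Rightarrow> polygon \<Rightarrow> real^2 \<Rightarrow> real^2 \<Rightarrow> (nat \<Rightarrow> real) \<Rightarrow> (nat \<Rightarrow> real) \<Rightarrow>
    (int \<Rightarrow> real) \<Rightarrow> (int \<Rightarrow> real) \<Rightarrow> bool" where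
  "nondeg_two_scale_under n G Q u v \<alpha> \<beta> a b \<longleftrightarrow>
     (\<exists>R. R 0 = Q \<and> (\<forall>j. proj_maps G (R j) (R (Suc j))) \<and> two_scale n R u v \<alpha> \<beta> a b) \<and>
     limit_area n u v a b \<noteq> 0"

definition compensated :: "nat \<Rightarrow> polygon \<Rightarrow> nat \<Rightarrow> nat \<Rightarrow> polygon" where
  "compensated n P r j = shift (- 3 * int j) ((normalized_pentagram n ^^ (2 * j + r)) P)"

definition hyperbola :: "real^2 \<Rightarrow> real^2 \<Rightarrow> real^2 \<Rightarrow> real \<Rightarrow> (real^2) set" where
  "hyperbola p u v c = {p + x *\<^sub>R u + y *\<^sub>R v | x y. x * y = c}"

definition asymptotic_to :: "(nat \<Rightarrow> real^2) \<Rightarrow> (real^2) set \<Rightarrow> bool" where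
  "asymptotic_to z H \<longleftrightarrow> filterlim (\<lambda>m. norm (z m)) at_top sequentially \<and> (\<lambda>m. infdist (z m) H) \<longlonglongrightarrow> 0"

text \<open>Jacobi elliptic functions of modulus k (not of parameter k^2), for 0 < k < 1: the amplitude
  inverts the incomplete elliptic integral of the first kind.\<close>

definition elliptic_F :: "real \<Rightarrow> real \<Rightarrow> real" where
  "elliptic_F \<phi> k = (LBINT \<theta>=ereal 0..ereal \<phi>. 1 / sqrt (1 - k\<^sup>2 * (sin \<theta>)\<^sup>2))"

definition elliptic_K :: "real \<Rightarrow> real" where
  "elliptic_K k = elliptic_F (pi / 2) k"

definition jacobi_am :: "real \<Rightarrow> real \<Rightarrow> real" where
  "jacobi_am u k = (THE \<phi>. elliptic_F \<phi> k = u)"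

definition jacobi_sn :: "real \<Rightarrow> real \<Rightarrow> real" where
  "jacobi_sn u k = sin (jacobi_am u k)"

definition jacobi_cn :: "real \<Rightarrow> real \<Rightarrow> real" where
  "jacobi_cn u k = cos (jacobi_am u k)"

definition jacobi_polygon :: "nat \<Rightarrow> real \<Rightarrow> real \<Rightarrow> polygon" where
  "jacobi_polygon n \<epsilon> u0 = (let h = 4 * elliptic_K \<epsilon> / real n in
     (\<lambda>i. vector [jacobi_sn (u0 + of_int i * h) \<epsilon>, jacobi_cn (u0 + of_int i * h) \<epsilon>]))"

end

theory Submission
  imports Defs
begin

text \<open>Lift the vertices to homogeneous vectors g i. Tangency of the sides lets one rescale the g i and the
  inner form N so that N (g i) (g i) = 1, and convexity then forces N (g i) (g (i + 1)) = -1. The form N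
  is Lorentzian and has a timelike eigenvector in common with the outer form, so both forms are
  diagonalized by one projectivity M. In these coordinates the vertices and the suitably scaled points of
  tangency alternate in a chain r of points (x j, y j) on the unit circle with
  alpha x j x (j + 1) + beta y j y (j + 1) = 1 and 1 < alpha \<le> beta; equality alpha = beta makes the
  chain equidistant, that is, the polygon projectively regular.

  Doubling the chord relation shows that the pentagram map acts on the chain as the scaling by
  (lam, mu) for explicit 0 < mu < lam < 1, combined with the shift of r by three. Hence G is, up to a
  factor, conjugate by M to the diagonal matrix with entries lam^2, mu^2, 1, and the vertices of all
  iterates are known in closed form; dividing by the square root of the area, which decays like (lam mu)^k, leaves scales
  (lam / mu)^(k/2) and (mu / lam)^(k/2) with constant product.

  A polygon in Jacobi normal form has M = 1. There the chord relation is the addition theorem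
  sn m sn (m + \<delta>) dn \<delta> + cn m cn (m + \<delta>) = cn \<delta> with \<delta> half the step of the polygon.\<close>

section \<open>Determinants and bilinear forms\<close>

text \<open>A Poncelet polygon carries no information on the position of its conics: in the affine
  chart either may be a hyperbola, and nothing says that the second lies inside the first. Convexity
  must supply every sign. Gram determinants of null vectors do this for the vertices on the outer
  conic, and a relation between the points of tangency does it for the inner one. The result is N >
  0 on all nonzero null vectors of the outer form B. So N / B attains an interior maximum on the
  region where both forms are nonpositive, and its critical point is the common timelike
  eigenvector. Five vertices matter twice: in these sign arguments, and for alpha^2 + beta^2 -
  alpha^2 beta^2 > 0, which degenerates to 0 for a square with its two circles. The theorem
  quantifies over all asymptotic data, whereas the iterates are explicit. Images under a
  projectivity are unique, so any data describe the same explicit sequence; the limits then follow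
  from the abstract two-scale conditions, and explicit scales enter only where existence is
  shown.\<close>

definition det3 :: "real^3 \<Rightarrow> real^3 \<Rightarrow> real^3 \<Rightarrow> real" where
  "det3 x y z = Determinants.det (vector [x, y, z] :: real^3^3)"

lemma det3_expand:
  "det3 x y z = x$1 * (y$2 * z$3 - y$3 * z$2) - x$2 * (y$1 * z$3 - y$3 * z$1) + x$3 * (y$1 * z$2 - y$2 * z$1)"
  by (simp add: det3_def Determinants.det_3 algebra_simps)

lemma vec3_eq_iff: "(x :: real^3) = y \<longleftrightarrow> x$1 = y$1 \<and> x$2 = y$2 \<and> x$3 = y$3"
  by (simp add: vec_eq_iff forall_3)

lemma vec2_eq_iff: "(x :: real^2) = y \<longleftrightarrow> x$1 = y$1 \<and> x$2 = y$2"
  by (simp add: vec_eq_iff forall_2)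

lemma det3_add: "det3 (x + x') y z = det3 x y z + det3 x' y z"
  "det3 x (y + y') z = det3 x y z + det3 x y' z" "det3 x y (z + z') = det3 x y z + det3 x y z'"
  by (simp_all add: det3_expand algebra_simps)

lemma det3_diff: "det3 (x - x') y z = det3 x y z - det3 x' y z"
  "det3 x (y - y') z = det3 x y z - det3 x y' z" "det3 x y (z - z') = det3 x y z - det3 x y z'"
  by (simp_all add: det3_expand algebra_simps)

lemma det3_scale: "det3 (c *\<^sub>R x) y z = c * det3 x y z"
  "det3 x (c *\<^sub>R y) z = c * det3 x y z" "det3 x y (c *\<^sub>R z) = c * det3 x y z"
  by (simp_all add: det3_expand algebra_simps)

lemma det3_same [simp]: "det3 x x z = 0" "det3 x z x = 0" "det3 z x x = 0"
  by (simp_all add: det3_expand algebra_simps)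

lemma det3_rotate: "det3 x y z = det3 y z x"
  by (simp add: det3_expand algebra_simps)

lemma det3_swap: "det3 x y z = - det3 y x z"
  by (simp add: det3_expand algebra_simps)

lemma det3_cramer:
  "det3 x y z *\<^sub>R w = det3 w y z *\<^sub>R x + det3 x w z *\<^sub>R y + det3 x y w *\<^sub>R z"
  by (simp add: vec3_eq_iff det3_expand algebra_simps)

text \<open>With \<open>p\<close> fixed, \<open>det3 p\<close> is an alternating form on the plane
  of vectors modulo \<open>p\<close>, where any three vectors are dependent. The relation transfers
  signs between triangles with the common vertex \<open>p\<close>.\<close>

lemma det3_pluecker:
  "det3 p e b * det3 p a c = det3 p e a * det3 p b c + det3 p e c * det3 p a b"
  by (simp add: det3_expand algebra_simps)

lemma matrix_mult_vec_3: "(A :: real^3^3) *v x = vector [A$1$1 * x$1 + A$1$2 * x$2 + A$1$3 * x$3,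
    A$2$1 * x$1 + A$2$2 * x$2 + A$2$3 * x$3, A$3$1 * x$1 + A$3$2 * x$2 + A$3$3 * x$3]"
  by (simp add: vec3_eq_iff matrix_vector_mult_def sum_3)

lemma inner_3: "(x :: real^3) \<bullet> y = x$1 * y$1 + x$2 * y$2 + x$3 * y$3"
  by (simp add: inner_vec_def sum_3)

lemma det3_matrix_mult: "det3 (A *v x) (A *v y) (A *v z) = Determinants.det A * det3 x y z"
proof -
  have "(vector [A *v x, A *v y, A *v z] :: real^3^3)
      = vector [x, y, z] ** Finite_Cartesian_Product.transpose A"
    by (simp add: vec_eq_iff forall_3 matrix_matrix_mult_def matrix_vector_mult_def sum_3
        Finite_Cartesian_Product.transpose_def mult.commute)
  then show ?thesis by (simp add: det3_def det_mul)
qed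

definition bform :: "real^3^3 \<Rightarrow> real^3 \<Rightarrow> real^3 \<Rightarrow> real" where
  "bform S x y = x \<bullet> (S *v y)"

lemma bform_add: "bform S (x + y) z = bform S x z + bform S y z"
  "bform S z (x + y) = bform S z x + bform S z y"
  by (simp_all add: bform_def inner_add_left inner_add_right matrix_vector_right_distrib)

lemma bform_diff: "bform S (x - y) z = bform S x z - bform S y z"
  "bform S z (x - y) = bform S z x - bform S z y"
  by (simp_all add: bform_def inner_diff_left inner_diff_right matrix_vector_mult_diff_distrib)

lemma bform_scale: "bform S (c *\<^sub>R x) z = c * bform S x z" "bform S z (c *\<^sub>R x) = c * bform S z x"
  by (simp_all add: bform_def scaleR_matrix_vector_assoc[symmetric] matrix_vector_mult_scaleR)

lemma bform_zero [simp]: "bform S 0 z = 0" "bform S z 0 = 0"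
  by (simp_all add: bform_def)

lemma bform_uminus: "bform S (- x) z = - bform S x z" "bform S z (- x) = - bform S z x"
  using bform_scale(1)[of S "-1" x z] bform_scale(2)[of S z "-1" x] by simp_all

lemmas bform_linear = bform_add bform_diff bform_scale bform_uminus

lemma bform_sym:
  assumes "Finite_Cartesian_Product.transpose S = S"
  shows "bform S x y = bform S y x"
proof -
  have "bform S x y = (x v* S) \<bullet> y" by (simp add: bform_def dot_lmul_matrix)
  also have "x v* S = S *v x" using assms transpose_matrix_vector[of S x] by simp
  finally show ?thesis by (simp add: bform_def inner_commute)
qed

lemma bform_smult: "bform (c *\<^sub>R S) x y = c * bform S x y"
  by (simp add: bform_def scaleR_matrix_vector_assoc[symmetric])

text \<open>The Gram matrix is \<open>V S V^T\<close>, with the three vectors as rows of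
  \<open>V\<close>. Most signs below are read off here: for null or orthogonal vectors the left side
  collapses, while the right side has the sign of the determinant of \<open>S\<close> or
  vanishes.\<close>

lemma bform_gram:
  "bform S x x * (bform S y y * bform S z z - bform S y z * bform S z y)
   - bform S x y * (bform S y x * bform S z z - bform S y z * bform S z x)
   + bform S x z * (bform S y x * bform S z y - bform S y y * bform S z x)
   = Determinants.det S * (det3 x y z)\<^sup>2"
proof -
  define V where "V = (vector [x, y, z] :: real^3^3)"
  define W where "W = V ** S ** Finite_Cartesian_Product.transpose V"
  have "Determinants.det W = Determinants.det S * (det3 x y z)\<^sup>2"
    by (simp add: W_def det_mul V_def det3_def power2_eq_square)
  moreover have W: "W $ i $ j = bform S (V $ i) (V $ j)" for i j
  proof -
    have "W $ i $ j = (\<Sum>k\<in>UNIV. (\<Sum>l\<in>UNIV. V$i$l * S$l$k) * V$j$k)"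
      by (simp add: W_def matrix_matrix_mult_def Finite_Cartesian_Product.transpose_def)
    also have "\<dots> = bform S (V $ i) (V $ j)"
      unfolding bform_def inner_3 matrix_vector_mult_def sum_3 by (simp add: distrib_left distrib_right)
    finally show ?thesis .
  qed
  moreover have "V $ 1 = x" "V $ 2 = y" "V $ 3 = z" by (simp_all add: V_def)
  ultimately show ?thesis
    unfolding Determinants.det_3 W by (simp add: right_diff_distrib mult.assoc)
qed

lemma det3_nonzero_basis:
  assumes "det3 x y z \<noteq> 0"
  obtains a b c where "w = a *\<^sub>R x + b *\<^sub>R y + c *\<^sub>R z"
proof -
  let ?d = "det3 x y z"
  have "w = (1 / ?d) *\<^sub>R (?d *\<^sub>R w)" using assms by simp
  also have "\<dots> = (det3 w y z / ?d) *\<^sub>R x + (det3 x w z / ?d) *\<^sub>R y + (det3 x y w / ?d) *\<^sub>R z"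
    by (subst det3_cramer) (simp add: scaleR_right_distrib)
  finally show ?thesis using that by blast
qed

lemma bform_nondegenerate:
  assumes "invertible S" "\<And>y. bform S y x = 0"
  shows "x = 0"
proof -
  have "S *v x = 0" using assms(2)[of "S *v x"] by (simp add: bform_def)
  then show ?thesis using assms(1) by (metis invertible_eq_bij bij_is_inj matrix_vector_mult_0_right injD)
qed

lemma bform_zero_on_basis:
  assumes "invertible S" "det3 a b c \<noteq> 0" "bform S a x = 0" "bform S b x = 0" "bform S c x = 0"
  shows "x = 0"
proof (rule bform_nondegenerate[OF assms(1)])
  fix y
  obtain p q r where "y = p *\<^sub>R a + q *\<^sub>R b + r *\<^sub>R c" by (rule det3_nonzero_basis[OF assms(2)])
  then show "bform S y x = 0" using assms by (simp add: bform_linear)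
qed

lemma int_mod_neq_of_less:
  fixes i k :: int
  assumes "i < k" "k < i + int n"
  shows "k mod int n \<noteq> i mod int n"
proof
  assume "k mod int n = i mod int n"
  then have "int n dvd k - i" by (simp add: mod_eq_dvd_iff)
  then show False using assms zdvd_imp_le[of "int n" "k - i"] by simp
qed

text \<open>\<open>p\<close> and \<open>q\<close> span a hyperbolic plane whose orthogonal
  complement is spanned by \<open>H\<close>, so the form is a square plus a product of two null
  coordinates.\<close>

lemma bform_null_decomposition:
  assumes S: "Finite_Cartesian_Product.transpose S = S" "invertible S"
    and "bform S p p = 0" "bform S q q = 0" "bform S p q \<noteq> 0"
    and "bform S H H = 1" "bform S p H = 0" "bform S q H = 0"
  shows "bform S y z = bform S y H * bform S z H
    + (bform S y p * bform S z q + bform S y q * bform S z p) / bform S p q"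
proof -
  note sym = bform_sym[OF S(1)]
  define M where "M = bform S p q"
  have "Determinants.det S * (det3 p q H)\<^sup>2 = - M\<^sup>2"
    using bform_gram[of S p q H] assms sym[of H p] sym[of H q] sym[of q p]
    by (simp add: M_def power2_eq_square)
  then have D: "det3 p q H \<noteq> 0" using assms by (auto simp: M_def)
  define w where "w = y - (bform S y H *\<^sub>R H + (bform S y q / M) *\<^sub>R p + (bform S y p / M) *\<^sub>R q)"
  have "bform S p w = 0" "bform S q w = 0" "bform S H w = 0"
    using assms sym[of H p] sym[of H q] sym[of q p] sym[of p y] sym[of q y] sym[of H y]
    by (simp_all add: w_def bform_linear M_def)
  then have "w = 0" using bform_zero_on_basis[OF S(2) D] by blast
  then have y: "y = bform S y H *\<^sub>R H + (bform S y q / M) *\<^sub>R p + (bform S y p / M) *\<^sub>R q"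
    by (simp add: w_def)
  have "bform S y z = bform S (bform S y H *\<^sub>R H + (bform S y q / M) *\<^sub>R p + (bform S y p / M) *\<^sub>R q) z"
    using y by simp
  then show ?thesis
    using sym[of H z] sym[of p z] sym[of q z] by (simp add: bform_linear M_def add_divide_distrib)
qed

lemma real_decomposition_swap:
  fixes A M :: real
  assumes "A = a + W / M" "M = c + W / A" "M \<noteq> 0" "A \<noteq> 0"
  shows "a * M = c * A"
proof -
  have "A * M = a * M + W" by (subst assms(1)) (simp add: assms(3) distrib_right)
  moreover have "A * M = c * A + W"
    by (subst mult.commute, subst assms(2)) (simp add: assms(4) distrib_right)
  ultimately show ?thesis by simp
qed

text \<open>The pair \<open>y\<close>, \<open>z\<close> can be expanded in the frame
  \<open>p\<close>, \<open>q\<close>, \<open>H\<close>, and \<open>p\<close>, \<open>q\<close> in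
  the frame \<open>y\<close>, \<open>z\<close>, \<open>K\<close>. Both expansions contain the same
  mixed term \<open>W\<close>; eliminating it leaves this relation.\<close>

lemma bform_null_quadruple:
  assumes S: "Finite_Cartesian_Product.transpose S = S" "invertible S"
    and pq: "bform S p p = 0" "bform S q q = 0" "bform S p q \<noteq> 0"
      "bform S H H = 1" "bform S p H = 0" "bform S q H = 0"
    and yz: "bform S y y = 0" "bform S z z = 0" "bform S y z \<noteq> 0"
      "bform S K K = 1" "bform S y K = 0" "bform S z K = 0"
  shows "bform S y H * bform S z H * bform S p q = bform S p K * bform S q K * bform S y z"
proof -
  note sym = bform_sym[OF S(1)]
  define W where "W = bform S y p * bform S z q + bform S y q * bform S z p"
  have "bform S y z = bform S y H * bform S z H + W / bform S p q"
    unfolding W_def by (rule bform_null_decomposition[OF S pq])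
  moreover have "bform S p q = bform S p K * bform S q K + W / bform S y z"
    using bform_null_decomposition[OF S yz, of p q] sym[of y p] sym[of z p] sym[of y q] sym[of z q]
    by (simp add: W_def algebra_simps)
  ultimately show ?thesis using pq(3) yz(3) by (rule real_decomposition_swap)
qed

section \<open>Convex sequences of homogeneous vectors\<close>

text \<open>All conditions survive multiplication by a positive periodic factor; this freedom later
  normalizes the inner form on the vertices. The sign \<open>\<sigma>\<close> covers both
  orientations.\<close>

locale convex_sequence =
  fixes n :: nat and \<sigma> :: real and h :: "int \<Rightarrow> real^3"
  assumes n5: "n \<ge> 5" and sigma: "\<sigma> \<in> {-1, 1}"
    and periodic: "h (i + int n) = h i"
    and convex: "j mod int n \<noteq> i mod int n \<Longrightarrow> j mod int n \<noteq> (i + 1) mod int n \<Longrightarrow>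
      \<sigma> * det3 (h i) (h (i + 1)) (h j) > 0"
begin

definition D :: "real^3 \<Rightarrow> real^3 \<Rightarrow> real^3 \<Rightarrow> real" where
  "D x y z = \<sigma> * det3 x y z"

lemma D_rotate: "D x y z = D y z x"
  unfolding D_def by (subst det3_rotate) (rule refl)

lemma D_pluecker: "D p e b * D p a c = D p e a * D p b c + D p e c * D p a b"
proof -
  have "D p e b * D p a c = (\<sigma> * \<sigma>) * (det3 p e b * det3 p a c)" by (simp add: D_def)
  also have "\<dots> = (\<sigma> * \<sigma>) * (det3 p e a * det3 p b c + det3 p e c * det3 p a b)"
    by (rule arg_cong[OF det3_pluecker])
  finally show ?thesis by (simp only: D_def distrib_left mult.assoc mult.left_commute)
qed

lemma D_side: "i + 1 < k \<Longrightarrow> k < i + int n \<Longrightarrow> D (h i) (h (i + 1)) (h k) > 0"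
  unfolding D_def by (rule convex; rule int_mod_neq_of_less) linarith+

lemma D_side': "i < k \<Longrightarrow> k + 1 < i + int n \<Longrightarrow> D (h i) (h k) (h (k + 1)) > 0"
  using D_side[of k "i + int n"] periodic[of i] D_rotate[of "h i" "h k" "h (k + 1)"] by simp

text \<open>Convexity gives the sign of triples that contain a side. In the Pluecker relation at
  \<open>h i\<close> for \<open>h (i + 1)\<close>, \<open>h j\<close>, \<open>h k\<close>,
  \<open>h (k + 1)\<close> every other factor is such a triple, except the one known by induction on
  \<open>k\<close>.\<close>

lemma D_pos:
  assumes "i < j" "j < k" "k < i + int n"
  shows "D (h i) (h j) (h k) > 0"
proof -
  have "j + 1 \<le> k" using assms by simp
  then have "k < i + int n \<longrightarrow> D (h i) (h j) (h k) > 0"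
  proof (induction k rule: int_ge_induct)
    case base
    then show ?case using D_side'[of i j] assms by auto
  next
    case (step k)
    show ?case
    proof
      assume lt: "k + 1 < i + int n"
      show "D (h i) (h j) (h (k + 1)) > 0"
      proof (cases "j = i + 1")
        case True
        then show ?thesis using D_side[of i "k+1"] lt step.hyps assms by simp
      next
        case False
        then have "i + 1 < j" using assms by simp
        then have "D (h i) (h (i+1)) (h k) > 0" "D (h i) (h (i+1)) (h j) > 0"
          "D (h i) (h (i+1)) (h (k+1)) > 0" "D (h i) (h k) (h (k+1)) > 0" "D (h i) (h j) (h k) > 0"
          using D_side[of i k] D_side[of i j] D_side[of i "k+1"] D_side'[of i k] step lt assms by auto
        then have "D (h i) (h (i+1)) (h k) * D (h i) (h j) (h (k+1)) > 0"
          unfolding D_pluecker[of "h i" "h (i+1)" "h k" "h j" "h (k+1)"] by (intro add_pos_pos mult_pos_pos)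
        then show ?thesis using \<open>D (h i) (h (i+1)) (h k) > 0\<close> by (simp add: zero_less_mult_iff)
      qed
    qed
  qed
  then show ?thesis using assms by simp
qed

lemma det3_neq_0: "i < j \<Longrightarrow> j < k \<Longrightarrow> k < i + int n \<Longrightarrow> det3 (h i) (h j) (h k) \<noteq> 0"
  using D_pos[of i j k] by (auto simp: D_def)

lemma D_cramer: "D x y z *\<^sub>R w = D w y z *\<^sub>R x + D x w z *\<^sub>R y + D x y w *\<^sub>R z"
proof -
  have "D x y z *\<^sub>R w = \<sigma> *\<^sub>R (det3 x y z *\<^sub>R w)" by (simp add: D_def)
  also have "\<dots> = \<sigma> *\<^sub>R (det3 w y z *\<^sub>R x + det3 x w z *\<^sub>R y + det3 x y w *\<^sub>R z)" by (subst det3_cramer) simp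
  finally show ?thesis by (simp add: D_def scaleR_right_distrib)
qed

end

text \<open>For unit vectors \<open>g i\<close>, \<open>g (i + 1)\<close> tangency of the side is
  the vanishing of their 2 by 2 Gram determinant, which is \<open>tangent\<close>. It leaves the
  sign of the product open; convexity has to decide it.\<close>

locale circumscribed_sequence = convex_sequence n \<sigma> g for n \<sigma> g +
  fixes S :: "real^3^3"
  assumes S_sym: "Finite_Cartesian_Product.transpose S = S" and S_inv: "invertible S"
    and unit: "bform S (g i) (g i) = 1" and tangent: "(bform S (g i) (g (i + 1)))\<^sup>2 = 1"
begin

abbreviation "N \<equiv> bform S"
lemmas N_sym = bform_sym[OF S_sym]

text \<open>\<open>e i\<close> is the open sign, \<open>x i\<close> the point of tangency of side
  \<open>i\<close>, and \<open>k i\<close> the ratio of two linear forms that vanish on that side: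
  the polar of \<open>x i\<close> and \<open>D (g i) (g (i + 1))\<close>.\<close>

definition e :: "int \<Rightarrow> real" where "e i = N (g i) (g (i + 1))"
definition x :: "int \<Rightarrow> real^3" where "x i = g i - e i *\<^sub>R g (i + 1)"
definition k :: "int \<Rightarrow> real" where "k i = N (x i) (g (i + 2)) / D (g i) (g (i + 1)) (g (i + 2))"

lemma e_sq: "e i * e i = 1" using tangent[of i] by (simp add: e_def power2_eq_square)

lemma x_orth: "N (x i) (g i) = 0" "N (x i) (g (i + 1)) = 0" "N (x i) (x i) = 0"
proof -
  show 1: "N (x i) (g i) = 0"
    using e_sq[of i] N_sym[of "g (i+1)" "g i"] by (simp add: x_def bform_linear unit e_def[symmetric])
  show 2: "N (x i) (g (i + 1)) = 0" by (simp add: x_def bform_linear unit e_def)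
  have "N (x i) (x i) = N (x i) (g i) - e i * N (x i) (g (i+1))"
    by (subst (2) x_def) (simp add: bform_linear)
  then show "N (x i) (x i) = 0" using 1 2 by simp
qed

lemma N_x: "N (x i) w = k i * D (g i) (g (i + 1)) w"
proof -
  let ?d = "D (g i) (g (i+1)) (g (i+2))"
  have d: "?d > 0" using D_pos[of i "i+1" "i+2"] n5 by simp
  have "?d * N (x i) w = N (x i) (?d *\<^sub>R w)" by (simp add: bform_linear)
  also have "\<dots> = D (g i) (g (i+1)) w * N (x i) (g (i+2))"
    by (subst D_cramer) (simp add: bform_linear x_orth)
  finally show ?thesis using d by (simp add: k_def field_simps)
qed

lemma k_neq_0: "k i \<noteq> 0"
proof
  assume "k i = 0"
  then have "N y (x i) = 0" for y using N_x[of i y] N_sym[of y "x i"] by simp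
  then have "x i = 0" by (rule bform_nondegenerate[OF S_inv])
  then have "det3 (g i) (g (i+1)) (g (i+2)) = 0" by (simp add: x_def det3_scale)
  then show False using det3_neq_0[of i "i+1" "i+2"] n5 by simp
qed

text \<open>Both ratios can be evaluated on the triangle of three consecutive vertices, where they
  share the single unknown product of \<open>g i\<close> and \<open>g (i + 2)\<close>.\<close>

lemma k_Suc: "k (i + 1) = - e (i + 1) * k i"
proof -
  let ?d = "D (g i) (g (i+1)) (g (i+2))" and ?b = "N (g i) (g (i+2))"
  have d: "?d > 0" using D_pos[of i "i+1" "i+2"] n5 by simp
  have "k i * ?d = ?b - e i * e (i+1)"
    using N_x[of i "g (i+2)"] by (simp add: x_def bform_linear e_def add.assoc)
  moreover have "k (i+1) * ?d = e i - e (i+1) * ?b"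
    using N_x[of "i+1" "g i"] D_rotate[of "g i" "g (i+1)" "g (i+2)"] N_sym[of "g (i+2)" "g i"] N_sym[of "g (i+1)" "g i"]
    by (simp add: x_def bform_linear e_def add.assoc)
  moreover have "(k (i+1) + e (i+1) * k i) * ?d - e i * (1 - e (i+1) * e (i+1))
      = (k (i+1) * ?d - (e i - e (i+1) * ?b)) + e (i+1) * (k i * ?d - (?b - e i * e (i+1)))"
    by (simp add: algebra_simps)
  ultimately have "(k (i+1) + e (i+1) * k i) * ?d = e i * (1 - e (i+1) * e (i+1))"
    by simp
  then show ?thesis using d e_sq[of "i+1"] by simp
qed

text \<open>Because \<open>e i\<close> squares to 1, the Gram determinant of three consecutive
  vertices is minus a square. As \<open>N\<close> also takes the value 1, its signature is
  (2,1).\<close>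

lemma det_neg: "Determinants.det S < 0"
proof -
  let ?b = "N (g 0) (g 2)"
  have "N (g 1) (g 0) = e 0" "N (g 0) (g 1) = e 0" "N (g 1) (g 2) = e 1" "N (g 2) (g 1) = e 1" "N (g 2) (g 0) = ?b"
    using N_sym[of "g 1" "g 0"] N_sym[of "g 2" "g 1"] N_sym[of "g 2" "g 0"] by (simp_all add: e_def)
  then have "Determinants.det S * (det3 (g 0) (g 1) (g 2))\<^sup>2
      = 1 - e 1 * e 1 - e 0 * (e 0 - e 1 * ?b) + ?b * (e 0 * e 1 - ?b)"
    using bform_gram[of S "g 0" "g 1" "g 2"] by (simp add: unit)
  also have "\<dots> = (1 - e 0 * e 0) * (1 - e 1 * e 1) - (?b - e 0 * e 1)\<^sup>2"
    by (simp add: power2_eq_square left_diff_distrib right_diff_distrib)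
  also have "\<dots> \<le> 0" unfolding e_sq by simp
  finally have "Determinants.det S * (det3 (g 0) (g 1) (g 2))\<^sup>2 \<le> 0" .
  moreover have "(det3 (g 0) (g 1) (g 2))\<^sup>2 > 0" using det3_neq_0[of 0 1 2] n5 by simp
  ultimately have "Determinants.det S \<le> 0" by (simp add: mult_le_0_iff)
  moreover have "Determinants.det S \<noteq> 0" using S_inv invertible_det_nz by blast
  ultimately show ?thesis by simp
qed

lemma N_x_x_Suc: "N (x i) (x (i + 1)) = k (i + 1) * D (g i) (g (i + 1)) (g (i + 2))"
proof -
  have "N (x i) (x (i+1)) = N (x i) (g (i+1)) - e (i+1) * N (x i) (g (i+2))"
    by (subst (2) x_def) (simp add: bform_linear add.assoc)
  then show ?thesis using x_orth(2)[of i] N_x[of i "g (i+2)"] k_Suc[of i] by simp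
qed

text \<open>\<open>bform_null_quadruple\<close> is applied to the points of tangency on the two
  sides meeting at \<open>g (i + 1)\<close> and on the two sides meeting at
  \<open>g (j + 1)\<close>. Written through \<open>k\<close>, all remaining factors are determinants
  that convexity makes positive.\<close>

lemma k_nonadjacent:
  assumes "i + 2 \<le> j" "j + 2 \<le> i + int n"
  shows "k i * k j > 0"
proof -
  have x1: "N (x (i + 1)) (g (i + 1)) = 0" for i using x_orth(1)[of "i+1"] by simp
  have pos: "D (g i) (g (i+1)) (g (i+2)) > 0" for i using D_pos[of i "i+1" "i+2"] n5 by simp
  have quad: "N (x j) (g (i+1)) * N (x (j+1)) (g (i+1)) * N (x i) (x (i+1))
      = N (x i) (g (j+1)) * N (x (i+1)) (g (j+1)) * N (x j) (x (j+1))"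
    by (rule bform_null_quadruple[OF S_sym S_inv])
      (use x_orth x1 unit N_x_x_Suc k_neq_0 pos[of i] pos[of j] in \<open>simp_all\<close>)
  have p: "D (g j) (g (j+1)) (g (i+1)) > 0" "D (g (j+1)) (g (j+2)) (g (i+1)) > 0"
    "D (g i) (g (i+1)) (g (j+1)) > 0" "D (g (i+1)) (g (i+2)) (g (j+1)) > 0"
    using D_pos[of "i+1" j "j+1"] D_pos[of "i+1" "j+1" "j+2"] D_pos[of i "i+1" "j+1"] D_pos[of "i+1" "i+2" "j+1"] assms
      D_rotate[of "g (i+1)" "g j" "g (j+1)"] D_rotate[of "g (i+1)" "g (j+1)" "g (j+2)"] by auto
  define u v where "u = D (g j) (g (j+1)) (g (i+1)) * D (g (j+1)) (g (j+2)) (g (i+1)) * D (g i) (g (i+1)) (g (i+2))"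
    and "v = D (g i) (g (i+1)) (g (j+1)) * D (g (i+1)) (g (i+2)) (g (j+1)) * D (g j) (g (j+1)) (g (j+2))"
  have "(k (i+1) * k (j+1)) * (k j * u) = N (x j) (g (i+1)) * N (x (j+1)) (g (i+1)) * N (x i) (x (i+1))"
    using N_x[of "j+1"] unfolding N_x[of j] N_x_x_Suc u_def by (simp add: add.assoc mult_ac)
  moreover have "(k (i+1) * k (j+1)) * (k i * v) = N (x i) (g (j+1)) * N (x (i+1)) (g (j+1)) * N (x j) (x (j+1))"
    using N_x[of "i+1"] unfolding N_x[of i] N_x_x_Suc v_def by (simp add: add.assoc mult_ac)
  ultimately have "(k (i+1) * k (j+1)) * (k j * u) = (k (i+1) * k (j+1)) * (k i * v)"
    using quad by simp
  moreover have "k (i+1) * k (j+1) \<noteq> 0" using k_neq_0 by simp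
  ultimately have eq: "k j * u = k i * v" by (metis mult_left_cancel)
  have "u > 0" "v > 0" using p pos by (simp_all add: u_def v_def)
  have "k i * k j * u = k i * k i * v" by (simp only: mult.assoc eq)
  moreover have "k i * k i * v > 0" using \<open>v > 0\<close> k_neq_0[of i] not_real_square_gt_zero[of "k i"]
    by (metis mult_pos_pos)
  ultimately have "k i * k j * u > 0" by metis
  then show ?thesis using \<open>u > 0\<close> by (simp add: zero_less_mult_iff)
qed

text \<open>For \<open>n\<close> at least 5, sides \<open>i - 1\<close> and \<open>i\<close> are
  both nonadjacent to side \<open>i + 2\<close>. Hence \<open>k (i - 1)\<close> and
  \<open>k i\<close> agree in sign, and \<open>k_Suc\<close> turns this into the sign of
  \<open>e i\<close>.\<close>

lemma e_eq: "e i = -1"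
proof -
  let ?j = "i - 1"
  have "k ?j * k (?j + 3) > 0" "k (?j + 1) * k (?j + 3) > 0"
    using k_nonadjacent[of ?j "?j+3"] k_nonadjacent[of "?j+1" "?j+3"] n5 by auto
  then have "k ?j * k (?j + 1) > 0" by (auto simp: zero_less_mult_iff)
  then have "- e i * (k ?j * k ?j) > 0" using k_Suc[of ?j] by (simp add: mult_ac)
  then have "e i < 0" by (simp add: mult_less_0_iff)
  then show ?thesis using tangent[of i] by (simp add: e_def power2_eq_1_iff)
qed

lemma x_eq: "x i = g i + g (i + 1)" by (simp add: x_def e_eq)

lemma k_const: "k i = k 0"
proof (induction i rule: int_induct[where k = 0])
  case (step1 i) then show ?case using k_Suc[of i] by (simp add: e_eq)
next
  case (step2 i) then show ?case using k_Suc[of "i - 1"] by (simp add: e_eq)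
qed simp

text \<open>For null vectors the Gram determinant is twice the product of the three mutual values. A
  positive \<open>k\<close> would make all of them positive for \<open>x 0\<close>,
  \<open>x 1\<close>, \<open>x 2\<close>, against \<open>det_neg\<close>.\<close>

lemma k_neg: "k 0 < 0"
proof (rule ccontr)
  assume "\<not> k 0 < 0"
  then have k: "k 0 > 0" using k_neq_0[of 0] by simp
  have d: "D (g 0) (g 1) (g 2) > 0" "D (g 1) (g 2) (g 3) > 0" "D (g 0) (g 1) (g 3) > 0"
    using D_pos[of 0 1 2] D_pos[of 1 2 3] D_pos[of 0 1 3] n5 by simp_all
  have a: "N (x 0) (x 1) > 0" using N_x_x_Suc[of 0] k_const[of 1] k d by simp
  have b: "N (x 1) (x 2) > 0" using N_x_x_Suc[of 1] k_const[of 2] k d by simp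
  have "N (x 0) (x 2) = N (x 0) (g 2) + N (x 0) (g 3)" by (subst (2) x_eq) (simp add: bform_linear)
  then have c: "N (x 0) (x 2) > 0" using N_x[of 0 "g 2"] N_x[of 0 "g 3"] k d by (simp add: add_pos_pos)
  have "2 * N (x 0) (x 1) * N (x 1) (x 2) * N (x 0) (x 2) = Determinants.det S * (det3 (x 0) (x 1) (x 2))\<^sup>2"
    using bform_gram[of S "x 0" "x 1" "x 2"] x_orth(3) N_sym[of "x 1" "x 0"] N_sym[of "x 2" "x 1"] N_sym[of "x 2" "x 0"]
    by (simp add: algebra_simps)
  moreover have "Determinants.det S * (det3 (x 0) (x 1) (x 2))\<^sup>2 \<le> 0" using det_neg by (simp add: mult_le_0_iff)
  moreover have "2 * N (x 0) (x 1) * N (x 1) (x 2) * N (x 0) (x 2) > 0" using a b c by simp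
  ultimately show False by simp
qed

end

section \<open>Cone over the polygon, conics through the vertices, scaling of the lifts\<close>

context convex_sequence begin

lemma periodic_mult: "h (i + m * int n) = h i"
proof (induction m rule: int_induct[where k = 0])
  case (step1 m) then show ?case using periodic[of "i + m * int n"] by (simp add: algebra_simps)
next
  case (step2 m) then show ?case using periodic[of "i + (m - 1) * int n"] by (simp add: algebra_simps)
qed simp

lemma periodic_mod: assumes "i mod int n = j mod int n" shows "h i = h j"
proof -
  have "i = j + (i div int n - j div int n) * int n"
    using assms div_mult_mod_eq[of i "int n"] div_mult_mod_eq[of j "int n"] unfolding left_diff_distrib by linarith
  then show ?thesis by (metis periodic_mult)
qed

lemma D_nonneg: "D (h i) (h (i + 1)) (h j) \<ge> 0"
proof (cases "j mod int n = i mod int n \<or> j mod int n = (i + 1) mod int n")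
  case True
  then have "h j = h i \<or> h j = h (i + 1)" using periodic_mod by blast
  then show ?thesis by (auto simp: D_def)
next
  case False
  then show ?thesis using convex[of j i] by (simp add: D_def)
qed

text \<open>The rays through the vertices cut the cone over the polygon into triangles with apex
  \<open>h 0\<close>. The first sign change of \<open>D (h 0) (h j) w\<close> along \<open>j\<close>
  finds one that contains \<open>w\<close>, and Cramer's rule gives the weights.\<close>

lemma fan:
  assumes "\<And>i. D (h i) (h (i + 1)) w \<ge> 0"
  obtains j a b c where "0 < j" "j + 1 < int n" "a \<ge> 0" "b \<ge> 0" "c \<ge> 0"
    "w = a *\<^sub>R h 0 + b *\<^sub>R h j + c *\<^sub>R h (j + 1)"
proof -
  define P where "P j \<longleftrightarrow> D (h 0) (h (1 + int j)) w < 0" for j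
  have last: "D (h 0) (h (int n - 1)) w \<le> 0"
    using assms[of "int n - 1"] periodic[of 0] by (simp add: D_def det3_swap[of "h 0"])
  have "\<exists>j. 0 < j \<and> j + 1 < int n \<and> D (h 0) (h j) w \<ge> 0 \<and> D (h 0) (h (j + 1)) w \<le> 0"
  proof (cases "\<exists>j. P j \<and> int j + 1 < int n")
    case True
    then have ex: "\<exists>j. P j" by blast
    define l where "l = (LEAST j. P j)"
    have "P l" unfolding l_def using ex by (rule LeastI_ex)
    have "l \<noteq> 0" using \<open>P l\<close> assms[of 0] by (intro notI) (simp add: P_def)
    then have "\<not> P (l - 1)" unfolding l_def by (metis diff_less less_one not_less_Least zero_less_iff_neq_zero)
    moreover have "1 + int (l - 1) = int l" using \<open>l \<noteq> 0\<close> by simp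
    ultimately have "D (h 0) (h (int l)) w \<ge> 0" by (simp add: P_def)
    moreover have "int l + 1 < int n" using True unfolding l_def by (metis (mono_tags) Least_le add_le_cancel_right of_nat_le_iff le_less_trans)
    ultimately show ?thesis using \<open>P l\<close> \<open>l \<noteq> 0\<close> by (intro exI[of _ "int l"]) (simp add: P_def add.commute)
  next
    case False
    \<comment> \<open>Without a sign change up to the ray through \<open>h (n - 2)\<close> the
      vector lies in the last triangle, where \<open>last\<close> supplies the second sign.\<close>
    have "\<not> P (n - 3)" using False n5 by auto
    moreover have "1 + int (n - 3) = int n - 2" using n5 by simp
    ultimately show ?thesis using last n5 by (intro exI[of _ "int n - 2"]) (simp add: P_def)
  qed
  then obtain j where j: "0 < j" "j + 1 < int n" "D (h 0) (h j) w \<ge> 0" "D (h 0) (h (j + 1)) w \<le> 0" by blast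
  define d where "d = D (h 0) (h j) (h (j + 1))"
  have d: "d > 0" unfolding d_def using D_pos[of 0 j "j+1"] j by simp
  have "w = (1 / d) *\<^sub>R (d *\<^sub>R w)" using d by simp
  also have "\<dots> = (D w (h j) (h (j+1)) / d) *\<^sub>R h 0 + (D (h 0) w (h (j+1)) / d) *\<^sub>R h j + (D (h 0) (h j) w / d) *\<^sub>R h (j+1)"
    unfolding d_def by (subst D_cramer) (simp add: scaleR_right_distrib)
  finally show ?thesis
  proof (rule that[OF j(1,2), rotated 3])
    show "D w (h j) (h (j+1)) / d \<ge> 0" using assms[of j] D_rotate[of w "h j" "h (j+1)"] d by simp
    have "D (h 0) w (h (j+1)) = - D (h 0) (h (j+1)) w" by (simp add: D_def det3_expand algebra_simps)
    then have "D (h 0) w (h (j+1)) \<ge> 0" using j by linarith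
    then show "D (h 0) w (h (j+1)) / d \<ge> 0" using d by simp
    show "D (h 0) (h j) w / d \<ge> 0" using j d by simp
  qed
qed

text \<open>The diagonals of a convex quadrilateral cross: a positive combination of
  \<open>h j\<close>, \<open>h l\<close> equals one of \<open>h i\<close>, \<open>h k\<close>. On
  null vectors the form of either side reduces to its mixed term.\<close>

lemma inscribed_alternating:
  assumes S: "Finite_Cartesian_Product.transpose S = S" and null: "\<And>i. bform S (h i) (h i) = 0"
    and ord: "i < j" "j < k" "k < l" "l < i + int n"
    and neq: "bform S (h i) (h k) \<noteq> 0"
  shows "bform S (h i) (h k) * bform S (h j) (h l) > 0"
proof -
  define a b c d where "a = D (h j) (h k) (h l)" "b = D (h i) (h k) (h l)" "c = D (h i) (h j) (h l)" "d = D (h i) (h j) (h k)"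
  note defs = this
  have pos: "a > 0" "b > 0" "c > 0" "d > 0"
    unfolding defs using D_pos ord by auto
  have "d *\<^sub>R h l = D (h l) (h j) (h k) *\<^sub>R h i + D (h i) (h l) (h k) *\<^sub>R h j + D (h i) (h j) (h l) *\<^sub>R h k"
    unfolding defs by (rule D_cramer)
  moreover have "D (h l) (h j) (h k) = a" "D (h i) (h l) (h k) = - b"
    by (simp_all add: defs D_def det3_expand algebra_simps)
  ultimately have eq: "b *\<^sub>R h j + d *\<^sub>R h l = a *\<^sub>R h i + c *\<^sub>R h k" by (simp add: defs)
  note sym = bform_sym[OF S]
  have n2: "bform S (s *\<^sub>R h p + t *\<^sub>R h q) (s *\<^sub>R h p + t *\<^sub>R h q) = 2 * s * t * bform S (h p) (h q)" for s t p q
    using sym[of "h q" "h p"] by (simp add: bform_linear null)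
  have e: "b * d * bform S (h j) (h l) = a * c * bform S (h i) (h k)"
    using n2[of b j d l] n2[of a i c k] eq by simp
  have "(b * d) * (bform S (h i) (h k) * bform S (h j) (h l)) = (a * c) * (bform S (h i) (h k) * bform S (h i) (h k))"
    using arg_cong[OF e, of "\<lambda>x. bform S (h i) (h k) * x"] by (simp only: mult_ac)
  moreover have "\<dots> > 0" using pos neq not_real_square_gt_zero[of "bform S (h i) (h k)"] by (metis mult_pos_pos)
  moreover have "b * d > 0" using pos by simp
  ultimately show ?thesis by (metis zero_less_mult_pos)
qed

lemma inscribed_triangle:
  assumes S: "Finite_Cartesian_Product.transpose S = S" "invertible S" and null: "\<And>i. bform S (h i) (h i) = 0"
    and ord: "i < j" "j < k" "k < i + int n"
  shows "bform S (h i) (h j) * bform S (h j) (h k) * bform S (h i) (h k) * Determinants.det S > 0"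
proof -
  note sym = bform_sym[OF S(1)]
  have "2 * (bform S (h i) (h j) * bform S (h j) (h k) * bform S (h i) (h k)) = Determinants.det S * (det3 (h i) (h j) (h k))\<^sup>2"
    using bform_gram[of S "h i" "h j" "h k"] sym[of "h j" "h i"] sym[of "h k" "h j"] sym[of "h k" "h i"]
    by (simp add: null mult_ac)
  then have "2 * (bform S (h i) (h j) * bform S (h j) (h k) * bform S (h i) (h k) * Determinants.det S)
     = (Determinants.det S * det3 (h i) (h j) (h k))\<^sup>2" by (simp add: power2_eq_square mult_ac)
  moreover have "Determinants.det S * det3 (h i) (h j) (h k) \<noteq> 0"
    using S(2) invertible_det_nz det3_neq_0[OF ord] by auto
  ultimately show ?thesis by (metis zero_less_mult_pos zero_less_numeral zero_less_power2)
qed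

text \<open>Among five vertices, crossing diagonals agree in sign by
  \<open>inscribed_alternating\<close>, and each triangle ties a product of three values to the
  determinant. Cancelling equal signs isolates a single pair; hence all vertices lie on one nappe of
  the cone.\<close>

lemma inscribed_sign:
  assumes S: "Finite_Cartesian_Product.transpose S = S" "invertible S" and null: "\<And>i. bform S (h i) (h i) = 0"
    and ij: "i < j" "j < i + int n"
  shows "bform S (h i) (h j) * Determinants.det S > 0"
proof -
  note sym = bform_sym[OF S(1)]
  define s where "s = Determinants.det S"
  have five: "bform S (h a) (h b) * s > 0 \<and> bform S (h a) (h c) * s > 0"
    if "a < b" "b < c" "c < d" "d < e" "e < a + int n" for a b c d e
  proof -
    have tri: "bform S (h a) (h b) * bform S (h b) (h c) * bform S (h a) (h c) * s > 0"
       "bform S (h a) (h b) * bform S (h b) (h d) * bform S (h a) (h d) * s > 0"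
       "bform S (h b) (h c) * bform S (h c) (h e) * bform S (h b) (h e) * s > 0"
      unfolding s_def using that by (auto intro!: inscribed_triangle[OF S null])
    have cross: "bform S (h a) (h c) * bform S (h b) (h d) > 0" "bform S (h a) (h c) * bform S (h b) (h e) > 0"
       "bform S (h a) (h d) * bform S (h b) (h e) > 0" "bform S (h b) (h d) * bform S (h c) (h e) > 0"
      using that tri by (auto intro!: inscribed_alternating[OF S(1) null])
    have same: "y * z > 0" if "x * y > 0" "x * z > 0" for x y z :: real
      using that by (auto simp: zero_less_mult_iff)
    have BD_BE: "bform S (h b) (h d) * bform S (h b) (h e) > 0" using same cross(1,2) .
    then have BD_AD: "bform S (h b) (h d) * bform S (h a) (h d) > 0"
      using same[of "bform S (h b) (h e)"] cross(3) by (simp add: mult.commute)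
    have CE_BE: "bform S (h c) (h e) * bform S (h b) (h e) > 0" using same cross(4) BD_BE .
    have AB: "bform S (h a) (h b) * s > 0"
      by (rule zero_less_mult_pos[OF _ BD_AD]) (use tri(2) in \<open>simp only: mult_ac\<close>)
    have BC: "bform S (h b) (h c) * s > 0"
      by (rule zero_less_mult_pos[OF _ CE_BE]) (use tri(3) in \<open>simp only: mult_ac\<close>)
    have AB_BC: "bform S (h a) (h b) * bform S (h b) (h c) > 0"
      using same[of s] AB BC by (simp add: mult.commute)
    have "bform S (h a) (h c) * s > 0"
      by (rule zero_less_mult_pos[OF _ AB_BC]) (use tri(1) in \<open>simp only: mult_ac\<close>)
    then show ?thesis using AB by simp
  qed
  \<comment> \<open>The cases make the given pair the first and second, or the first and third, of
    five vertices in cyclic order, passing to \<open>i + int n\<close> where necessary.\<close>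
  consider "j = i + 1" | "i + 2 \<le> j" "j + 3 \<le> i + int n" | "j + 2 = i + int n" | "j + 1 = i + int n"
    using ij by linarith
  then show ?thesis
  proof cases
    case 1 then show ?thesis using five[of i j "i+2" "i+3" "i+4"] n5 by (simp add: s_def)
  next
    case 2 then show ?thesis using five[of i "i+1" j "j+1" "j+2"] by (simp add: s_def)
  next
    case 3 then show ?thesis using five[of j "j+1" "i + int n" "j+3" "j+4"] n5 sym[of "h i" "h j"]
      by (simp add: s_def periodic)
  next
    case 4 then show ?thesis using five[of j "i + int n" "j+2" "j+3" "j+4"] n5 sym[of "h i" "h j"]
      by (simp add: s_def periodic)
  qed
qed

text \<open>On the plane of a tangent side the form is degenerate. So the values at neighbouring
  vertices have a nonzero square as product, all values share one sign, and a common factor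
  \<open>c\<close> together with individual factors \<open>t i\<close> turns them into 1.\<close>

lemma tangent_normalization:
  assumes S: "Finite_Cartesian_Product.transpose S = S" "invertible S"
    and tangent: "\<And>i. \<exists>x. x \<noteq> 0 \<and> bform S x x = 0 \<and> bform S x (h i) = 0 \<and> bform S x (h (i + 1)) = 0"
  obtains c t where "c \<noteq> 0" "\<And>i. t i > 0" "circumscribed_sequence n \<sigma> (\<lambda>i. t i *\<^sub>R h i) (c *\<^sub>R S)"
proof -
  note sym = bform_sym[OF S(1)]
  define N where "N i j = bform S (h i) (h j)" for i j
  have Nsym: "N i j = N j i" for i j unfolding N_def by (rule sym)
  have disc: "N i i * N (i + 1) (i + 1) = (N i (i + 1))\<^sup>2" for i
  proof -
    obtain x where x: "x \<noteq> 0" "bform S x x = 0" "bform S x (h i) = 0" "bform S x (h (i + 1)) = 0"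
      using tangent by blast
    have d: "D (h i) (h (i+1)) (h (i+2)) > 0" using D_pos[of i "i+1" "i+2"] n5 by simp
    \<comment> \<open>Off the plane of the side, \<open>x\<close> would complete \<open>h i\<close>,
      \<open>h (i + 1)\<close> to a basis orthogonal to \<open>x\<close>; so the point of tangency
      lies on the side.\<close>
    have "det3 (h i) (h (i+1)) x = 0"
    proof (rule ccontr)
      assume "det3 (h i) (h (i+1)) x \<noteq> 0"
      then have "x = 0" by (rule bform_zero_on_basis[OF S(2)]) (use x sym in auto)
      then show False using x by simp
    qed
    then have D0: "D (h i) (h (i+1)) x = 0" by (simp add: D_def)
    define p q where "p = D x (h (i+1)) (h (i+2))" and "q = D (h i) x (h (i+2))"
    have xe: "D (h i) (h (i+1)) (h (i+2)) *\<^sub>R x = p *\<^sub>R h i + q *\<^sub>R h (i+1)"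
      by (subst D_cramer) (simp add: D0 p_def q_def)
    then have pq: "p \<noteq> 0 \<or> q \<noteq> 0" using x d by auto
    have "p * N i i + q * N i (i+1) = bform S (D (h i) (h (i+1)) (h (i+2)) *\<^sub>R x) (h i)"
      unfolding xe using sym[of "h (i+1)" "h i"] by (simp add: bform_linear N_def)
    then have 1: "p * N i i + q * N i (i+1) = 0" using x by (simp add: bform_linear)
    have "p * N i (i+1) + q * N (i+1) (i+1) = bform S (D (h i) (h (i+1)) (h (i+2)) *\<^sub>R x) (h (i+1))"
      unfolding xe by (simp add: bform_linear N_def)
    then have 2: "p * N i (i+1) + q * N (i+1) (i+1) = 0" using x by (simp add: bform_linear)
    \<comment> \<open>\<open>(p, q)\<close> is a nonzero kernel vector of the Gram matrix of the
      side, whose determinant therefore vanishes.\<close>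
    have "p * (N i i * N (i+1) (i+1) - (N i (i+1))\<^sup>2)
        = N (i+1) (i+1) * (p * N i i + q * N i (i+1)) - N i (i+1) * (p * N i (i+1) + q * N (i+1) (i+1))"
      by (simp add: algebra_simps power2_eq_square)
    moreover have "q * (N i i * N (i+1) (i+1) - (N i (i+1))\<^sup>2)
        = N i i * (p * N i (i+1) + q * N (i+1) (i+1)) - N i (i+1) * (p * N i i + q * N i (i+1))"
      by (simp add: algebra_simps power2_eq_square)
    ultimately show ?thesis using pq unfolding 1 2 by auto
  qed
  have N0: "N i i \<noteq> 0" for i
  proof
    \<comment> \<open>A vertex on the inner conic would be orthogonal to itself and to both
      neighbours, hence zero.\<close>
    assume 0: "N i i = 0"
    then have "N i (i+1) = 0" "N (i-1) i = 0" using disc[of i] disc[of "i-1"] by simp_all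
    then have "h i = 0"
      using bform_zero_on_basis[OF S(2) det3_neq_0[of "i-1" i "i+1"], of "h i"] n5 0 Nsym[of "i+1" i]
      by (simp add: N_def)
    then have "det3 (h i) (h (i+1)) (h (i+2)) = 0" by (simp add: det3_expand)
    then show False using det3_neq_0[of i "i+1" "i+2"] n5 by simp
  qed
  have step: "N i i * N (i+1) (i+1) > 0" for i
    using disc[of i] N0[of i] N0[of "i+1"] by (metis mult_eq_0_iff zero_less_power2 power_zero_numeral)
  have same: "N 0 0 * N i i > 0" for i
  proof (induction i rule: int_induct[where k = 0])
    case base then show ?case using N0[of 0] not_real_square_gt_zero by blast
  next
    case (step1 i) then show ?case using step[of i] by (auto simp: zero_less_mult_iff)
  next
    case (step2 i) then show ?case using step[of "i-1"] by (auto simp: zero_less_mult_iff)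
  qed
  define c t where "c = N 0 0" and "t i = 1 / sqrt (c * N i i)" for i
  have c: "c \<noteq> 0" and cN: "c * N i i > 0" for i using N0 same by (simp_all add: c_def)
  have t: "t i > 0" for i using cN by (simp add: t_def)
  have tt: "t i * t i * (c * N i i) = 1" for i
    using cN[of i] real_sqrt_mult_self[of "c * N i i"] by (auto simp: t_def)
  have unit: "bform (c *\<^sub>R S) (t i *\<^sub>R h i) (t i *\<^sub>R h i) = 1" for i
    using tt[of i] by (simp add: bform_smult bform_linear N_def mult_ac)
  have tan: "(bform (c *\<^sub>R S) (t i *\<^sub>R h i) (t (i+1) *\<^sub>R h (i+1)))\<^sup>2 = 1" for i
  proof -
    have "(bform (c *\<^sub>R S) (t i *\<^sub>R h i) (t (i+1) *\<^sub>R h (i+1)))\<^sup>2 = (c * (t i * (t (i+1) * N i (i+1))))\<^sup>2"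
      by (simp add: bform_smult bform_linear N_def mult_ac)
    also have "\<dots> = (t i * t i * (c * c)) * (t (i+1) * t (i+1)) * (N i (i+1))\<^sup>2"
      by (simp add: power2_eq_square mult_ac)
    also have "\<dots> = (t i * t i * (c * N i i)) * (t (i+1) * t (i+1) * (c * N (i+1) (i+1)))"
      unfolding disc[symmetric] by (simp only: mult_ac)
    finally show ?thesis unfolding tt by simp
  qed
  have "circumscribed_sequence n \<sigma> (\<lambda>i. t i *\<^sub>R h i) (c *\<^sub>R S)"
  proof
    show "n \<ge> 5" "\<sigma> \<in> {-1, 1}" by (rule n5, rule sigma)
    show "t (i + int n) *\<^sub>R h (i + int n) = t i *\<^sub>R h i" for i by (simp add: t_def N_def periodic)
    show "\<sigma> * det3 (t i *\<^sub>R h i) (t (i + 1) *\<^sub>R h (i + 1)) (t j *\<^sub>R h j) > 0"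
      if "j mod int n \<noteq> i mod int n" "j mod int n \<noteq> (i + 1) mod int n" for i j
    proof -
      have "t i * (t (i+1) * (t j * (\<sigma> * det3 (h i) (h (i+1)) (h j)))) > 0"
        by (rule mult_pos_pos[OF t mult_pos_pos[OF t mult_pos_pos[OF t convex[OF that]]]])
      then show ?thesis by (simp only: det3_scale mult.left_commute)
    qed
    show "Finite_Cartesian_Product.transpose (c *\<^sub>R S) = c *\<^sub>R S"
      using S(1) by (simp add: transpose_scalar)
    show "invertible (c *\<^sub>R S)" using S(2) c by (simp add: scalar_invertible)
  qed (use unit tan in auto)
  then show ?thesis using that c t by blast
qed

end

text \<open>Half the polar angle of \<open>(q, -2 r)\<close>: rotating by it diagonalizes a
  symmetric 2 by 2 matrix with diagonal difference \<open>q\<close> and off-diagonal entry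
  \<open>r\<close>.\<close>

lemma rotation_angle_exists:
  fixes q r :: real
  obtains c s where "c\<^sup>2 + s\<^sup>2 = 1" "c * s * q + (c\<^sup>2 - s\<^sup>2) * r = 0"
proof (cases "q = 0 \<and> r = 0")
  case True
  then show ?thesis using that[of 1 0] by simp
next
  case False
  define z where "z = sqrt (q\<^sup>2 + (2 * r)\<^sup>2)"
  have pos: "q\<^sup>2 + (2 * r)\<^sup>2 > 0" using False sum_power2_gt_zero_iff[of q "2 * r"] by auto
  then have z: "z > 0" "z\<^sup>2 = q\<^sup>2 + (2 * r)\<^sup>2" by (simp_all add: z_def)
  have "(q / z)\<^sup>2 + (- 2 * r / z)\<^sup>2 = (q\<^sup>2 + (2 * r)\<^sup>2) / z\<^sup>2"
    by (simp add: power_divide add_divide_distrib)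
  also have "\<dots> = 1" using z pos by simp
  finally obtain \<phi> where \<phi>: "q / z = cos \<phi>" "- 2 * r / z = sin \<phi>"
    using sincos_total_2pi by blast
  have "sin \<phi> = 2 * (cos (\<phi> / 2) * sin (\<phi> / 2))" "cos \<phi> = (cos (\<phi> / 2))\<^sup>2 - (sin (\<phi> / 2))\<^sup>2"
    using sin_double[of "\<phi>/2"] cos_double[of "\<phi>/2"] by simp_all
  then have "cos (\<phi> / 2) * sin (\<phi> / 2) = - r / z" "(cos (\<phi> / 2))\<^sup>2 - (sin (\<phi> / 2))\<^sup>2 = q / z"
    using \<phi> by simp_all
  then show ?thesis using that[of "cos (\<phi>/2)" "sin (\<phi>/2)"] by simp
qed

text \<open>Two null vectors with negative product lie on one nappe of the cone, and no vector of
  the closed cone has products of opposite sign with them. The Gram determinant makes this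
  quantitative.\<close>

lemma null_cone_positive:
  assumes S: "Finite_Cartesian_Product.transpose S = S" "Determinants.det S < 0"
    and "bform S p p = 0" "bform S q q = 0" "bform S p q < 0"
    and "bform S p w > 0" "bform S q w < 0"
  shows "bform S w w > 0"
proof -
  note sym = bform_sym[OF S(1)]
  define a b c where "a = bform S p w" "b = bform S q w" "c = bform S p q"
  have "2 * (c * a * b) - c\<^sup>2 * bform S w w = Determinants.det S * (det3 p q w)\<^sup>2"
    using bform_gram[of S p q w] assms(3,4) sym[of q p] sym[of w p] sym[of w q]
    by (simp add: a_b_c_def power2_eq_square algebra_simps)
  also have "\<dots> \<le> 0" using S(2) by (simp add: mult_le_0_iff)
  finally have "2 * (c * a * b) \<le> c\<^sup>2 * bform S w w" by simp
  moreover have "c * a * b > 0" using assms by (simp add: a_b_c_def zero_less_mult_iff mult_less_0_iff)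
  ultimately have "c\<^sup>2 * bform S w w > 0" by linarith
  then show ?thesis by (simp add: zero_less_mult_iff)
qed

lemma continuous_on_bform [continuous_intros]:
  "continuous_on A (\<lambda>x. bform S (f x) (g x))" if "continuous_on A f" "continuous_on A g"
  unfolding bform_def using that
  by (intro continuous_intros matrix_vector_mult_linear_continuous_on[THEN continuous_on_compose2[of UNIV]]) auto

section \<open>Simultaneous diagonalization of the two conics\<close>

text \<open>\<open>B\<close> is the outer form with its sign chosen so that it is Lorentzian and all
  \<open>g i\<close> lie on one nappe of its null cone.\<close>

locale nested_pair = circumscribed_sequence n \<sigma> g S for n \<sigma> g S +
  fixes B :: "real^3^3"
  assumes B_sym: "Finite_Cartesian_Product.transpose B = B" and B_det: "Determinants.det B < 0"
    and B_null: "bform B (g i) (g i) = 0"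
    and B_neg: "i < j \<Longrightarrow> j < i + int n \<Longrightarrow> bform B (g i) (g j) < 0"
begin

lemmas Bs = bform_sym[OF B_sym]

text \<open>\<open>N (x i)\<close> is a negative multiple of the equation of side \<open>i\<close>,
  which is nonnegative at the two vertices whose sum is \<open>x j\<close> and positive at one of
  them. So the points of tangency, too, lie on one nappe.\<close>

lemma N_x_x_neg:
  assumes "i mod int n \<noteq> j mod int n"
  shows "N (x i) (x j) < 0"
proof -
  have "N (x i) (x j) = N (x i) (g j) + N (x i) (g (j + 1))"
    by (subst (2) x_eq) (simp add: bform_linear)
  then have eq: "N (x i) (x j) = k 0 * (D (g i) (g (i + 1)) (g j) + D (g i) (g (i + 1)) (g (j + 1)))"
    unfolding N_x k_const[of i] by (simp add: distrib_left)
  have "D (g i) (g (i + 1)) (g j) > 0 \<or> D (g i) (g (i + 1)) (g (j + 1)) > 0"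
  proof (cases "j mod int n = (i + 1) mod int n")
    case True
    then have *: "(j + 1) mod int n = (i + 2) mod int n" by (metis mod_add_left_eq add.assoc one_add_one)
    have "(i + 2) mod int n \<noteq> i mod int n" "(i + 2) mod int n \<noteq> (i + 1) mod int n"
      using int_mod_neq_of_less[of i "i + 2" n] int_mod_neq_of_less[of "i + 1" "i + 2" n] n5 by simp_all
    then show ?thesis using convex[of "j + 1" i] * by (simp add: D_def)
  next
    case False
    then show ?thesis using convex[of j i] assms by (simp add: D_def)
  qed
  then have "D (g i) (g (i + 1)) (g j) + D (g i) (g (i + 1)) (g (j + 1)) > 0"
    using D_nonneg[of i j] D_nonneg[of i "j + 1"] by linarith
  then show ?thesis unfolding eq using k_neg by (simp add: mult_less_0_iff)
qed

text \<open>In a nonnegative combination of vertices all mixed terms of \<open>B\<close> are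
  nonpositive, so it is null only if it is a multiple of one vertex; there \<open>N\<close> is
  positive by normalization.\<close>

lemma N_pos_on_cone:
  assumes w: "bform B w w = 0" "w \<noteq> 0" and nn: "\<And>i. D (g i) (g (i + 1)) w \<ge> 0"
  shows "N w w > 0"
proof -
  obtain j a b c where j: "0 < j" "j + 1 < int n" and abc: "a \<ge> 0" "b \<ge> 0" "c \<ge> 0"
    and we: "w = a *\<^sub>R g 0 + b *\<^sub>R g j + c *\<^sub>R g (j + 1)" by (rule fan[OF nn])
  have neg: "bform B (g 0) (g j) < 0" "bform B (g 0) (g (j + 1)) < 0" "bform B (g j) (g (j + 1)) < 0"
    using B_neg[of 0 j] B_neg[of 0 "j + 1"] B_neg[of j "j + 1"] j by simp_all
  have "0 = 2 * (a * b * bform B (g 0) (g j) + a * c * bform B (g 0) (g (j + 1)) + b * c * bform B (g j) (g (j + 1)))"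
    using w(1) Bs[of "g j" "g 0"] Bs[of "g (j+1)" "g 0"] Bs[of "g (j+1)" "g j"]
    unfolding we by (simp add: bform_linear B_null algebra_simps)
  moreover have "a * b * bform B (g 0) (g j) \<le> 0" "a * c * bform B (g 0) (g (j + 1)) \<le> 0"
    "b * c * bform B (g j) (g (j + 1)) \<le> 0" using abc neg by (simp_all add: mult_nonneg_nonpos)
  moreover have "u = 0 \<and> v = 0 \<and> w = 0" if "0 = 2 * (u + v + w)" "u \<le> 0" "v \<le> 0" "w \<le> 0" for u v w :: real
    using that by argo
  ultimately have "a * b * bform B (g 0) (g j) = 0 \<and> a * c * bform B (g 0) (g (j + 1)) = 0
    \<and> b * c * bform B (g j) (g (j + 1)) = 0" by blast
  then have "a * b = 0" "a * c = 0" "b * c = 0" using neg by simp_all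
  then obtain t i where t: "w = t *\<^sub>R g i"
    unfolding we by (metis add.right_neutral add_0 mult_eq_0_iff scaleR_eq_0_iff)
  then have "t \<noteq> 0" using w by auto
  then have "t * t > 0" using not_real_square_gt_zero by blast
  then show ?thesis unfolding t by (simp add: bform_linear unit)
qed

text \<open>Geometrically, the outer conic lies outside the inner one. Either \<open>w\<close> or
  \<open>- w\<close> belongs to the cone over the polygon, or two sides see \<open>w\<close> with
  opposite signs and their points of tangency satisfy \<open>null_cone_positive\<close>.\<close>

lemma N_pos_on_null:
  assumes w: "bform B w w = 0" "w \<noteq> 0"
  shows "N w w > 0"
proof -
  consider "\<And>i. D (g i) (g (i + 1)) w \<ge> 0" | "\<And>i. D (g i) (g (i + 1)) w \<le> 0"
    | i j where "D (g i) (g (i + 1)) w < 0" "D (g j) (g (j + 1)) w > 0"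
    by (meson not_le)
  then show ?thesis
  proof cases
    case 1 then show ?thesis using N_pos_on_cone w by blast
  next
    case 2
    have "D (g i) (g (i + 1)) (- w) \<ge> 0" for i using 2[of i] by (simp add: D_def det3_expand algebra_simps)
    then show ?thesis using N_pos_on_cone[of "- w"] w by (simp add: bform_linear)
  next
    case 3
    have ne: "i mod int n \<noteq> j mod int n"
    proof
      assume "i mod int n = j mod int n"
      moreover have "(i + 1) mod int n = (j + 1) mod int n" using calculation by (metis mod_add_left_eq)
      ultimately have "g i = g j" "g (i + 1) = g (j + 1)" by (auto intro: periodic_mod)
      then show False using 3 by simp
    qed
    show ?thesis
    proof (rule null_cone_positive[OF S_sym det_neg])
      show "N (x i) (x i) = 0" "N (x j) (x j) = 0" by (rule x_orth)+
      show "N (x i) (x j) < 0" by (rule N_x_x_neg[OF ne])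
      show "N (x i) w > 0" "N (x j) w < 0" unfolding N_x k_const[of i] k_const[of j]
        using k_neg 3 by (simp_all add: mult_neg_neg mult_less_0_iff)
    qed
  qed
qed

text \<open>On the compact set \<open>K\<close> the form \<open>B\<close> is nowhere zero by
  \<open>N_pos_on_null\<close>, so the quotient \<open>N / B\<close> has a maximum. The maximum is
  positive, hence both forms are negative at the maximizer, all small variations stay in the cone,
  and the first variation yields the eigenvector equation.\<close>

lemma common_eigenvector:
  obtains y m where "m > 0" "bform B y y < 0" "\<And>v. N y v = m * bform B y v"
proof -
  define K where "K = sphere 0 1 \<inter> {z. N z z \<le> 0} \<inter> {z. bform B z z \<le> 0}"
  have cN: "continuous_on A (\<lambda>z. bform M z z)" for A M by (intro continuous_intros)
  have "compact K" unfolding K_def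
    by (intro compact_Int_closed closed_Collect_le cN continuous_intros compact_sphere)
  moreover have Bneg: "bform B z z < 0" if "z \<in> K" for z
  proof -
    have "z \<noteq> 0" using that by (auto simp: K_def)
    then have "bform B z z \<noteq> 0" using that N_pos_on_null[of z] by (auto simp: K_def)
    then show ?thesis using that by (simp add: K_def less_le)
  qed
  have normalise: "\<exists>t>0. t *\<^sub>R z \<in> K" if "N z z \<le> 0" "bform B z z \<le> 0" "z \<noteq> 0" for z
    using that by (intro exI[of _ "1 / norm z"]) (simp add: K_def bform_linear divide_nonpos_nonneg)
  \<comment> \<open>Removing from the null vector \<open>x 0\<close> its component along the unit
    vector \<open>g 2\<close> leaves minus the square of that component as the value of
    \<open>N\<close>. This shows that \<open>K\<close> is nonempty and that the maximum is
    positive.\<close>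
  define z0 where "z0 = x 0 - N (x 0) (g 2) *\<^sub>R g 2"
  have "N (x 0) (g 2) < 0"
    using N_x[of 0 "g 2"] D_pos[of 0 1 2] n5 k_neg by (simp add: mult_less_0_iff)
  then have z0: "N z0 z0 < 0"
    using N_sym[of "g 2" "x 0"] by (simp add: z0_def bform_linear x_orth unit mult_neg_neg)
  have "bform B z0 z0 = 2 * (bform B (g 0) (g 1) - N (x 0) (g 2) * (bform B (g 0) (g 2) + bform B (g 1) (g 2)))"
    using Bs[of "g 1" "g 0"] Bs[of "g 2" "g 0"] Bs[of "g 2" "g 1"] x_eq[of 0]
    by (simp add: z0_def bform_linear B_null algebra_simps)
  moreover have "N (x 0) (g 2) * (bform B (g 0) (g 2) + bform B (g 1) (g 2)) > 0"
    using \<open>N (x 0) (g 2) < 0\<close> B_neg[of 0 2] B_neg[of 1 2] n5 by (simp add: mult_neg_neg)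
  ultimately have z0B: "bform B z0 z0 < 0" using B_neg[of 0 1] n5 by simp
  have "z0 \<noteq> 0" using z0 by auto
  then obtain t0 where t0: "t0 > 0" "t0 *\<^sub>R z0 \<in> K" using normalise[of z0] z0 z0B by auto
  define f where "f z = N z z / bform B z z" for z
  have "continuous_on K f" unfolding f_def
    by (intro continuous_on_divide cN) (use Bneg in force)
  then obtain y where y: "y \<in> K" "\<And>z. z \<in> K \<Longrightarrow> f z \<le> f y"
    using continuous_attains_sup[OF \<open>compact K\<close>, of f] t0(2) by blast
  define m where "m = f y"
  have fscale: "f (t *\<^sub>R z) = f z" if "t > 0" for t z using that by (simp add: f_def bform_linear)
  have "f z0 > 0" using z0 z0B by (simp add: f_def zero_less_divide_iff)
  then have m: "m > 0" using y(2)[OF t0(2)] fscale[OF t0(1)] by (simp add: m_def)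
  have yB: "bform B y y < 0" using Bneg y(1) .
  have yN: "N y y = m * bform B y y" using yB by (simp add: m_def f_def)
  then have yNneg: "N y y < 0" using m yB by (simp add: mult_less_0_iff)
  have "N y v = m * bform B y v" for v
  proof -
    \<comment> \<open>As \<open>B\<close> is negative, maximality of the quotient says that
      \<open>q\<close> is nonnegative near its zero at 0; its linear coefficient
      \<open>2 * L\<close> must vanish.\<close>
    define q where "q t = N (y + t *\<^sub>R v) (y + t *\<^sub>R v) - m * bform B (y + t *\<^sub>R v) (y + t *\<^sub>R v)" for t
    define L Q where "L = N y v - m * bform B y v" and "Q = N v v - m * bform B v v"
    have q: "q t = 2 * t * L + t\<^sup>2 * Q" for t
      using N_sym[of v y] Bs[of v y]
      by (simp add: q_def L_def Q_def bform_linear yN algebra_simps power2_eq_square)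
    have tend: "((\<lambda>t. bform M (y + t *\<^sub>R v) (y + t *\<^sub>R v)) \<longlongrightarrow> bform M y y) (at 0)" for M
    proof -
      have "continuous_on UNIV (\<lambda>t. bform M (y + t *\<^sub>R v) (y + t *\<^sub>R v))" by (intro continuous_intros)
      then have "isCont (\<lambda>t. bform M (y + t *\<^sub>R v) (y + t *\<^sub>R v)) 0" by (simp add: continuous_on_eq_continuous_at)
      then show ?thesis by (simp add: isCont_def)
    qed
    have "eventually (\<lambda>t. N (y + t *\<^sub>R v) (y + t *\<^sub>R v) < 0 \<and> bform B (y + t *\<^sub>R v) (y + t *\<^sub>R v) < 0) (at 0)"
      using order_tendstoD(2)[OF tend yNneg] order_tendstoD(2)[OF tend yB] by (rule eventually_conj)
    then obtain d where d: "d > 0" "\<And>t. t \<noteq> 0 \<Longrightarrow> \<bar>t\<bar> < d \<Longrightarrow>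
        N (y + t *\<^sub>R v) (y + t *\<^sub>R v) < 0 \<and> bform B (y + t *\<^sub>R v) (y + t *\<^sub>R v) < 0"
      by (auto simp: eventually_at dist_real_def)
    have qnn: "q t \<ge> 0" if "\<bar>t\<bar> < d" for t
    proof (cases "t = 0")
      case True then show ?thesis by (simp add: q)
    next
      case False
      define z where "z = y + t *\<^sub>R v"
      have z: "N z z < 0" "bform B z z < 0" using d(2)[OF False that] by (simp_all add: z_def)
      then have "z \<noteq> 0" by auto
      then obtain r where "r > 0" "r *\<^sub>R z \<in> K" using normalise[of z] z by auto
      then have "f z \<le> m" using y(2) fscale[of r z] by (metis m_def)
      then have "N z z \<ge> m * bform B z z" using z by (simp add: f_def divide_le_eq)
      then show ?thesis by (simp add: q_def z_def)
    qed
    have "(q has_real_derivative 2 * L) (at 0)"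
      unfolding q[abs_def] by (auto intro!: derivative_eq_intros)
    then have "2 * L = 0"
      by (rule DERIV_local_min[OF _ d(1)]) (use qnn in \<open>simp add: q[of 0]\<close>)
    then show ?thesis by (simp add: L_def)
  qed
  then show ?thesis using that m yB by blast
qed

text \<open>The normalized common eigenvector is the third axis. On its orthogonal complement
  \<open>B\<close> is positive definite by the Gram determinant, so Gram-Schmidt followed by a
  rotation diagonalizes \<open>N\<close> there.\<close>

lemma simultaneous_diagonalization:
  obtains E1 E2 E3 n1 n2 m where
    "bform B E1 E1 = 1" "bform B E2 E2 = 1" "bform B E3 E3 = -1"
    "bform B E1 E2 = 0" "bform B E1 E3 = 0" "bform B E2 E3 = 0"
    "N E1 E1 = n1" "N E2 E2 = n2" "N E3 E3 = - m" "N E1 E2 = 0" "N E1 E3 = 0" "N E2 E3 = 0"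
    "det3 E1 E2 E3 \<noteq> 0" "0 < m" "m < n1" "n1 \<le> n2"
proof -
  obtain y m where m: "m > 0" and y: "bform B y y < 0" "\<And>v. N y v = m * bform B y v"
    using common_eigenvector by blast
  define E3 where "E3 = (1 / sqrt (- bform B y y)) *\<^sub>R y"
  have E3: "bform B E3 E3 = -1" "\<And>v. N E3 v = m * bform B E3 v"
    using y real_sqrt_mult_self[of "- bform B y y"] by (auto simp: E3_def bform_linear)
  \<comment> \<open>Three vertices span the space, so \<open>E3\<close> is completed to a basis by
    some two of them; their projections span the complement of \<open>E3\<close>.\<close>
  have "det3 E3 (g 0) (g 1) \<noteq> 0 \<or> det3 E3 (g 0) (g 2) \<noteq> 0 \<or> det3 E3 (g 1) (g 2) \<noteq> 0"
  proof (rule ccontr)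
    assume "\<not> ?thesis"
    then have "det3 (g 0) (g 1) (g 2) *\<^sub>R E3 = 0"
      by (subst det3_cramer) (simp add: det3_expand algebra_simps)
    then have "E3 = 0" using det3_neq_0[of 0 1 2] n5 by simp
    then show False using E3 by simp
  qed
  then obtain i j where ij: "det3 E3 (g i) (g j) \<noteq> 0" by blast
  define p where "p i = g i + bform B (g i) E3 *\<^sub>R E3" for i
  have pE: "bform B (p i) E3 = 0" "bform B E3 (p i) = 0" for i
    using Bs[of E3 "g i"] by (simp_all add: p_def bform_linear E3)
  define b11 b12 b22 where "b11 = bform B (p i) (p i)" "b12 = bform B (p i) (p j)" "b22 = bform B (p j) (p j)"
  note b_def = this
  have "b11 = (bform B (g i) E3)\<^sup>2"
    using Bs[of E3 "g i"] by (simp add: b_def p_def bform_linear E3 B_null power2_eq_square)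
  then have b11: "b11 \<ge> 0" by simp
  have "det3 E3 (p i) (p j) = det3 E3 (g i) (g j)" by (simp add: p_def det3_add det3_scale)
  moreover have "- (b11 * b22 - b12\<^sup>2) = Determinants.det B * (det3 E3 (p i) (p j))\<^sup>2"
    using bform_gram[of B E3 "p i" "p j"] Bs[of "p j" "p i"] by (simp add: b_def pE E3 power2_eq_square)
  moreover have "Determinants.det B * (det3 E3 (g i) (g j))\<^sup>2 < 0" using ij B_det by (simp add: mult_less_0_iff)
  ultimately have disc: "b11 * b22 > b12\<^sup>2" by simp
  then have b11: "b11 > 0" using b11 by (cases "b11 = 0") auto
  define F1 where "F1 = (1 / sqrt b11) *\<^sub>R p i"
  define f where "f = p j - (b12 / b11) *\<^sub>R p i"
  have F1: "bform B F1 F1 = 1" using b11 real_sqrt_mult_self[of b11] by (simp add: F1_def bform_linear b_def)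
  have ff: "bform B f f = (b11 * b22 - b12\<^sup>2) / b11"
    using b11 Bs[of "p j" "p i"] by (simp add: f_def bform_linear b_def[symmetric] power2_eq_square field_simps)
  then have f: "bform B f f > 0" using disc b11 by simp
  have pf: "bform B (p i) f = 0" using b11 by (simp add: f_def bform_linear b_def[symmetric])
  define F2 where "F2 = (1 / sqrt (bform B f f)) *\<^sub>R f"
  have F2: "bform B F2 F2 = 1" using f real_sqrt_mult_self[of "bform B f f"] by (simp add: F2_def bform_linear)
  have F12: "bform B F1 F2 = 0" by (simp add: F1_def F2_def bform_linear pf)
  have FE: "bform B F1 E3 = 0" "bform B F2 E3 = 0" by (simp_all add: F1_def F2_def f_def bform_linear pE)
  obtain c s where cs: "c\<^sup>2 + s\<^sup>2 = 1" "c * s * (N F2 F2 - N F1 F1) + (c\<^sup>2 - s\<^sup>2) * N F1 F2 = 0"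
    by (rule rotation_angle_exists)
  define E1 E2 where "E1 = c *\<^sub>R F1 + s *\<^sub>R F2" and "E2 = c *\<^sub>R F2 - s *\<^sub>R F1"
  have cs': "c * c + s * s = 1" using cs(1) by (simp add: power2_eq_square)
  have B11: "bform B E1 E1 = 1" "bform B E2 E2 = 1" "bform B E1 E2 = 0" "bform B E1 E3 = 0" "bform B E2 E3 = 0"
    using cs' Bs[of F2 F1] by (simp_all add: E1_def E2_def bform_linear F1 F2 F12 FE)
  have N12: "N E1 E2 = 0"
    using cs(2) N_sym[of F2 F1] by (simp add: E1_def E2_def bform_linear power2_eq_square algebra_simps)
  have N13: "N E1 E3 = 0" "N E2 E3 = 0"
    using E3(2)[of E1] E3(2)[of E2] N_sym[of E1 E3] N_sym[of E2 E3] Bs[of E3 E1] Bs[of E3 E2] B11 by simp_all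
  have N33: "N E3 E3 = - m" using E3 by simp
  have "Determinants.det B * (det3 E1 E2 E3)\<^sup>2 = -1"
    using bform_gram[of B E1 E2 E3] B11 E3(1) Bs[of E2 E1] Bs[of E3 E1] Bs[of E3 E2] by simp
  then have det: "det3 E1 E2 E3 \<noteq> 0" by auto
  \<comment> \<open>The vector \<open>E + E3\<close> is null for \<open>B\<close>, so nestedness of
    the conics gives the strict inequality, that is, 1 < alpha.\<close>
  have larger: "m < N E E" if "bform B E E = 1" "bform B E E3 = 0" "N E E3 = 0" for E
  proof -
    have "bform B (E + E3) (E + E3) = 0" using that Bs[of E3 E] by (simp add: bform_linear E3)
    moreover have "bform B E (E + E3) = 1" using that by (simp add: bform_linear)
    then have "E + E3 \<noteq> 0" by auto
    ultimately have "N (E + E3) (E + E3) > 0" by (rule N_pos_on_null)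
    then show ?thesis using that N_sym[of E3 E] by (simp add: bform_linear N33)
  qed
  show ?thesis
  proof (cases "N E1 E1 \<le> N E2 E2")
    case True
    then show ?thesis using that[OF B11(1,2) E3(1) B11(3-5) refl refl N33 N12 N13 det m] larger[of E1] B11 N13 by simp
  next
    case False
    have "bform B E2 E1 = 0" "N E2 E1 = 0" "det3 E2 E1 E3 \<noteq> 0"
      using B11 N12 Bs[of E2 E1] N_sym[of E2 E1] det det3_swap[of E2 E1 E3] by simp_all
    then show ?thesis using that[OF B11(2,1) E3(1) _ B11(5,4) refl refl N33 _ N13(2,1) _ m] larger[of E2] B11 N13 False by simp
  qed
qed

end

section \<open>The normal form\<close>

text \<open>The vertices of P come from the points of r with even index, so r has period 2n.\<close>

locale poncelet_normal_form =
  fixes n :: nat and M :: "real^3^3" and r :: "int \<Rightarrow> real^2" and \<alpha> \<beta> :: real and P :: polygon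
  assumes n5: "n \<ge> 5" and M_inv: "invertible M"
    and r_periodic: "r (j + 2 * int n) = r j"
    and r_circle: "(r j $ 1)\<^sup>2 + (r j $ 2)\<^sup>2 = 1"
    and r_chord: "\<alpha> * r j $ 1 * r (j + 1) $ 1 + \<beta> * r j $ 2 * r (j + 1) $ 2 = 1"
    and r_neq: "r j \<noteq> r (j + 2)"
    and alpha_gt_1: "1 < \<alpha>" and alpha_less_beta: "\<alpha> < \<beta>"
    and small_step: "\<alpha>\<^sup>2 * \<beta>\<^sup>2 < \<alpha>\<^sup>2 + \<beta>\<^sup>2"
    and vertices: "\<exists>c>0. M *v hom_coords (r (2 * i)) = c *\<^sub>R hom_coords (P i)"

text \<open>The pole \<open>w\<close> is perpendicular to the chord from \<open>p\<close> to
  \<open>q\<close>, whose midpoint is \<open>w\<close> divided by its squared norm.\<close>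

lemma vec2_circle_pole:
  fixes p q w :: "real^2"
  assumes "(p$1)\<^sup>2 + (p$2)\<^sup>2 = 1" "(q$1)\<^sup>2 + (q$2)\<^sup>2 = 1" "p \<noteq> q"
    and "w$1 * p$1 + w$2 * p$2 = 1" "w$1 * q$1 + w$2 * q$2 = 1"
  shows "((w$1)\<^sup>2 + (w$2)\<^sup>2) * (p$1 + q$1) = 2 * w$1" "((w$1)\<^sup>2 + (w$2)\<^sup>2) * (p$2 + q$2) = 2 * w$2"
proof -
  define d1 d2 s1 s2 where "d1 = p$1 - q$1" "d2 = p$2 - q$2" "s1 = p$1 + q$1" "s2 = p$2 + q$2"
  note defs = this
  have d: "d1 \<noteq> 0 \<or> d2 \<noteq> 0" using assms(3) by (auto simp: defs vec2_eq_iff)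
  have wd: "w$1 * d1 + w$2 * d2 = 0" using assms(4,5) by (simp add: defs algebra_simps)
  have sd: "s1 * d1 + s2 * d2 = 0" using assms(1,2) by (simp add: defs algebra_simps power2_eq_square)
  have ws: "w$1 * s1 + w$2 * s2 = 2" using assms(4,5) by (simp add: defs algebra_simps)
  have "d1 * (w$1 * s2 - w$2 * s1) = s2 * (w$1 * d1 + w$2 * d2) - w$2 * (s1 * d1 + s2 * d2)"
    "d2 * (w$1 * s2 - w$2 * s1) = w$1 * (s1 * d1 + s2 * d2) - s1 * (w$1 * d1 + w$2 * d2)"
    by (simp_all add: algebra_simps)
  then have "w$1 * s2 - w$2 * s1 = 0" using d unfolding wd sd by auto
  then have par: "w$1 * s2 = w$2 * s1" by simp
  have "((w$1)\<^sup>2 + (w$2)\<^sup>2) * s1 = w$1 * (w$1 * s1 + w$2 * s2) - w$2 * (w$1 * s2 - w$2 * s1)"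
    "((w$1)\<^sup>2 + (w$2)\<^sup>2) * s2 = w$2 * (w$1 * s1 + w$2 * s2) + w$1 * (w$1 * s2 - w$2 * s1)"
    by (simp_all add: algebra_simps power2_eq_square)
  then show "((w$1)\<^sup>2 + (w$2)\<^sup>2) * (p$1 + q$1) = 2 * w$1" "((w$1)\<^sup>2 + (w$2)\<^sup>2) * (p$2 + q$2) = 2 * w$2"
    unfolding ws par defs[symmetric] by simp_all
qed

text \<open>The line through \<open>p\<close> and \<open>q\<close> has the pole
  \<open>(X, Y)\<close>, which runs over an ellipse as \<open>s\<close> runs over the circle. The
  coordinate products of \<open>p\<close> and \<open>q\<close> are rational in \<open>X^2\<close>
  and \<open>Y^2\<close>, and the ellipse equation makes them satisfy a fixed linear relation: two
  steps of the chain obey a law of the same shape as one.\<close>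

lemma chord_doubling:
  fixes p q s :: "real^2" and \<alpha> \<beta> :: real
  assumes p: "(p$1)\<^sup>2 + (p$2)\<^sup>2 = 1" and q: "(q$1)\<^sup>2 + (q$2)\<^sup>2 = 1" and s: "(s$1)\<^sup>2 + (s$2)\<^sup>2 = 1" and "p \<noteq> q"
    and lp: "\<alpha> * s$1 * p$1 + \<beta> * s$2 * p$2 = 1" and lq: "\<alpha> * s$1 * q$1 + \<beta> * s$2 * q$2 = 1"
  shows "(\<alpha>\<^sup>2 * \<beta>\<^sup>2 + \<alpha>\<^sup>2 - \<beta>\<^sup>2) * p$1 * q$1 + (\<alpha>\<^sup>2 * \<beta>\<^sup>2 + \<beta>\<^sup>2 - \<alpha>\<^sup>2) * p$2 * q$2 = \<alpha>\<^sup>2 + \<beta>\<^sup>2 - \<alpha>\<^sup>2 * \<beta>\<^sup>2"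
proof -
  define X Y where "X = \<alpha> * s$1" and "Y = \<beta> * s$2"
  define v where "v = X\<^sup>2 + Y\<^sup>2"
  have lp': "X * p$1 + Y * p$2 = 1" using lp by (simp add: X_def Y_def)
  have sum: "v * (p$1 + q$1) = 2 * X" "v * (p$2 + q$2) = 2 * Y"
    using vec2_circle_pole[OF p q \<open>p \<noteq> q\<close>, of "vector [X, Y]"] lp lq by (simp_all add: X_def Y_def v_def)
  have v: "v > 0"
    using lp' by (auto simp: v_def sum_power2_gt_zero_iff)
  \<comment> \<open>Lagrange's identity: a unit vector whose product with the pole is 1 has a cross
    product with the pole known up to sign.\<close>
  have "v * 1 = (Y * p$1 - X * p$2)\<^sup>2 + (X * p$1 + Y * p$2)\<^sup>2"
    unfolding p[symmetric] v_def by (simp add: algebra_simps power2_eq_square)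
  then have cross: "(Y * p$1 - X * p$2)\<^sup>2 = v - 1" unfolding lp' by simp
  have "v * p$1 - X * (X * p$1 + Y * p$2) = Y * (Y * p$1 - X * p$2)"
    "v * p$2 - Y * (X * p$1 + Y * p$2) = - (X * (Y * p$1 - X * p$2))"
    by (simp_all add: v_def algebra_simps power2_eq_square)
  then have "v * p$1 - X = Y * (Y * p$1 - X * p$2)" "v * p$2 - Y = - (X * (Y * p$1 - X * p$2))"
    unfolding lp' by simp_all
  then have "(v * p$1 - X)\<^sup>2 = Y\<^sup>2 * (v - 1)" "(v * p$2 - Y)\<^sup>2 = X\<^sup>2 * (v - 1)"
    using cross by (simp_all add: power_mult_distrib)
  moreover have "v * (v * (p$1 * q$1)) = X\<^sup>2 - (v * p$1 - X)\<^sup>2" "v * (v * (p$2 * q$2)) = Y\<^sup>2 - (v * p$2 - Y)\<^sup>2"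
  proof -
    have "v * (v * (p$1 * q$1)) = v * p$1 * (v * (p$1 + q$1) - v * p$1)" by (simp add: algebra_simps)
    then show "v * (v * (p$1 * q$1)) = X\<^sup>2 - (v * p$1 - X)\<^sup>2" unfolding sum by (simp add: algebra_simps power2_eq_square)
    have "v * (v * (p$2 * q$2)) = v * p$2 * (v * (p$2 + q$2) - v * p$2)" by (simp add: algebra_simps)
    then show "v * (v * (p$2 * q$2)) = Y\<^sup>2 - (v * p$2 - Y)\<^sup>2" unfolding sum by (simp add: algebra_simps power2_eq_square)
  qed
  ultimately have prod: "v * (v * (p$1 * q$1)) = X\<^sup>2 - Y\<^sup>2 * (v - 1)" "v * (v * (p$2 * q$2)) = Y\<^sup>2 - X\<^sup>2 * (v - 1)" by simp_all
  have XY: "\<beta>\<^sup>2 * X\<^sup>2 + \<alpha>\<^sup>2 * Y\<^sup>2 = \<alpha>\<^sup>2 * \<beta>\<^sup>2"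
  proof -
    have "\<beta>\<^sup>2 * X\<^sup>2 + \<alpha>\<^sup>2 * Y\<^sup>2 = \<alpha>\<^sup>2 * \<beta>\<^sup>2 * ((s$1)\<^sup>2 + (s$2)\<^sup>2)"
      by (simp add: X_def Y_def algebra_simps power_mult_distrib)
    then show ?thesis by (simp add: s)
  qed
  define a b where "a = \<alpha>\<^sup>2" and "b = \<beta>\<^sup>2"
  define U W where "U = X\<^sup>2" and "W = Y\<^sup>2"
  have XY': "b * U + a * W = a * b" using XY by (simp add: a_def b_def U_def W_def)
  have vUW: "v = U + W" by (simp add: v_def U_def W_def)
  have "v * (v * ((a * b + a - b) * p$1 * q$1 + (a * b + b - a) * p$2 * q$2))
      = (a * b + a - b) * (v * (v * (p$1 * q$1))) + (a * b + b - a) * (v * (v * (p$2 * q$2)))"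
    by (simp add: algebra_simps)
  also have "\<dots> = (a * b + a - b) * (U - W * (v - 1)) + (a * b + b - a) * (W - U * (v - 1))"
    unfolding prod U_def W_def ..
  \<comment> \<open>The error term is a multiple of the ellipse equation \<open>XY'\<close>.\<close>
  also have "\<dots> = v * (v * (a + b - a * b)) + 2 * v * (a * b - (b * U + a * W))"
    unfolding vUW by (simp add: algebra_simps)
  also have "\<dots> = v * (v * (a + b - a * b))" unfolding XY' by simp
  finally show ?thesis using v by (simp add: a_def b_def)
qed

lemma column_matrix_mult:
  "Finite_Cartesian_Product.transpose (vector [a, b, c] :: real^3^3) *v w = w$1 *\<^sub>R a + w$2 *\<^sub>R b + w$3 *\<^sub>R c"
  by (simp add: vec3_eq_iff matrix_mult_vec_3 Finite_Cartesian_Product.transpose_def mult.commute)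

lemma det_column_matrix: "Determinants.det (Finite_Cartesian_Product.transpose (vector [a, b, c] :: real^3^3)) = det3 a b c"
  by (simp add: det3_def)

lemma det_scaleR_3: "Determinants.det (c *\<^sub>R A :: real^3^3) = c^3 * Determinants.det A"
  by (simp add: Determinants.det_3 power3_eq_cube algebra_simps)

lemma hom_coords_nth [simp]: "hom_coords p $ 1 = p $ 1" "hom_coords p $ 2 = p $ 2" "hom_coords p $ 3 = 1"
  by (simp_all add: hom_coords_def)

section \<open>Coordinates adapted to both conics, and the chain on the circle\<close>

text \<open>\<open>E3_g\<close> orients the timelike axis so that every vertex has positive third
  coordinate \<open>Z\<close>; dividing by it then keeps all orientations.\<close>

locale diagonal_pair = nested_pair n \<sigma> g S B for n \<sigma> g S B +
  fixes E1 E2 E3 :: "real^3" and n1 n2 m :: real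
  assumes B_E: "bform B E1 E1 = 1" "bform B E2 E2 = 1" "bform B E3 E3 = -1"
      "bform B E1 E2 = 0" "bform B E1 E3 = 0" "bform B E2 E3 = 0"
    and N_E: "N E1 E1 = n1" "N E2 E2 = n2" "N E3 E3 = - m" "N E1 E2 = 0" "N E1 E3 = 0" "N E2 E3 = 0"
    and E_det: "det3 E1 E2 E3 \<noteq> 0" and m_pos: "0 < m" and m_less: "m < n1" and n1_le: "n1 \<le> n2"
    and E3_g: "bform B E3 (g i) < 0"
begin

definition X :: "real^3 \<Rightarrow> real" where "X w = bform B E1 w"
definition Y :: "real^3 \<Rightarrow> real" where "Y w = bform B E2 w"
definition Z :: "real^3 \<Rightarrow> real" where "Z w = - bform B E3 w"

lemma B_E': "bform B E2 E1 = 0" "bform B E3 E1 = 0" "bform B E3 E2 = 0"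
  and N_E': "N E2 E1 = 0" "N E3 E1 = 0" "N E3 E2 = 0"
  using B_E N_E Bs[of E2 E1] Bs[of E3 E1] Bs[of E3 E2] N_sym[of E2 E1] N_sym[of E3 E1] N_sym[of E3 E2] by simp_all

lemma coords: "w = X w *\<^sub>R E1 + Y w *\<^sub>R E2 + Z w *\<^sub>R E3"
proof -
  obtain a b c where w: "w = a *\<^sub>R E1 + b *\<^sub>R E2 + c *\<^sub>R E3" by (rule det3_nonzero_basis[OF E_det])
  have "X w = a" "Y w = b" "Z w = c"
    by (simp_all add: w X_def Y_def Z_def bform_linear B_E B_E')
  then show ?thesis using w by simp
qed

lemma XYZ_linear:
  "X (v + w) = X v + X w" "Y (v + w) = Y v + Y w" "Z (v + w) = Z v + Z w"
  "X (c *\<^sub>R w) = c * X w" "Y (c *\<^sub>R w) = c * Y w" "Z (c *\<^sub>R w) = c * Z w"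
  by (simp_all add: X_def Y_def Z_def bform_linear)

lemma XYZ_E3: "X E3 = 0" "Y E3 = 0" "Z E3 = 1"
  by (simp_all add: X_def Y_def Z_def B_E)

lemma B_coords: "bform B v w = X v * X w + Y v * Y w - Z v * Z w"
proof -
  have "bform B v w = bform B (X v *\<^sub>R E1 + Y v *\<^sub>R E2 + Z v *\<^sub>R E3) w" using coords[of v] by simp
  then show ?thesis by (simp add: bform_linear X_def Y_def Z_def)
qed

lemma N_coords: "N v w = n1 * X v * X w + n2 * Y v * Y w - m * Z v * Z w"
proof -
  have "N v w = N (X v *\<^sub>R E1 + Y v *\<^sub>R E2 + Z v *\<^sub>R E3) (X w *\<^sub>R E1 + Y w *\<^sub>R E2 + Z w *\<^sub>R E3)"
    using coords[of v] coords[of w] by simp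
  then show ?thesis by (simp add: bform_linear N_E N_E')
qed

lemma Z_g: "Z (g i) > 0" using E3_g by (simp add: Z_def)

lemma Z_x: "Z (x i) > 0" using Z_g[of i] Z_g[of "i + 1"] by (simp add: x_eq XYZ_linear)

definition al :: real where "al = sqrt (n1 / m)"
definition be :: real where "be = sqrt (n2 / m)"

lemma al_be_sq: "al\<^sup>2 = n1 / m" "be\<^sup>2 = n2 / m"
  using m_pos m_less n1_le by (simp_all add: al_def be_def)

lemma al_gt_1: "al > 1" using m_pos m_less by (simp add: al_def)

lemma al_le_be: "al \<le> be" using m_pos n1_le by (simp add: al_def be_def divide_right_mono)

text \<open>The outer conic becomes the unit circle, the inner one an ellipse that the factors
  \<open>al\<close> and \<open>be\<close> stretch to the same circle. Incidence of a vertex with a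
  tangent becomes symmetric in the two kinds of points, so \<open>r\<close> can mix them.\<close>

definition q :: "real^3 \<Rightarrow> real^2" where "q w = vector [X w / Z w, Y w / Z w]"
definition q' :: "real^3 \<Rightarrow> real^2" where "q' w = vector [al * X w / Z w, be * Y w / Z w]"
definition r :: "int \<Rightarrow> real^2" where "r j = (if even j then q (g (j div 2)) else q' (x (j div 2)))"

lemma r_even: "r (2 * i) = q (g i)" and r_odd: "r (2 * i + 1) = q' (x i)"
  by (simp_all add: r_def)

lemma q_circle: "(q (g i) $ 1)\<^sup>2 + (q (g i) $ 2)\<^sup>2 = 1"
proof -
  have "(X (g i))\<^sup>2 + (Y (g i))\<^sup>2 = (Z (g i))\<^sup>2" using B_null[of i] unfolding B_coords by (simp add: power2_eq_square)
  moreover have "(q (g i) $ 1)\<^sup>2 + (q (g i) $ 2)\<^sup>2 = ((X (g i))\<^sup>2 + (Y (g i))\<^sup>2) / (Z (g i))\<^sup>2"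
    by (simp add: q_def power_divide add_divide_distrib)
  ultimately show ?thesis using Z_g[of i] by simp
qed

lemma q'_circle: "(q' (x i) $ 1)\<^sup>2 + (q' (x i) $ 2)\<^sup>2 = 1"
proof -
  have "n1 * (X (x i))\<^sup>2 + n2 * (Y (x i))\<^sup>2 = m * (Z (x i))\<^sup>2"
    using x_orth(3)[of i] unfolding N_coords by (simp add: power2_eq_square mult.assoc)
  moreover have "(q' (x i) $ 1)\<^sup>2 + (q' (x i) $ 2)\<^sup>2 = (n1 * (X (x i))\<^sup>2 + n2 * (Y (x i))\<^sup>2) / (m * (Z (x i))\<^sup>2)"
    by (simp add: q'_def power_divide power_mult_distrib add_divide_distrib al_be_sq)
  ultimately show ?thesis using Z_x[of i] m_pos by simp
qed

lemma r_circle: "(r j $ 1)\<^sup>2 + (r j $ 2)\<^sup>2 = 1"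
  by (simp add: r_def q_circle q'_circle)

lemma q_q': 
  assumes "N (x i) (g j) = 0"
  shows "al * q (g j) $ 1 * q' (x i) $ 1 + be * q (g j) $ 2 * q' (x i) $ 2 = 1"
proof -
  have "n1 * X (x i) * X (g j) + n2 * Y (x i) * Y (g j) = m * Z (x i) * Z (g j)"
    using assms unfolding N_coords by simp
  moreover have "al * q (g j) $ 1 * q' (x i) $ 1 + be * q (g j) $ 2 * q' (x i) $ 2
     = (al\<^sup>2 * X (x i) * X (g j) + be\<^sup>2 * Y (x i) * Y (g j)) / (Z (x i) * Z (g j))"
    by (simp add: q_def q'_def add_divide_distrib power2_eq_square mult_ac)
  moreover have "\<dots> = (n1 * X (x i) * X (g j) + n2 * Y (x i) * Y (g j)) / (m * Z (x i) * Z (g j))"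
    by (simp add: al_be_sq add_divide_distrib)
  ultimately show ?thesis using Z_x[of i] Z_g[of j] m_pos by simp
qed

lemma int_even_odd_cases: obtains i :: int where "j = 2 * i" | i :: int where "j = 2 * i + 1"
  by (metis evenE oddE)

lemma r_chord: "al * r j $ 1 * r (j + 1) $ 1 + be * r j $ 2 * r (j + 1) $ 2 = 1"
proof (cases j rule: int_even_odd_cases)
  case (1 i)
  then show ?thesis using q_q'[of i i] x_orth(1)[of i] by (simp only: r_even r_odd)
next
  case (2 i)
  have "j + 1 = 2 * (i + 1)" using 2 by simp
  then have "r (j + 1) = q (g (i + 1))" by (simp only: r_even)
  moreover have "r j = q' (x i)" using 2 by (simp only: r_odd)
  ultimately show ?thesis using q_q'[of i "i + 1"] x_orth(2)[of i] by (simp add: mult_ac)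
qed

lemma q_eq_imp: assumes "q v = q w" "Z v \<noteq> 0" "Z w \<noteq> 0" shows "Z w *\<^sub>R v = Z v *\<^sub>R w"
proof -
  have "X v / Z v = X w / Z w" "Y v / Z v = Y w / Z w" using assms(1) by (simp_all add: q_def vec2_eq_iff)
  then have "Z w * X v = Z v * X w" "Z w * Y v = Z v * Y w" using assms(2,3) by (simp_all add: field_simps)
  then show ?thesis
    using coords[of "Z w *\<^sub>R v"] coords[of "Z v *\<^sub>R w"] unfolding XYZ_linear by (simp add: mult.commute)
qed

text \<open>Equality would make two neighbouring null lifts proportional, vertices or points of
  tangency, although their mutual product is negative.\<close>

lemma r_neq: "r j \<noteq> r (j + 2)"
proof (cases j rule: int_even_odd_cases)
  case (1 i)
  have e: "r j = q (g i)" "r (j + 2) = q (g (i + 1))" using r_even[of i] r_even[of "i + 1"] 1 by simp_all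
  show ?thesis
  proof
    assume "r j = r (j + 2)"
    then have "Z (g (i + 1)) *\<^sub>R g i = Z (g i) *\<^sub>R g (i + 1)" using q_eq_imp[of "g i" "g (i + 1)"] Z_g e by (metis less_irrefl)
    then have "Z (g (i + 1)) * bform B (g i) (g (i + 1)) = Z (g i) * bform B (g (i + 1)) (g (i + 1))"
      by (metis bform_scale(1))
    then show False using B_null B_neg[of i "i + 1"] n5 Z_g[of "i + 1"] by simp
  qed
next
  case (2 i)
  have e: "r j = q' (x i)" "r (j + 2) = q' (x (i + 1))" using r_odd[of i] r_odd[of "i + 1"] 2 by (simp_all add: algebra_simps)
  show ?thesis
  proof
    assume "r j = r (j + 2)"
    then have "al * (X (x i) / Z (x i)) = al * (X (x (i + 1)) / Z (x (i + 1)))"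
      "be * (Y (x i) / Z (x i)) = be * (Y (x (i + 1)) / Z (x (i + 1)))"
      using e by (simp_all add: q'_def vec2_eq_iff)
    moreover have "al \<noteq> 0" "be \<noteq> 0" using al_gt_1 al_le_be by simp_all
    ultimately have "X (x i) / Z (x i) = X (x (i + 1)) / Z (x (i + 1))"
      "Y (x i) / Z (x i) = Y (x (i + 1)) / Z (x (i + 1))" by (meson mult_left_cancel)+
    then have "q (x i) = q (x (i + 1))" by (simp only: q_def)
    then have "Z (x (i + 1)) *\<^sub>R x i = Z (x i) *\<^sub>R x (i + 1)" using q_eq_imp[of "x i" "x (i + 1)"] Z_x by (metis less_irrefl)
    then have "Z (x (i + 1)) * N (x i) (x (i + 1)) = Z (x i) * N (x (i + 1)) (x (i + 1))"
      by (metis bform_scale(1))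
    then have "N (x i) (x (i + 1)) = 0" using x_orth(3) Z_x[of "i + 1"] by simp
    then show False using N_x_x_neg[of i "i + 1"] int_mod_neq_of_less[of i "i + 1" n] n5 by simp
  qed
qed

lemma x_periodic: "x (i + int n) = x i"
  using periodic[of i] periodic[of "i + 1"] by (simp add: x_eq algebra_simps)

lemma r_periodic: "r (j + 2 * int n) = r j"
  by (simp add: r_def periodic x_periodic add.commute[of "int n"])

definition M :: "real^3^3" where "M = Finite_Cartesian_Product.transpose (vector [E1, E2, E3])"

lemma M_inv: "invertible M"
  unfolding M_def invertible_det_nz det_column_matrix by (rule E_det)

lemma M_vertex: "M *v hom_coords (r (2 * i)) = (1 / Z (g i)) *\<^sub>R g i"
proof -
  have "M *v hom_coords (r (2 * i)) = (1 / Z (g i)) *\<^sub>R (X (g i) *\<^sub>R E1 + Y (g i) *\<^sub>R E2 + Z (g i) *\<^sub>R E3)"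
    using Z_g[of i] unfolding M_def column_matrix_mult r_even by (simp add: q_def scaleR_right_distrib)
  then show ?thesis using coords[of "g i"] by simp
qed

lemma center_inside: "D (g i) (g (i + 1)) E3 > 0"
proof -
  have "N (x i) E3 < 0" unfolding N_coords XYZ_E3 using m_pos Z_x by simp
  then show ?thesis using k_neg unfolding N_x k_const[of i] by (simp add: mult_less_0_iff)
qed

text \<open>The doubled chord relation is the equation of the short diagonal through
  \<open>g i\<close> and \<open>g (i + 2)\<close>. Under the assumption the centre \<open>E3\<close>
  and the cut-off vertex \<open>g (i + 1)\<close> do not lie strictly on opposite sides of
  it.\<close>

lemma double_chord_sign:
  assumes "al\<^sup>2 + be\<^sup>2 \<le> al\<^sup>2 * be\<^sup>2"
  shows "D (g i) (g (i + 2)) E3 \<le> 0"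
proof -
  define a b where "a = al\<^sup>2" and "b = be\<^sup>2"
  \<comment> \<open>\<open>U\<close> is the doubled relation with \<open>g (i + 1)\<close> as one
    argument: a linear form with zeros at \<open>g i\<close> and \<open>g (i + 2)\<close>, positive
    at \<open>g (i + 1)\<close>.\<close>
  define U where "U w = (a * b + a - b) * X (g (i + 1)) * X w + (a * b + b - a) * Y (g (i + 1)) * Y w
    - (a + b - a * b) * Z (g (i + 1)) * Z w" for w
  have U_lin: "U (v + w) = U v + U w" "U (c *\<^sub>R w) = c * U w" for v w c
    by (simp_all add: U_def XYZ_linear algebra_simps)
  have U0: "U (g j) = 0" if "r (2 * j) \<noteq> r (2 * i + 2)"
    "al * r s $ 1 * r (2 * j) $ 1 + be * r s $ 2 * r (2 * j) $ 2 = 1"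
    "al * r s $ 1 * r (2 * i + 2) $ 1 + be * r s $ 2 * r (2 * i + 2) $ 2 = 1" for j s
  proof -
    have "(a * b + a - b) * r (2 * j) $ 1 * r (2 * i + 2) $ 1 + (a * b + b - a) * r (2 * j) $ 2 * r (2 * i + 2) $ 2 = a + b - a * b"
      unfolding a_def b_def by (rule chord_doubling[OF r_circle r_circle r_circle[of s] that])
    moreover have "r (2 * i + 2) = q (g (i + 1))" using r_even[of "i + 1"] by simp
    ultimately have e: "(a * b + a - b) * (X (g j) / Z (g j)) * (X (g (i + 1)) / Z (g (i + 1)))
       + (a * b + b - a) * (Y (g j) / Z (g j)) * (Y (g (i + 1)) / Z (g (i + 1))) = a + b - a * b"
      by (simp add: r_even q_def)
    have "U (g j) = Z (g j) * Z (g (i + 1)) * ((a * b + a - b) * (X (g j) / Z (g j)) * (X (g (i + 1)) / Z (g (i + 1)))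
       + (a * b + b - a) * (Y (g j) / Z (g j)) * (Y (g (i + 1)) / Z (g (i + 1))) - (a + b - a * b))"
      using Z_g[of j] Z_g[of "i + 1"] by (simp add: U_def field_simps)
    then show ?thesis unfolding e by simp
  qed
  have c: "al * r (j + 1) $ 1 * r j $ 1 + be * r (j + 1) $ 2 * r j $ 2 = 1" for j
    using r_chord[of j] by (simp add: mult_ac)
  have c': "al * r j $ 1 * r (j + 1) $ 1 + be * r j $ 2 * r (j + 1) $ 2 = 1" for j
    using r_chord[of j] .
  have "r (2 * i + 1 + 1) = r (2 * i + 2)" by (simp add: algebra_simps)
  then have Ui: "U (g i) = 0" using U0[of i "2 * i + 1"] r_neq[of "2 * i"] c[of "2 * i"] c'[of "2 * i + 1"] by simp
  have "r (2 * (i + 2)) = r (2 * i + 4)" "r (2 * i + 2 + 2) = r (2 * i + 4)" "r (2 * i + 3 + 1) = r (2 * i + 4)"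
    "r (2 * i + 2 + 1) = r (2 * i + 3)"
    by (simp_all add: algebra_simps)
  then have Ui2: "U (g (i + 2)) = 0" using U0[of "i + 2" "2 * i + 3"] r_neq[of "2 * i + 2"] c[of "2 * i + 2"] c'[of "2 * i + 3"] by simp
  have a1: "a > 1" "b > 1" using al_gt_1 al_le_be by (simp_all add: a_def b_def)
  have circ: "(X (g (i + 1)))\<^sup>2 + (Y (g (i + 1)))\<^sup>2 = (Z (g (i + 1)))\<^sup>2"
    using B_null[of "i + 1"] unfolding B_coords by (simp add: power2_eq_square)
  have "U (g (i + 1)) = (a * b + a - b) * (X (g (i + 1)))\<^sup>2 + (a * b + b - a) * (Y (g (i + 1)))\<^sup>2 - (a + b - a * b) * (Z (g (i + 1)))\<^sup>2"
    by (simp add: U_def power2_eq_square)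
  also have "\<dots> = 2 * b * (a - 1) * (X (g (i + 1)))\<^sup>2 + 2 * a * (b - 1) * (Y (g (i + 1)))\<^sup>2"
    unfolding circ[symmetric] by (simp add: algebra_simps)
  also have "\<dots> > 0"
  proof -
    have "2 * b * (a - 1) > 0" "2 * a * (b - 1) > 0" using a1 by simp_all
    moreover have "X (g (i + 1)) \<noteq> 0 \<or> Y (g (i + 1)) \<noteq> 0" using circ Z_g[of "i + 1"] by auto
    ultimately show ?thesis
      by (metis add_nonneg_pos add_pos_nonneg less_imp_le mult_nonneg_nonneg mult_pos_pos zero_le_power2 zero_less_power2)
  qed
  finally have Upos: "U (g (i + 1)) > 0" .
  have d: "D (g i) (g (i + 1)) (g (i + 2)) > 0" using D_pos[of i "i + 1" "i + 2"] n5 by simp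
  have "D (g i) (g (i + 1)) (g (i + 2)) * U E3 = U (D (g i) (g (i + 1)) (g (i + 2)) *\<^sub>R E3)" by (simp add: U_lin)
  also have "\<dots> = D (g i) E3 (g (i + 2)) * U (g (i + 1))"
    by (subst D_cramer) (simp add: U_lin Ui Ui2)
  finally have eq: "D (g i) (g (i + 1)) (g (i + 2)) * U E3 = D (g i) E3 (g (i + 2)) * U (g (i + 1))" .
  have "U E3 = (a * b - (a + b)) * Z (g (i + 1))" by (simp add: U_def XYZ_E3 algebra_simps)
  then have "U E3 \<ge> 0" using assms Z_g[of "i + 1"] by (simp add: a_def b_def)
  then have "D (g i) E3 (g (i + 2)) * U (g (i + 1)) \<ge> 0" using eq d by (metis less_imp_le mult_nonneg_nonneg)
  then have "D (g i) E3 (g (i + 2)) \<ge> 0" using Upos by (simp add: zero_le_mult_iff)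
  moreover have "D (g i) (g (i + 2)) E3 = - D (g i) E3 (g (i + 2))" by (simp add: D_def det3_expand algebra_simps)
  ultimately show ?thesis by simp
qed

text \<open>Otherwise the centre, which is inside every side, would be on the outer side of, or on,
  both diagonals \<open>g 0\<close>, \<open>g 2\<close> and \<open>g 2\<close>, \<open>g 4\<close>.
  The Pluecker relation at \<open>g 2\<close> excludes this when \<open>g 4\<close> differs from
  \<open>g 0\<close>, that is, beyond quadrilaterals.\<close>

lemma small_step: "al\<^sup>2 * be\<^sup>2 < al\<^sup>2 + be\<^sup>2"
proof (rule ccontr)
  assume "\<not> ?thesis"
  then have s: "D (g i) (g (i + 2)) E3 \<le> 0" for i using double_chord_sign by simp
  have g0: "g (int n) = g 0" using periodic[of 0] by simp
  have p: "D (g 2) (g 3) E3 > 0" "D (g 2) (g 4) (g 0) > 0" "D (g 2) (g 3) (g 4) > 0" "D (g 2) (g 3) (g 0) > 0"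
    using center_inside[of 2] D_pos[of 2 4 "int n"] D_pos[of 2 3 4] D_pos[of 2 3 "int n"] n5 g0 by simp_all
  have "D (g 2) E3 (g 0) \<le> 0" "D (g 2) (g 4) E3 \<le> 0"
    using s[of 0] s[of 2] D_rotate[of "g 0" "g 2" E3] by simp_all
  then have "D (g 2) (g 3) (g 4) * D (g 2) E3 (g 0) + D (g 2) (g 3) (g 0) * D (g 2) (g 4) E3 \<le> 0"
    using p by (intro add_nonpos_nonpos mult_nonneg_nonpos) simp_all
  moreover have "D (g 2) (g 3) E3 * D (g 2) (g 4) (g 0) > 0" using p by simp
  ultimately show False using D_pluecker[of "g 2" "g 3" E3 "g 4" "g 0"] by simp
qed

end

section \<open>Equal axes give a regular polygon\<close>

text \<open>Up to a factor this is the area of an inscribed triangle, a product of sines of half its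
  central angles.\<close>

lemma sin_product_det:
  "det3 (vector [cos a, sin a, 1]) (vector [cos (a + 2 * s), sin (a + 2 * s), 1])
     (vector [cos (a + 2 * (s + t)), sin (a + 2 * (s + t)), 1]) = 4 * sin s * sin t * sin (s + t)"
proof -
  have cs: "cos b * sin c - cos c * sin b = sin (c - b)" for b c :: real by (simp add: sin_diff algebra_simps)
  have "det3 (vector [cos a, sin a, 1]) (vector [cos b, sin b, 1]) (vector [cos c, sin c, 1])
     = (cos a * sin b - cos b * sin a) + (cos b * sin c - cos c * sin b) - (cos a * sin c - cos c * sin a)" for b c
    by (simp add: det3_expand algebra_simps)
  then have "det3 (vector [cos a, sin a, 1]) (vector [cos b, sin b, 1]) (vector [cos c, sin c, 1])
     = sin (b - a) + sin (c - b) - sin (c - a)" for b c unfolding cs .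
  from this[of "a + 2 * s" "a + 2 * (s + t)"]
  have "det3 (vector [cos a, sin a, 1]) (vector [cos (a + 2 * s), sin (a + 2 * s), 1])
     (vector [cos (a + 2 * (s + t)), sin (a + 2 * (s + t)), 1]) = sin (2 * s) + sin (2 * t) - sin (2 * s + 2 * t)"
    by (simp add: algebra_simps)
  also have "\<dots> = sin (2 * s) * (1 - cos (2 * t)) + sin (2 * t) * (1 - cos (2 * s))"
    by (simp add: sin_add algebra_simps)
  also have "\<dots> = 4 * sin s * sin t * (sin s * cos t + cos s * sin t)"
    unfolding sin_double cos_double_sin by (simp add: algebra_simps power2_eq_square)
  finally show ?thesis by (simp add: sin_add)
qed

text \<open>While the multiples of \<open>\<theta>\<close> are below \<open>pi\<close>, positivity
  of the next sine keeps the next one below \<open>pi\<close> too. So the last multiple is below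
  \<open>2 * pi\<close>, and a vanishing sine leaves only \<open>pi\<close>.\<close>

lemma convex_step_angle:
  fixes \<theta> :: real
  assumes "0 < \<theta>" "\<theta> < pi" "n \<ge> 2" "sin (real n * \<theta>) = 0"
    and pos: "\<And>j. 1 \<le> j \<Longrightarrow> j + 1 < n \<Longrightarrow> sin (real j * \<theta>) * sin (real (j + 1) * \<theta>) > 0"
  shows "real n * \<theta> = pi"
proof -
  have "j < n \<longrightarrow> real j * \<theta> < pi" if "1 \<le> j" for j
    using that
  proof (induction j rule: dec_induct)
    case base then show ?case using assms by simp
  next
    case (step j)
    show ?case
    proof
      assume lt: "Suc j < n"
      then have j: "real j * \<theta> < pi" "real j * \<theta> > 0" using step assms by auto
      then have "sin (real j * \<theta>) > 0" by (simp add: sin_gt_zero)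
      moreover have "sin (real j * \<theta>) * sin (real (j + 1) * \<theta>) > 0" using pos[of j] step lt by simp
      ultimately have s: "sin (real (Suc j) * \<theta>) > 0" by (simp add: zero_less_mult_iff)
      have "real (Suc j) * \<theta> < 2 * pi" using j assms by (simp add: distrib_right)
      then show "real (Suc j) * \<theta> < pi" using s sin_le_zero[of "real (Suc j) * \<theta>"] by linarith
    qed
  qed
  from this[of "n - 1"] have "real (n - 1) * \<theta> < pi" using assms by simp
  then have lt: "real n * \<theta> < 2 * pi" using assms by (simp add: of_nat_diff left_diff_distrib)
  obtain i where i: "real n * \<theta> = of_int i * pi" using assms(4) sin_zero_iff_int2 by blast
  then have "0 < of_int i * pi" "of_int i * pi < 2 * pi" using lt assms by (metis mult_pos_pos of_nat_0_less_iff less_le_trans pos2, simp)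
  then have "i = 1" by (simp add: zero_less_mult_iff)
  then show ?thesis using i by simp
qed

text \<open>A negative \<open>\<kappa>\<close> means that the chain turns against the polygon.
  Replacing \<open>\<theta>\<close> by \<open>pi - \<theta>\<close> multiplies the sines by
  alternating signs and leads back to the first case.\<close>

lemma regular_step_angle:
  fixes \<theta> :: real
  assumes "0 < \<theta>" "\<theta> < pi" "n \<ge> 2" "sin (real n * \<theta>) = 0"
    and pos: "\<And>j. 1 \<le> j \<Longrightarrow> j + 1 < n \<Longrightarrow> \<kappa> * (sin (real j * \<theta>) * sin (real (j + 1) * \<theta>)) > 0"
  shows "real n * \<theta> = pi \<or> real n * \<theta> = real n * pi - pi"
proof (cases "\<kappa> > 0")
  case True
  then show ?thesis using convex_step_angle[OF assms(1-4)] pos by (simp add: zero_less_mult_iff)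
next
  case False
  have refl: "sin (real j * (pi - \<theta>)) = - ((-1) ^ j * sin (real j * \<theta>))" for j
    by (simp add: right_diff_distrib sin_diff cos_npi)
  have "real n * (pi - \<theta>) = pi"
  proof (rule convex_step_angle)
    show "sin (real n * (pi - \<theta>)) = 0" unfolding refl using assms by simp
    fix j assume j: "1 \<le> j" "j + 1 < n"
    have "sin (real j * (pi - \<theta>)) * sin (real (j + 1) * (pi - \<theta>)) = - (((-1) ^ j * (-1) ^ j) * (sin (real j * \<theta>) * sin (real (j + 1) * \<theta>)))"
      unfolding refl by simp
    also have "\<dots> = - (sin (real j * \<theta>) * sin (real (j + 1) * \<theta>))" by (simp flip: power_mult_distrib)
    finally show "sin (real j * (pi - \<theta>)) * sin (real (j + 1) * (pi - \<theta>)) > 0"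
      using pos[OF j] False by (simp add: zero_less_mult_iff)
  qed (use assms in simp_all)
  then show ?thesis by (simp add: right_diff_distrib)
qed

text \<open>Successive complex quotients have modulus 1 and a common real part, so each is one of
  two conjugate numbers. A change to the conjugate would return to the starting point after two
  steps, which \<open>neq\<close> forbids.\<close>

lemma equal_steps_rotation:
  fixes r :: "int \<Rightarrow> real^2"
  assumes unit: "\<And>j. (r j $ 1)\<^sup>2 + (r j $ 2)\<^sup>2 = 1"
    and step: "\<And>j. r j $ 1 * r (j + 1) $ 1 + r j $ 2 * r (j + 1) $ 2 = d"
    and neq: "\<And>j. r j \<noteq> r (j + 2)"
  obtains \<phi> \<theta> where "0 < \<theta>" "\<theta> < pi"
    "\<And>i. r (2 * i) = vector [cos (\<phi> + of_int i * (2 * \<theta>)), sin (\<phi> + of_int i * (2 * \<theta>))]"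
proof -
  define c where "c j = Complex (r j $ 1) (r j $ 2)" for j
  define w where "w j = c (j + 1) * cnj (c j)" for j
  have c1: "c j * cnj (c j) = 1" for j
    by (simp add: c_def complex_eq_iff power2_eq_square[symmetric] unit)
  then have c0: "c j \<noteq> 0" for j by (metis mult_zero_left zero_neq_one)
  have cw: "c (j + 1) = w j * c j" for j
  proof -
    have "cnj (c j) * c j = 1" using c1[of j] by (simp only: mult.commute)
    then show ?thesis by (simp only: w_def mult.assoc mult_1_right)
  qed
  have w1: "w j * cnj (w j) = 1" for j
  proof -
    have "w j * cnj (w j) = (c (j + 1) * cnj (c (j + 1))) * (c j * cnj (c j))" by (simp add: w_def)
    then show ?thesis by (simp add: c1)
  qed
  have Re_w: "Re (w j) = d" for j using step[of j] by (simp add: w_def c_def mult.commute)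
  have Im_w: "(Im (w j))\<^sup>2 = 1 - d\<^sup>2" for j
    using w1[of j] Re_w[of j] by (simp add: complex_eq_iff power2_eq_square)
  have w_step: "w (j + 1) = w j" for j
  proof (rule ccontr)
    assume ne: "w (j + 1) \<noteq> w j"
    have "(Im (w (j + 1)))\<^sup>2 = (Im (w j))\<^sup>2" by (simp add: Im_w)
    then have "Im (w (j + 1)) = Im (w j) \<or> Im (w (j + 1)) = - Im (w j)" by (simp add: power2_eq_iff)
    then have "w (j + 1) = cnj (w j)" using ne Re_w by (auto simp: complex_eq_iff)
    then have "w (j + 1) * w j = 1" using w1[of j] by (simp add: mult.commute)
    then have "c (j + 2) = c j" using cw[of "j + 1"] cw[of j] by (simp add: add.assoc mult.assoc[symmetric])
    then have "r (j + 2) = r j" by (simp add: c_def vec2_eq_iff)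
    then show False using neq[of j] by simp
  qed
  have w_const: "w j = w 0" for j
  proof (induction j rule: int_induct[where k = 0])
    case (step1 i) then show ?case using w_step[of i] by simp
  next
    case (step2 i) then show ?case using w_step[of "i - 1"] by simp
  qed simp
  define \<rho> where "\<rho> = w 0 * w 0"
  have c_two: "c (j + 2) = \<rho> * c j" for j
    using cw[of "j + 1"] cw[of j] w_const[of j] w_const[of "j + 1"] by (simp add: \<rho>_def add.assoc mult.assoc)
  have "(norm (w 0))\<^sup>2 = 1" by (metis complex_norm_square w1 of_real_1 of_real_eq_iff of_real_power)
  then have "norm (w 0) = 1" using norm_ge_zero[of "w 0"] by (auto simp: power2_eq_1_iff)
  then have nrho: "norm \<rho> = 1" by (simp add: \<rho>_def norm_mult)
  define \<theta> where "\<theta> = Arg2pi \<rho> / 2"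
  have "\<rho> = of_real (norm \<rho>) * exp (\<i> * of_real (Arg2pi \<rho>))" by (rule Arg2pi_eq)
  also have "\<dots> = cis (2 * \<theta>)" by (simp only: nrho) (simp add: \<theta>_def cis_conv_exp)
  finally have rho: "\<rho> = cis (2 * \<theta>)" .
  have "\<rho> \<noteq> 1" using c_two[of 0] neq[of 0] by (auto simp: c_def vec2_eq_iff)
  moreover have "\<rho> = 1" if "\<theta> = 0" unfolding rho that by simp
  ultimately have "\<theta> \<noteq> 0" by blast
  then have th: "0 < \<theta>" "\<theta> < pi" using Arg2pi_ge_0[of \<rho>] Arg2pi_lt_2pi[of \<rho>] by (simp_all add: \<theta>_def order_less_le)
  obtain \<phi> where phi: "r 0 $ 1 = cos \<phi>" "r 0 $ 2 = sin \<phi>" using sincos_total_2pi[OF unit[of 0]] by metis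
  have "c (2 * i) = cis (\<phi> + of_int i * (2 * \<theta>))" for i
  proof (induction i rule: int_induct[where k = 0])
    case base then show ?case by (simp add: c_def phi complex_eq_iff)
  next
    case (step1 i)
    have "c (2 * (i + 1)) = \<rho> * c (2 * i)" using c_two[of "2 * i"] by (simp add: algebra_simps)
    then show ?case using step1 by (simp add: rho cis_mult algebra_simps)
  next
    case (step2 i)
    have "\<rho> * c (2 * (i - 1)) = c (2 * i)" using c_two[of "2 * (i - 1)"] by (simp add: algebra_simps)
    also have "\<dots> = \<rho> * cis (\<phi> + of_int (i - 1) * (2 * \<theta>))" using step2 by (simp add: rho cis_mult algebra_simps)
    finally have "\<rho> * c (2 * (i - 1)) = \<rho> * cis (\<phi> + of_int (i - 1) * (2 * \<theta>))" .
    moreover have "\<rho> \<noteq> 0" using nrho by auto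
    ultimately show ?case using mult_left_cancel by blast
  qed
  then have "r (2 * i) = vector [cos (\<phi> + of_int i * (2 * \<theta>)), sin (\<phi> + of_int i * (2 * \<theta>))]" for i
    by (simp add: c_def vec2_eq_iff complex_eq_iff)
  then show ?thesis using that th by blast
qed

context diagonal_pair begin

text \<open>For equal axes the chord relation fixes the inner product of neighbours, so the vertices
  arise by a rotation. It could still describe a star polygon; the orientation of the triangles with
  vertices 0, 1 and \<open>j + 1\<close> rules that out.\<close>

lemma regular_if_equal:
  assumes "n1 = n2"
  obtains A where "invertible A" "\<And>i. \<exists>c>0. A *v hom_coords (regular_ngon n i) = c *\<^sub>R g i"
proof -
  have abe: "al = be" unfolding al_def be_def using assms by simp
  have "al * (r j $ 1 * r (j + 1) $ 1 + r j $ 2 * r (j + 1) $ 2) = 1" for j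
    using r_chord[of j] unfolding abe[symmetric] by (simp only: distrib_left mult.assoc)
  then have "r j $ 1 * r (j + 1) $ 1 + r j $ 2 * r (j + 1) $ 2 = 1 / al" for j
    using al_gt_1 by (simp only: eq_divide_eq) (simp add: mult.commute)
  from equal_steps_rotation[OF r_circle this r_neq] obtain \<phi> \<theta> where th: "0 < \<theta>" "\<theta> < pi"
    and re: "\<And>i. r (2 * i) = vector [cos (\<phi> + of_int i * (2 * \<theta>)), sin (\<phi> + of_int i * (2 * \<theta>))]" by blast
  have n0: "real n > 0" using n5 by simp
  have rn: "r (2 * int n) = r (2 * 0)" using r_periodic[of 0] by simp
  have ne: "\<phi> + of_int (int n) * (2 * \<theta>) = \<phi> + 2 * (real n * \<theta>)" by simp
  have e: "cos (\<phi> + 2 * (real n * \<theta>)) = cos \<phi>" "sin (\<phi> + 2 * (real n * \<theta>)) = sin \<phi>"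
    using rn unfolding re ne by (simp_all add: vec2_eq_iff)
  have "cos (2 * (real n * \<theta>)) = cos ((\<phi> + 2 * (real n * \<theta>)) - \<phi>)" by simp
  also have "\<dots> = (cos \<phi>)\<^sup>2 + (sin \<phi>)\<^sup>2" unfolding cos_diff e by (simp only: power2_eq_square)
  finally have "cos (2 * (real n * \<theta>)) = 1" by simp
  then have sn0: "sin (real n * \<theta>) = 0" unfolding cos_double_sin by simp
  \<comment> \<open>\<open>\<kappa>\<close> collects the orientations of the polygon and of
    \<open>M\<close>; its sign selects one of the two admissible steps.\<close>
  define \<kappa> where "\<kappa> = \<sigma> * Determinants.det M"
  have "\<kappa> * (sin (real j * \<theta>) * sin (real (j + 1) * \<theta>)) > 0" if j: "1 \<le> j" "j + 1 < n" for j
  proof -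
    define H where "H i = hom_coords (r (2 * i))" for i
    define z where "z i = Z (g i)" for i
    define k where "k = int (j + 1)"
    have z: "z i > 0" for i by (simp add: z_def Z_g)
    have gz: "g i = z i *\<^sub>R (M *v H i)" for i using Z_g[of i] by (simp add: z_def H_def M_vertex)
    have "D (g 0) (g 1) (g k) > 0" using D_pos[of 0 1 k] j by (simp add: k_def)
    moreover have "D (g 0) (g 1) (g k) = z 0 * (z 1 * (z k * (\<kappa> * det3 (H 0) (H 1) (H k))))"
      by (simp only: gz D_def det3_scale det3_matrix_mult \<kappa>_def mult_ac)
    ultimately have "z 0 * (z 1 * (z k * (\<kappa> * det3 (H 0) (H 1) (H k)))) > 0" by simp
    then have pos: "\<kappa> * det3 (H 0) (H 1) (H (int (j + 1))) > 0"
      unfolding k_def[symmetric] by (rule zero_less_mult_pos[OF zero_less_mult_pos[OF zero_less_mult_pos[OF _ z] z] z])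
    have He: "H i = vector [cos (\<phi> + of_int i * (2 * \<theta>)), sin (\<phi> + of_int i * (2 * \<theta>)), 1]" for i
      by (simp add: H_def re hom_coords_def)
    have "det3 (H 0) (H 1) (H (int (j + 1))) = 4 * sin \<theta> * sin (real j * \<theta>) * sin (\<theta> + real j * \<theta>)"
      unfolding He using sin_product_det[of \<phi> \<theta> "real j * \<theta>"] by (simp add: algebra_simps)
    then have "\<kappa> * det3 (H 0) (H 1) (H (int (j + 1))) = (4 * sin \<theta>) * (\<kappa> * (sin (real j * \<theta>) * sin (real (j + 1) * \<theta>)))"
      by (simp add: algebra_simps)
    moreover have "4 * sin \<theta> > 0" using th by (simp add: sin_gt_zero)
    ultimately show ?thesis using pos by (metis zero_less_mult_pos)
  qed
  then have "real n * \<theta> = pi \<or> real n * \<theta> = real n * pi - pi"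
    by (intro regular_step_angle[OF th _ sn0, of \<kappa>]) (use n5 in auto)
  then have "\<exists>s. s\<^sup>2 = 1 \<and> (\<forall>i. r (2 * i) = vector [cos (\<phi> + s * (2 * pi * of_int i / real n)), sin (\<phi> + s * (2 * pi * of_int i / real n))])"
  proof
    assume "real n * \<theta> = pi"
    then have "\<theta> = pi / real n" using n0 by (simp add: field_simps)
    then show ?thesis by (intro exI[of _ 1] conjI allI, simp, simp only: re, simp add: mult_ac)
  next
    assume "real n * \<theta> = real n * pi - pi"
    then have th': "\<theta> = pi - pi / real n" using n0 by (simp add: field_simps)
    \<comment> \<open>Modulo full turns the step is the regular one in the opposite
      direction.\<close>
    have "\<phi> + of_int i * (2 * \<theta>) = (\<phi> + - 1 * (2 * pi * of_int i / real n)) + 2 * pi * of_int i" for i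
      unfolding th' by (simp add: algebra_simps)
    then have "cos (\<phi> + of_int i * (2 * \<theta>)) = cos (\<phi> + - 1 * (2 * pi * of_int i / real n))"
      "sin (\<phi> + of_int i * (2 * \<theta>)) = sin (\<phi> + - 1 * (2 * pi * of_int i / real n))" for i
      by (simp_all only: cos_add[of _ "2 * pi * of_int i"] sin_add[of _ "2 * pi * of_int i"] sin_int_2pin cos_int_2pin mult_1_right mult_zero_right add_0_right diff_zero)
    then show ?thesis by (intro exI[of _ "-1"]) (simp add: re)
  qed
  then obtain s where s: "s\<^sup>2 = 1" and rs: "\<And>i. r (2 * i) = vector [cos (\<phi> + s * (2 * pi * of_int i / real n)), sin (\<phi> + s * (2 * pi * of_int i / real n))]" by blast
  have s1: "s = 1 \<or> s = -1" using s by (simp add: power2_eq_1_iff)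
  \<comment> \<open>The rotation by \<open>\<phi>\<close>, preceded by the reflection in the first
    axis if \<open>s\<close> is -1.\<close>
  define R where "R = (vector [vector [cos \<phi>, - s * sin \<phi>, 0], vector [sin \<phi>, s * cos \<phi>, 0], vector [0, 0, 1]] :: real^3^3)"
  have "Determinants.det R = s * (cos \<phi>)\<^sup>2 + s * (sin \<phi>)\<^sup>2"
    by (simp add: R_def Determinants.det_3 power2_eq_square)
  then have "Determinants.det R = s" unfolding distrib_left[symmetric] by simp
  then have "invertible R" using s1 by (auto simp: invertible_det_nz)
  then have inv: "invertible (M ** R)" using M_inv by (rule invertible_mult[rotated])
  have "R *v hom_coords (regular_ngon n i) = hom_coords (r (2 * i))" for i
  proof -
    have cs: "cos (s * t) = cos t" "sin (s * t) = s * sin t" for t using s1 by auto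
    define \<tau> where "\<tau> = 2 * pi * of_int i / real n"
    have "r (2 * i) = vector [cos (\<phi> + s * \<tau>), sin (\<phi> + s * \<tau>)]" by (simp only: rs \<tau>_def)
    moreover have "regular_ngon n i = vector [cos \<tau>, sin \<tau>]" by (simp only: regular_ngon_def \<tau>_def)
    ultimately show ?thesis
      by (simp add: R_def matrix_mult_vec_3 vec3_eq_iff cos_add sin_add cs)
  qed
  then have "(M ** R) *v hom_coords (regular_ngon n i) = (1 / Z (g i)) *\<^sub>R g i" for i
    by (simp add: matrix_vector_mul_assoc[symmetric] M_vertex)
  then show ?thesis using that[OF inv] Z_g by (metis zero_less_divide_1_iff)
qed

end

section \<open>Existence of the normal form\<close>

text \<open>Products of a timelike vector with null vectors of one nappe share their sign, by the
  Gram determinant. This fixes the sign of the third axis.\<close>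

lemma (in nested_pair) timelike_sign:
  assumes F: "bform B F F = -1"
  obtains s where "s\<^sup>2 = 1" "\<And>i. s * bform B F (g i) < 0"
proof -
  have pos: "bform B F (g i) * bform B F (g j) > 0" if "i < j" "j < i + int n" for i j
  proof -
    define a b c where "a = bform B F (g i)" "b = bform B F (g j)" "c = bform B (g i) (g j)"
    note defs = this
    have c: "c < 0" using B_neg[OF that] by (simp add: defs)
    have "c * c + 2 * (c * (a * b)) = Determinants.det B * (det3 F (g i) (g j))\<^sup>2"
      using bform_gram[of B F "g i" "g j"] Bs[of "g i" F] Bs[of "g j" F] Bs[of "g j" "g i"]
      by (simp add: defs[symmetric] F B_null algebra_simps)
    also have "\<dots> \<le> 0" using B_det by (simp add: mult_le_0_iff)
    finally have "c * c + 2 * (c * (a * b)) \<le> 0" .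
    moreover have "c * c > 0" using c by (simp add: mult_neg_neg)
    ultimately have "c * (a * b) < 0" by linarith
    then show ?thesis using c by (simp add: defs mult_less_0_iff)
  qed
  have p0: "bform B F (g 0) * bform B F (g i) > 0" for i
  proof (cases "i mod int n = 0")
    case True
    then have "g i = g 0" by (intro periodic_mod) simp
    moreover have "bform B F (g 0) \<noteq> 0" using pos[of 0 1] n5 by auto
    ultimately show ?thesis by (metis not_real_square_gt_zero)
  next
    case False
    have "g (i mod int n) = g i" by (intro periodic_mod) simp
    moreover have "0 < i mod int n" "i mod int n < int n" using False n5 pos_mod_sign[of "int n" i] pos_mod_bound[of "int n" i] by linarith+
    ultimately show ?thesis using pos[of 0 "i mod int n"] by simp
  qed
  show ?thesis
  proof (cases "bform B F (g 0) > 0")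
    case True
    then show ?thesis using p0 by (intro that[of "-1"]) (simp_all add: zero_less_mult_iff)
  next
    case False
    then show ?thesis using p0 by (intro that[of 1]) (auto simp: zero_less_mult_iff)
  qed
qed

lemma det2_diff_hom: "det2 (q - p) (s - p) = det3 (hom_coords p) (hom_coords q) (hom_coords s)"
  by (simp add: Determinants.det_2 det3_expand algebra_simps)

theorem normal_form_exists:
  assumes n5: "n \<ge> 5" and conv: "strictly_convex_ngon n P" and pon: "poncelet_polygon n P"
    and nreg: "\<not> projectively_regular n P"
  obtains M r \<alpha> \<beta> where "poncelet_normal_form n M r \<alpha> \<beta> P"
proof -
  obtain \<sigma> where sigma: "\<sigma> \<in> {-1, 1::real}" and per: "\<And>i. P (i + int n) = P i"
    and cv: "\<And>i j. j mod int n \<noteq> i mod int n \<Longrightarrow> j mod int n \<noteq> (i + 1) mod int n \<Longrightarrow>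
      \<sigma> * det2 (P (i + 1) - P i) (P j - P i) > 0"
    using conv unfolding strictly_convex_ngon_def ngon_def by blast
  interpret h: convex_sequence n \<sigma> "\<lambda>i. hom_coords (P i)"
    by standard (use n5 sigma per cv in \<open>auto simp: det2_diff_hom\<close>)
  obtain So Si where So: "Finite_Cartesian_Product.transpose So = So" "invertible So"
    and Si: "Finite_Cartesian_Product.transpose Si = Si" "invertible Si"
    and on: "\<And>i. bform So (hom_coords (P i)) (hom_coords (P i)) = 0"
    and tan: "\<And>i. \<exists>x. x \<noteq> 0 \<and> bform Si x x = 0 \<and> bform Si x (hom_coords (P i)) = 0 \<and> bform Si x (hom_coords (P (i + 1))) = 0"
    using pon unfolding poncelet_polygon_def nondegenerate_conic_def on_conic_def line_tangent_to_conic_def bform_def by blast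
  obtain c t where c: "c \<noteq> 0" and t: "\<And>i. t i > 0"
    and circ: "circumscribed_sequence n \<sigma> (\<lambda>i. t i *\<^sub>R hom_coords (P i)) (c *\<^sub>R Si)"
    using h.tangent_normalization[OF Si tan] by blast
  \<comment> \<open>The determinant is cubic in the scalar, so this sign makes it negative and at
    the same time turns \<open>inscribed_sign\<close> into negativity of all vertex
    products.\<close>
  define B where "B = (- sgn (Determinants.det So)) *\<^sub>R So"
  have dnz: "Determinants.det So \<noteq> 0" using So invertible_det_nz by blast
  interpret c: circumscribed_sequence n \<sigma> "\<lambda>i. t i *\<^sub>R hom_coords (P i)" "c *\<^sub>R Si" by (rule circ)
  interpret p: nested_pair n \<sigma> "\<lambda>i. t i *\<^sub>R hom_coords (P i)" "c *\<^sub>R Si" B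
  proof
    show "Finite_Cartesian_Product.transpose B = B" unfolding B_def transpose_scalar So(1) ..
    show "Determinants.det B < 0" unfolding B_def det_scaleR_3
      using dnz by (cases "Determinants.det So > 0") (auto simp: sgn_if mult_less_0_iff)
    show "bform B (t i *\<^sub>R hom_coords (P i)) (t i *\<^sub>R hom_coords (P i)) = 0" for i
      unfolding B_def by (simp only: bform_smult bform_linear on)
    show "bform B (t i *\<^sub>R hom_coords (P i)) (t j *\<^sub>R hom_coords (P j)) < 0" if "i < j" "j < i + int n" for i j
    proof -
      have "bform So (hom_coords (P i)) (hom_coords (P j)) * Determinants.det So > 0"
        using h.inscribed_sign[OF So on that] .
      then have "sgn (Determinants.det So) * bform So (hom_coords (P i)) (hom_coords (P j)) > 0"
        by (auto simp: sgn_if zero_less_mult_iff)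
      then have "t i * (t j * (sgn (Determinants.det So) * bform So (hom_coords (P i)) (hom_coords (P j)))) > 0"
        using t by (metis mult_pos_pos)
      then show ?thesis by (simp only: B_def bform_smult bform_linear mult.left_commute mult_minus_left neg_less_0_iff_less)
    qed
  qed
  obtain E1 E2 F n1 n2 m where diag: "bform B E1 E1 = 1" "bform B E2 E2 = 1" "bform B F F = -1"
    "bform B E1 E2 = 0" "bform B E1 F = 0" "bform B E2 F = 0"
    "bform (c *\<^sub>R Si) E1 E1 = n1" "bform (c *\<^sub>R Si) E2 E2 = n2" "bform (c *\<^sub>R Si) F F = - m" "bform (c *\<^sub>R Si) E1 E2 = 0" "bform (c *\<^sub>R Si) E1 F = 0" "bform (c *\<^sub>R Si) E2 F = 0"
    "det3 E1 E2 F \<noteq> 0" "0 < m" "m < n1" "n1 \<le> n2"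
    by (rule p.simultaneous_diagonalization)
  obtain s where s: "s\<^sup>2 = 1" "\<And>i. s * bform B F (t i *\<^sub>R hom_coords (P i)) < 0"
    using p.timelike_sign[OF diag(3)] by blast
  have ss: "s * s = 1" using s by (simp add: power2_eq_square)
  interpret d: diagonal_pair n \<sigma> "\<lambda>i. t i *\<^sub>R hom_coords (P i)" "c *\<^sub>R Si" B E1 E2 "s *\<^sub>R F" n1 n2 m
  proof
    show "bform B (s *\<^sub>R F) (t i *\<^sub>R hom_coords (P i)) < 0" for i
      unfolding bform_scale(1)[of _ s] by (rule s(2))
  qed (use diag ss in \<open>auto simp: bform_linear det3_scale\<close>)
  have "n1 \<noteq> n2"
  proof
    assume "n1 = n2"
    then obtain A where A: "invertible A" "\<And>i. \<exists>c>0. A *v hom_coords (regular_ngon n i) = c *\<^sub>R (t i *\<^sub>R hom_coords (P i))"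
      using d.regular_if_equal by blast
    then have "proj_maps A (regular_ngon n) P"
      unfolding proj_maps_def using t by (metis mult_eq_0_iff order_less_irrefl scaleR_scaleR)
    then show False using nreg A by (auto simp: projectively_regular_def)
  qed
  then have "d.al < d.be" using diag by (simp add: d.al_def d.be_def divide_strict_right_mono)
  have "poncelet_normal_form n d.M d.r d.al d.be P"
  proof
    show "\<exists>c>0. d.M *v hom_coords (d.r (2 * i)) = c *\<^sub>R hom_coords (P i)" for i
      using d.M_vertex[of i] d.Z_g[of i] t[of i] by (intro exI[of _ "1 / d.Z (t i *\<^sub>R hom_coords (P i)) * t i"]) simp
  qed (use n5 d.M_inv d.r_periodic d.r_circle d.r_chord d.r_neq d.al_gt_1 \<open>d.al < d.be\<close> d.small_step in auto)
  then show ?thesis using that by blast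
qed

section \<open>Incidence in the plane and the affine chart\<close>

lemma on_line_param:
  fixes a b z :: "real^2"
  assumes "a \<noteq> b" "det3 (hom_coords a) (hom_coords b) (hom_coords z) = 0"
  obtains s where "z = a + s *\<^sub>R (b - a)"
proof -
  define d e where "d = b - a" and "e = z - a"
  have "d \<noteq> 0" using assms by (simp add: d_def)
  have det: "d$1 * e$2 = d$2 * e$1" using assms(2) by (simp add: d_def e_def det3_expand algebra_simps)
  have "\<exists>s. e = s *\<^sub>R d"
  proof (cases "d$1 = 0")
    case True
    then have "d$2 \<noteq> 0" using \<open>d \<noteq> 0\<close> by (simp add: vec2_eq_iff)
    then show ?thesis using det True by (intro exI[of _ "e$2 / d$2"]) (simp add: vec2_eq_iff)
  next
    case False
    then have "e$2 = e$1 / d$1 * d$2" using det by (simp add: field_simps)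
    then show ?thesis using False by (intro exI[of _ "e$1 / d$1"]) (simp add: vec2_eq_iff)
  qed
  then obtain s where "e = s *\<^sub>R d" by blast
  then show ?thesis using that[of s] by (simp add: d_def e_def algebra_simps)
qed

text \<open>This is the power of the point \<open>z\<close> with respect to the unit circle.\<close>

lemma circle_line_param:
  fixes a b :: "real^2"
  assumes "(a$1)\<^sup>2 + (a$2)\<^sup>2 = 1" "(b$1)\<^sup>2 + (b$2)\<^sup>2 = 1" "z = a + s *\<^sub>R (b - a)"
  shows "(z$1)\<^sup>2 + (z$2)\<^sup>2 = 1 - s * (1 - s) * ((b$1 - a$1)\<^sup>2 + (b$2 - a$2)\<^sup>2)"
proof -
  have "(z$1)\<^sup>2 + (z$2)\<^sup>2 = (1 - s) * ((a$1)\<^sup>2 + (a$2)\<^sup>2) + s * ((b$1)\<^sup>2 + (b$2)\<^sup>2)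
     - s * (1 - s) * ((b$1 - a$1)\<^sup>2 + (b$2 - a$2)\<^sup>2)"
    unfolding assms(3) by (simp add: power2_eq_square algebra_simps)
  then show ?thesis using assms(1,2) by simp
qed

lemma dist2_pos: "a \<noteq> b \<Longrightarrow> (b$1 - a$1)\<^sup>2 + (b$2 - a$2)\<^sup>2 > 0" for a b :: "real^2"
  by (auto simp: vec2_eq_iff sum_power2_gt_zero_iff)

lemma circle_noncollinear:
  fixes a b c :: "real^2"
  assumes "(a$1)\<^sup>2 + (a$2)\<^sup>2 = 1" "(b$1)\<^sup>2 + (b$2)\<^sup>2 = 1" "(c$1)\<^sup>2 + (c$2)\<^sup>2 = 1" "a \<noteq> b" "c \<noteq> a" "c \<noteq> b"
  shows "det3 (hom_coords a) (hom_coords b) (hom_coords c) \<noteq> 0"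
proof
  assume "det3 (hom_coords a) (hom_coords b) (hom_coords c) = 0"
  then obtain s where s: "c = a + s *\<^sub>R (b - a)" using on_line_param assms(4) by blast
  have "s * (1 - s) * ((b$1 - a$1)\<^sup>2 + (b$2 - a$2)\<^sup>2) = 0"
    using circle_line_param[OF assms(1,2) s] assms(3) by simp
  then have "s = 0 \<or> s = 1" using dist2_pos[OF assms(4)] by auto
  then show False using s assms by auto
qed

text \<open>A point inside the disc has negative power, so on the line of a chord it lies strictly
  between the endpoints.\<close>

lemma circle_chord_segment:
  fixes a b w z :: "real^2"
  assumes "(a$1)\<^sup>2 + (a$2)\<^sup>2 = 1" "(b$1)\<^sup>2 + (b$2)\<^sup>2 = 1" "a \<noteq> b" "(z$1)\<^sup>2 + (z$2)\<^sup>2 < 1"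
    and "w$1 * a$1 + w$2 * a$2 = c" "w$1 * b$1 + w$2 * b$2 = c" "w$1 * z$1 + w$2 * z$2 = c" "c \<noteq> 0"
  obtains s where "0 < s" "s < 1" "z = a + s *\<^sub>R (b - a)"
proof -
  have w: "w$1 \<noteq> 0 \<or> w$2 \<noteq> 0" using assms(5,8) by auto
  define d1 d2 e1 e2 where "d1 = b$1 - a$1" "d2 = b$2 - a$2" "e1 = z$1 - a$1" "e2 = z$2 - a$2"
  note defs = this
  have d: "w$1 * d1 + w$2 * d2 = 0" using assms(5,6) by (simp add: defs algebra_simps)
  have e: "w$1 * e1 + w$2 * e2 = 0" using assms(5,7) by (simp add: defs algebra_simps)
  have "w$1 * (d1 * e2 - d2 * e1) = e2 * (w$1 * d1 + w$2 * d2) - d2 * (w$1 * e1 + w$2 * e2)"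
    "w$2 * (d1 * e2 - d2 * e1) = d1 * (w$1 * e1 + w$2 * e2) - e1 * (w$1 * d1 + w$2 * d2)"
    by (simp_all add: algebra_simps)
  then have "d1 * e2 - d2 * e1 = 0" using w unfolding d e by auto
  moreover have "det3 (hom_coords a) (hom_coords b) (hom_coords z) = d1 * e2 - d2 * e1"
    by (simp add: det3_expand defs algebra_simps)
  ultimately have "det3 (hom_coords a) (hom_coords b) (hom_coords z) = 0" by simp
  then obtain s where s: "z = a + s *\<^sub>R (b - a)" using on_line_param assms(3) by blast
  have "s * (1 - s) * ((b$1 - a$1)\<^sup>2 + (b$2 - a$2)\<^sup>2) > 0"
    using circle_line_param[OF assms(1,2) s] assms(4) by simp
  then have "s * (1 - s) > 0" using dist2_pos[OF assms(3)] by (simp add: zero_less_mult_iff)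
  then have "0 < s" "s < 1" by (auto simp: zero_less_mult_iff)
  then show ?thesis using that s by blast
qed

definition aff :: "real^3 \<Rightarrow> real^2" where "aff w = vector [w$1 / w$3, w$2 / w$3]"

lemma hom_aff: "w$3 \<noteq> 0 \<Longrightarrow> hom_coords (aff w) = (1 / w$3) *\<^sub>R w"
  by (simp add: vec3_eq_iff aff_def)

lemma aff_hom: "c \<noteq> 0 \<Longrightarrow> aff (c *\<^sub>R hom_coords p) = p"
  by (simp add: vec2_eq_iff aff_def)

lemma hom_inj: "hom_coords p = hom_coords q \<longleftrightarrow> p = q"
  by (simp add: vec3_eq_iff vec2_eq_iff)

lemma aff_in_affine_hull:
  assumes "v$3 > 0" "w$3 > 0" "0 < s" "s < 1" "z = v + s *\<^sub>R (w - v)"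
  shows "aff z \<in> affine hull {aff v, aff w}"
proof -
  have zi: "z$i = (1 - s) * v$i + s * w$i" for i unfolding assms(5) by (simp add: algebra_simps)
  note z3 = zi[of 3]
  have pos: "z$3 > 0" unfolding z3 using assms by (simp add: add_pos_pos)
  define t where "t = (1 - s) * v$3 / z$3"
  define t' where "t' = s * w$3 / z$3"
  have tt: "t + t' = 1" using pos z3 by (simp add: t_def t'_def add_divide_distrib[symmetric])
  have "t * (v$i / v$3) = (1 - s) * v$i / z$3" "t' * (w$i / w$3) = s * w$i / z$3" for i
    using assms(1,2) by (simp_all add: t_def t'_def)
  then have "aff z = t *\<^sub>R aff v + t' *\<^sub>R aff w"
    by (simp add: vec2_eq_iff aff_def zi[of 1] zi[of 2] add_divide_distrib)
  then show ?thesis unfolding affine_hull_2 using tt by blast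
qed

text \<open>Two common points would make the directions proportional and put \<open>c\<close> on the
  line through \<open>a\<close> and \<open>b\<close>.\<close>

lemma affine_lines_unique_meet:
  fixes a b c d :: "real^2"
  assumes "z \<in> affine hull {a, b}" "z \<in> affine hull {c, d}" "det3 (hom_coords a) (hom_coords b) (hom_coords c) \<noteq> 0"
    and "z' \<in> affine hull {a, b}" "z' \<in> affine hull {c, d}"
  shows "z' = z"
proof (rule ccontr)
  assume ne: "z' \<noteq> z"
  have ln: "\<exists>s. z = p + s *\<^sub>R (q - p)" if z: "z \<in> affine hull {p, q}" for z p q :: "real^2"
  proof -
    obtain u v where "z = u *\<^sub>R p + v *\<^sub>R q" "u + v = 1" using z unfolding affine_hull_2 by blast
    then have "z = p + v *\<^sub>R (q - p)" by (simp add: algebra_simps flip: scaleR_add_left)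
    then show ?thesis by blast
  qed
  define p q where "p = d - c" and "q = b - a"
  obtain s s' t t' where st: "z = a + s *\<^sub>R q" "z' = a + s' *\<^sub>R q" "z = c + t *\<^sub>R p" "z' = c + t' *\<^sub>R p"
    using ln assms unfolding p_def q_def by metis
  have tt: "t' - t \<noteq> 0" using ne st(3,4) by auto
  have "(c + t' *\<^sub>R p) - (c + t *\<^sub>R p) = (a + s' *\<^sub>R q) - (a + s *\<^sub>R q)" unfolding st[symmetric] st(3,4)[symmetric]
    using st by metis
  then have e: "(t' - t) *\<^sub>R p = (s' - s) *\<^sub>R q" by (simp add: algebra_simps)
  have "p = (1 / (t' - t)) *\<^sub>R ((t' - t) *\<^sub>R p)" using tt by simp
  then have p: "p = ((s' - s) / (t' - t)) *\<^sub>R q" unfolding e by simp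
  define k where "k = (s' - s) / (t' - t)"
  have "c = z - t *\<^sub>R p" using st(3) by simp
  also have "\<dots> = a + (s - t * k) *\<^sub>R q" unfolding p st(1) k_def by (simp add: scaleR_left_diff_distrib)
  finally have c: "c = a + (s - t * k) *\<^sub>R q" .
  then have "det3 (hom_coords a) (hom_coords b) (hom_coords c) = 0"
    unfolding c by (simp add: det3_expand q_def algebra_simps)
  then show False using assms by simp
qed

section \<open>Iterates of the pentagram map in normal form\<close>

context poncelet_normal_form begin

abbreviation "x j \<equiv> r j $ 1"
abbreviation "y j \<equiv> r j $ 2"

text \<open>\<open>p\<close>, \<open>q\<close> and \<open>s\<close> are the coefficients of the
  two-step relation in \<open>chord_doubling\<close>.\<close>

definition p :: real where "p = \<alpha>\<^sup>2 * \<beta>\<^sup>2 + \<alpha>\<^sup>2 - \<beta>\<^sup>2"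
definition q :: real where "q = \<alpha>\<^sup>2 * \<beta>\<^sup>2 + \<beta>\<^sup>2 - \<alpha>\<^sup>2"
definition s :: real where "s = \<alpha>\<^sup>2 + \<beta>\<^sup>2 - \<alpha>\<^sup>2 * \<beta>\<^sup>2"
definition lam :: real where "lam = \<alpha> * s / p"
definition mu :: real where "mu = \<beta> * s / q"

lemma beta_gt_1: "1 < \<beta>" using alpha_gt_1 alpha_less_beta by simp

lemma s_pos: "s > 0" using small_step by (simp add: s_def)

lemma p_pos: "p > 0"
proof -
  have "p = \<beta>\<^sup>2 * (\<alpha>\<^sup>2 - 1) + \<alpha>\<^sup>2" by (simp add: p_def algebra_simps)
  moreover have "\<beta>\<^sup>2 * (\<alpha>\<^sup>2 - 1) \<ge> 0" "\<alpha>\<^sup>2 > 0" using alpha_gt_1 by simp_all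
  ultimately show ?thesis by linarith
qed

lemma q_pos: "q > 0"
proof -
  have "q = \<alpha>\<^sup>2 * (\<beta>\<^sup>2 - 1) + \<beta>\<^sup>2" by (simp add: q_def algebra_simps)
  moreover have "\<alpha>\<^sup>2 * (\<beta>\<^sup>2 - 1) \<ge> 0" "\<beta>\<^sup>2 > 0" using beta_gt_1 by simp_all
  ultimately show ?thesis by linarith
qed

text \<open>At \<open>\<alpha> = 1\<close> both \<open>p\<close> and \<open>s\<close> equal 1,
  whence the factor \<open>\<alpha> - 1\<close> of the difference; the cofactor is positive.\<close>

lemma lam_less_1: "lam < 1"
proof -
  have "p - \<alpha> * s = (\<alpha> - 1) * ((\<alpha> + 1)\<^sup>2 * \<beta>\<^sup>2 - \<alpha>\<^sup>2)"
    by (simp add: p_def s_def power2_eq_square algebra_simps)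
  moreover have "\<alpha>\<^sup>2 < ((\<alpha> + 1) * \<beta>)\<^sup>2"
  proof (rule power_strict_mono)
    have "\<alpha> < (\<alpha> + 1) * 1" by simp
    also have "\<dots> \<le> (\<alpha> + 1) * \<beta>" using alpha_gt_1 beta_gt_1 by (intro mult_left_mono) auto
    finally show "\<alpha> < (\<alpha> + 1) * \<beta>" .
  qed (use alpha_gt_1 in auto)
  ultimately have "p - \<alpha> * s > 0" using alpha_gt_1 by (simp add: power_mult_distrib)
  then show ?thesis using p_pos by (simp add: lam_def)
qed

text \<open>The comparison becomes an equality for \<open>\<alpha> = \<beta>\<close>, so
  \<open>\<beta> - \<alpha>\<close> splits off; the cofactor is
  \<open>s + 2 * \<alpha> * \<beta>\<close>.\<close>

lemma mu_less_lam: "mu < lam"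
proof -
  have "\<alpha> * q - \<beta> * p = (\<beta> - \<alpha>) * ((\<alpha> + \<beta>)\<^sup>2 - \<alpha>\<^sup>2 * \<beta>\<^sup>2)"
    by (simp add: p_def q_def power2_eq_square algebra_simps)
  moreover have "(\<alpha> + \<beta>)\<^sup>2 - \<alpha>\<^sup>2 * \<beta>\<^sup>2 = s + 2 * \<alpha> * \<beta>" by (simp add: s_def power2_sum)
  moreover have "2 * \<alpha> * \<beta> > 0" using alpha_gt_1 beta_gt_1 by simp
  ultimately have "\<alpha> * q - \<beta> * p > 0" using s_pos alpha_less_beta by simp
  then have "\<beta> * p * s < \<alpha> * q * s" using s_pos by simp
  then show ?thesis using p_pos q_pos by (simp add: lam_def mu_def divide_less_eq less_divide_eq mult_ac)
qed

lemma mu_pos: "mu > 0" using s_pos q_pos beta_gt_1 by (simp add: mu_def)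

lemma lam_pos: "lam > 0" using mu_pos mu_less_lam by simp

lemma chord': "\<alpha> * x (j + 1) * x j + \<beta> * y (j + 1) * y j = 1"
  using r_chord[of j] by (simp add: mult_ac)

lemma double_chord: "p * x j * x (j + 2) + q * y j * y (j + 2) = s"
proof -
  have "\<alpha> * x (j + 1) * x (j + 2) + \<beta> * y (j + 1) * y (j + 2) = 1"
    using r_chord[of "j + 1"] by (simp add: add.assoc)
  then show ?thesis unfolding p_def q_def s_def
    by (rule chord_doubling[OF r_circle r_circle r_circle r_neq chord'])
qed

lemma pole_sum:
  defines "v \<equiv> \<lambda>j. (\<alpha> * x (j + 1))\<^sup>2 + (\<beta> * y (j + 1))\<^sup>2"
  shows "v j * (x j + x (j + 2)) = 2 * (\<alpha> * x (j + 1))" "v j * (y j + y (j + 2)) = 2 * (\<beta> * y (j + 1))" "v j > 0"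
proof -
  have e: "\<alpha> * x (j + 1) * x (j + 2) + \<beta> * y (j + 1) * y (j + 2) = 1"
    using r_chord[of "j + 1"] by (simp add: add.assoc)
  show "v j * (x j + x (j + 2)) = 2 * (\<alpha> * x (j + 1))" "v j * (y j + y (j + 2)) = 2 * (\<beta> * y (j + 1))"
    using vec2_circle_pole[OF r_circle r_circle r_neq, of "vector [\<alpha> * x (j + 1), \<beta> * y (j + 1)]" j] chord'[of j] e
    by (simp_all add: v_def)
  show "v j > 0" using chord'[of j] by (auto simp: v_def sum_power2_gt_zero_iff)
qed

text \<open>Twice the signed area of the triangle formed by the centre and two chain points at
  distance two, which are consecutive vertices of one polygon.\<close>

definition cr :: "int \<Rightarrow> real" where "cr j = x j * y (j + 2) - y j * x (j + 2)"

text \<open>Each factor is the cross product of one of the two points with the pole of the line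
  through the other one; their common sign makes r turn in a constant direction.\<close>

lemma skew_product_pos:
  "(\<beta> * (x j * y (j + 1)) - \<alpha> * (y j * x (j + 1))) * (\<alpha> * (x j * y (j + 1)) - \<beta> * (y j * x (j + 1))) > 0"
proof -
  define a b X Y where "a = x j * y (j + 1)" and "b = y j * x (j + 1)" and "X = x j * x (j + 1)" and "Y = y j * y (j + 1)"
  have ch: "\<alpha> * X + \<beta> * Y = 1" using r_chord[of j] by (simp add: X_def Y_def mult.assoc)
  have ab: "a * b = X * Y" by (simp add: a_def b_def X_def Y_def)
  have "a\<^sup>2 + b\<^sup>2 = ((x j)\<^sup>2 + (y j)\<^sup>2) * ((x (j + 1))\<^sup>2 + (y (j + 1))\<^sup>2) - X\<^sup>2 - Y\<^sup>2"
    by (simp add: a_def b_def X_def Y_def power2_eq_square algebra_simps)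
  then have a2b2: "a\<^sup>2 + b\<^sup>2 = 1 - X\<^sup>2 - Y\<^sup>2" by (simp add: r_circle)
  have "(\<beta> * a - \<alpha> * b) * (\<alpha> * a - \<beta> * b) = \<alpha> * \<beta> * (a\<^sup>2 + b\<^sup>2) - (\<alpha>\<^sup>2 + \<beta>\<^sup>2) * (a * b)"
    by (simp add: power2_eq_square algebra_simps)
  also have "\<dots> = \<alpha> * \<beta> - (\<alpha> * X + \<beta> * Y) * (\<beta> * X + \<alpha> * Y)"
    unfolding a2b2 ab by (simp add: power2_eq_square algebra_simps)
  also have "\<dots> = \<alpha> * \<beta> - (\<beta> * X + \<alpha> * Y)" unfolding ch by simp
  also have "\<dots> > 0"
  proof -
    have am: "u * v \<le> (u\<^sup>2 + v\<^sup>2) / 2" for u v :: real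
      using zero_le_power2[of "u - v"] by (simp add: power2_diff)
    have "\<beta> * X + \<alpha> * Y \<le> \<beta> * (((x j)\<^sup>2 + (x (j + 1))\<^sup>2) / 2) + \<alpha> * (((y j)\<^sup>2 + (y (j + 1))\<^sup>2) / 2)"
      unfolding X_def Y_def using am alpha_gt_1 beta_gt_1 by (intro add_mono mult_left_mono) auto
    also have "\<dots> \<le> \<beta> * (((x j)\<^sup>2 + (x (j + 1))\<^sup>2) / 2) + \<beta> * (((y j)\<^sup>2 + (y (j + 1))\<^sup>2) / 2)"
      using alpha_less_beta by (intro add_left_mono mult_right_mono) auto
    also have "\<dots> = \<beta> * (((x j)\<^sup>2 + (y j)\<^sup>2 + ((x (j + 1))\<^sup>2 + (y (j + 1))\<^sup>2)) / 2)" by (simp add: algebra_simps add_divide_distrib)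
    also have "\<dots> = \<beta>" by (simp add: r_circle)
    also have "\<dots> < \<alpha> * \<beta>" using alpha_gt_1 beta_gt_1 by simp
    finally show ?thesis by simp
  qed
  finally show ?thesis by (simp add: a_def b_def)
qed

text \<open>\<open>pole_sum\<close> expresses the outer points through \<open>r (j + 1)\<close> and
  \<open>r (j + 2)\<close>. Up to positive factors the two cross products are then the two factors
  of \<open>skew_product_pos\<close>.\<close>

lemma cr_step: "cr j * cr (j + 1) > 0"
proof -
  define a b where "a = x (j + 1) * y (j + 2)" and "b = y (j + 1) * x (j + 2)"
  define v v' where "v = (\<alpha> * x (j + 1))\<^sup>2 + (\<beta> * y (j + 1))\<^sup>2" and "v' = (\<alpha> * x (j + 2))\<^sup>2 + (\<beta> * y (j + 2))\<^sup>2"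
  have v: "v * (x j + x (j + 2)) = 2 * (\<alpha> * x (j + 1))" "v * (y j + y (j + 2)) = 2 * (\<beta> * y (j + 1))" "v > 0"
    using pole_sum[of j] by (simp_all add: v_def)
  have v': "v' * (x (j + 1) + x (j + 3)) = 2 * (\<alpha> * x (j + 2))" "v' * (y (j + 1) + y (j + 3)) = 2 * (\<beta> * y (j + 2))" "v' > 0"
    using pole_sum[of "j + 1"] by (simp_all add: v'_def add.assoc)
  have 1: "v * cr j = 2 * (\<alpha> * a - \<beta> * b)"
  proof -
    have "v * cr j = (v * (x j + x (j + 2))) * y (j + 2) - (v * (y j + y (j + 2))) * x (j + 2)"
      by (simp add: cr_def algebra_simps)
    then show ?thesis unfolding v by (simp add: a_def b_def)
  qed
  have 2: "v' * cr (j + 1) = 2 * (\<beta> * a - \<alpha> * b)"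
  proof -
    have "v' * cr (j + 1) = x (j + 1) * (v' * (y (j + 1) + y (j + 3))) - y (j + 1) * (v' * (x (j + 1) + x (j + 3)))"
      by (simp add: cr_def algebra_simps)
    then show ?thesis unfolding v' by (simp add: a_def b_def)
  qed
  have "(\<beta> * a - \<alpha> * b) * (\<alpha> * a - \<beta> * b) > 0"
    using skew_product_pos[of "j + 1"] by (simp add: a_def b_def add.assoc)
  then have "(v * v') * (cr j * cr (j + 1)) > 0"
  proof -
    have "(v * v') * (cr j * cr (j + 1)) = (v * cr j) * (v' * cr (j + 1))" by (simp only: mult_ac)
    also have "\<dots> = 4 * ((\<beta> * a - \<alpha> * b) * (\<alpha> * a - \<beta> * b))" unfolding 1 2 by (simp add: left_diff_distrib right_diff_distrib)
    finally show ?thesis using \<open>(\<beta> * a - \<alpha> * b) * (\<alpha> * a - \<beta> * b) > 0\<close> by simp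
  qed
  then show ?thesis using v v' by (meson mult_pos_pos zero_less_mult_pos)
qed

lemma cr_sign: "cr 0 * cr j > 0"
proof (induction j rule: int_induct[where k = 0])
  case base
  have "cr 0 \<noteq> 0" using cr_step[of 0] by auto
  then show ?case using not_real_square_gt_zero by blast
next
  case (step1 i) then show ?case using cr_step[of i] by (auto simp: zero_less_mult_iff)
next
  case (step2 i) then show ?case using cr_step[of "i - 1"] by (auto simp: zero_less_mult_iff)
qed

text \<open>If the points agreed, the scaled difference of \<open>r j\<close> and
  \<open>r (j + 2)\<close> would be orthogonal to both \<open>r (j + 1)\<close> and
  \<open>r (j + 3)\<close>, which are independent.\<close>

lemma r_neq_4: "r j \<noteq> r (j + 4)"
proof
  assume eq: "r j = r (j + 4)"
  define X Y where "X = \<alpha> * x j - \<alpha> * x (j + 2)" and "Y = \<beta> * y j - \<beta> * y (j + 2)"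
  have e: "\<alpha> * x j * x (j + 1) + \<beta> * y j * y (j + 1) = 1" "\<alpha> * x (j + 4) * x (j + 3) + \<beta> * y (j + 4) * y (j + 3) = 1"
    "\<alpha> * x (j + 2) * x (j + 1) + \<beta> * y (j + 2) * y (j + 1) = 1" "\<alpha> * x (j + 2) * x (j + 3) + \<beta> * y (j + 2) * y (j + 3) = 1"
    using r_chord[of j] chord'[of "j + 3"] chord'[of "j + 1"] r_chord[of "j + 2"] by (simp_all add: add.assoc)
  have 1: "X * x (j + 1) + Y * y (j + 1) = 0" using e(1,3) by (simp add: X_def Y_def algebra_simps)
  have 3: "X * x (j + 3) + Y * y (j + 3) = 0" using e(2,4) by (simp add: X_def Y_def eq algebra_simps)
  have "X * cr (j + 1) = (X * x (j + 1) + Y * y (j + 1)) * y (j + 3) - (X * x (j + 3) + Y * y (j + 3)) * y (j + 1)"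
    "Y * cr (j + 1) = (X * x (j + 3) + Y * y (j + 3)) * x (j + 1) - (X * x (j + 1) + Y * y (j + 1)) * x (j + 3)"
    by (simp_all add: cr_def add.assoc algebra_simps)
  moreover have "cr (j + 1) \<noteq> 0" using cr_step[of j] by auto
  ultimately have "X = 0" "Y = 0" unfolding 1 3 by simp_all
  then have "r j = r (j + 2)" using alpha_gt_1 beta_gt_1 by (simp add: X_def Y_def vec2_eq_iff)
  then show False using r_neq by blast
qed

text \<open>Closed form of the iterates before \<open>M\<close> is applied. Vertex \<open>i\<close>
  of the \<open>k\<close>-th iterate has the chain index \<open>2 * i + 3 * int k\<close>: each step
  moves by three, so iterates alternate between the two kinds of chain points.\<close>

definition v :: "nat \<Rightarrow> int \<Rightarrow> real^3" where "v k j = vector [lam ^ k * x j, mu ^ k * y j, 1]"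

lemma v_0: "v 0 j = hom_coords (r j)" by (simp add: v_def hom_coords_def)

lemma inner_point_circle: "(lam * x j)\<^sup>2 + (mu * y j)\<^sup>2 < 1"
proof -
  have sq: "lam\<^sup>2 < 1" "mu\<^sup>2 < 1" using lam_pos lam_less_1 mu_pos mu_less_lam by (simp_all add: power_less_one_iff)
  have "(lam * x j)\<^sup>2 + (mu * y j)\<^sup>2 = 1 - ((1 - lam\<^sup>2) * (x j)\<^sup>2 + (1 - mu\<^sup>2) * (y j)\<^sup>2)"
    using r_circle[of j] by (simp add: power_mult_distrib algebra_simps)
  moreover have "(1 - lam\<^sup>2) * (x j)\<^sup>2 + (1 - mu\<^sup>2) * (y j)\<^sup>2 > 0"
  proof -
    have "x j \<noteq> 0 \<or> y j \<noteq> 0" using r_circle[of j] by auto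
    then show ?thesis using sq
      by (metis add_nonneg_pos add_pos_nonneg diff_gt_0_iff_gt less_imp_le mult_nonneg_nonneg mult_pos_pos zero_le_power2 zero_less_power2)
  qed
  ultimately show ?thesis by simp
qed

text \<open>The line through r j and r (j + 4) has the equation p x (j + 2) X + q y (j + 2) Y = s. Scaling by
  lam and mu pulls it back to the line alpha x (j + 2) X + beta y (j + 2) Y = 1 through r (j + 1)
  and r (j + 3); this is where lam and mu come from.\<close>

lemma v_segment:
  assumes "\<bar>m - (j + 2)\<bar> = 1"
  obtains t where "0 < t" "t < 1" "\<And>k. v (Suc k) m = v k j + t *\<^sub>R (v k (j + 4) - v k j)"
proof -
  have pq: "p \<noteq> 0" "q \<noteq> 0" using p_pos q_pos by auto
  have c: "\<alpha> * x (j + 2) * x m + \<beta> * y (j + 2) * y m = 1"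
  proof -
    consider "m = j + 2 + 1" | "j + 2 = m + 1" using assms by linarith
    then show ?thesis
    proof cases
      case 1 then show ?thesis using r_chord[of "j + 2"] by simp
    next
      case 2 show ?thesis unfolding 2 by (rule chord')
    qed
  qed
  have "p * x (j + 2) * x j + q * y (j + 2) * y j = s" using double_chord[of j] by (simp add: mult_ac)
  moreover have "p * x (j + 2) * x (j + 4) + q * y (j + 2) * y (j + 4) = s" using double_chord[of "j + 2"] by (simp add: add.assoc)
  moreover have "p * x (j + 2) * (lam * x m) + q * y (j + 2) * (mu * y m) = s"
  proof -
    have "p * x (j + 2) * (lam * x m) + q * y (j + 2) * (mu * y m) = s * (\<alpha> * x (j + 2) * x m + \<beta> * y (j + 2) * y m)"
      using pq by (simp add: lam_def mu_def algebra_simps)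
    then show ?thesis unfolding c by simp
  qed
  ultimately obtain t where t: "0 < t" "t < 1" and eq: "vector [lam * x m, mu * y m] = r j + t *\<^sub>R (r (j + 4) - r j)"
    using circle_chord_segment[of "r j" "r (j + 4)" "vector [lam * x m, mu * y m]" "vector [p * x (j + 2), q * y (j + 2)]" s]
      r_circle r_neq_4 inner_point_circle s_pos by auto
  have x: "lam * x m = x j + t * (x (j + 4) - x j)" "mu * y m = y j + t * (y (j + 4) - y j)"
    using eq by (simp_all add: vec2_eq_iff)
  \<comment> \<open>The parameter \<open>t\<close> found for \<open>k = 0\<close> serves every
    \<open>k\<close>, because the diagonal scaling is linear.\<close>
  have "v (Suc k) m = v k j + t *\<^sub>R (v k (j + 4) - v k j)" for k
  proof -
    have "lam ^ Suc k * x m = lam ^ k * (lam * x m)" "mu ^ Suc k * y m = mu ^ k * (mu * y m)" by simp_all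
    then have "lam ^ Suc k * x m = lam ^ k * x j + t * (lam ^ k * x (j + 4) - lam ^ k * x j)"
      "mu ^ Suc k * y m = mu ^ k * y j + t * (mu ^ k * y (j + 4) - mu ^ k * y j)"
      unfolding x by (simp_all add: algebra_simps)
    then show ?thesis by (simp add: v_def vec3_eq_iff)
  qed
  then show ?thesis using that t by blast
qed

definition f :: "nat \<Rightarrow> int \<Rightarrow> real" where "f k j = (M *v v k j) $ 3"

lemma f_eq: "f k j = M$3$1 * (lam ^ k * x j) + M$3$2 * (mu ^ k * y j) + M$3$3"
  by (simp add: f_def matrix_mult_vec_3 v_def)

lemma f_segment:
  assumes "v (Suc k) m = v k j + t *\<^sub>R (v k (j + 4) - v k j)"
  shows "M *v v (Suc k) m = M *v v k j + t *\<^sub>R (M *v v k (j + 4) - M *v v k j)"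
  unfolding assms by (simp add: matrix_vector_right_distrib matrix_vector_mult_diff_distrib matrix_vector_mult_scaleR)

text \<open>A new vertex is a convex combination of two old ones before dehomogenization, so no
  iterate reaches the line at infinity. Positivity is claimed for the indices of actual vertices
  only.\<close>

lemma f_pos: "f k (2 * i + 3 * int k) > 0"
proof (induction k arbitrary: i)
  case 0
  obtain c where "c > 0" "M *v hom_coords (r (2 * i)) = c *\<^sub>R hom_coords (P i)" using vertices by blast
  then show ?case by (simp add: f_def v_0)
next
  case (Suc k)
  define j where "j = 2 * i + 3 * int k"
  have m: "2 * i + 3 * int (Suc k) = j + 3" by (simp add: j_def)
  obtain t where t: "0 < t" "t < 1" and e: "\<And>k. v (Suc k) (j + 3) = v k j + t *\<^sub>R (v k (j + 4) - v k j)"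
    using v_segment[of "j + 3" j] by auto
  have "f (Suc k) (j + 3) = (1 - t) * f k j + t * f k (j + 4)"
    using arg_cong[OF f_segment[OF e[of k]], of "\<lambda>w. w $ 3"] by (simp add: f_def algebra_simps)
  moreover have "f k j > 0" "f k (j + 4) > 0" using Suc[of i] Suc[of "i + 2"] by (simp_all add: j_def algebra_simps)
  ultimately show ?case unfolding m using t by (simp add: add_pos_pos)
qed

definition T :: "nat \<Rightarrow> polygon" where "T k i = aff (M *v v k (2 * i + 3 * int k))"

lemma T_hom: "M *v v k (2 * i + 3 * int k) = f k (2 * i + 3 * int k) *\<^sub>R hom_coords (T k i)"
  using hom_aff[of "M *v v k (2 * i + 3 * int k)"] f_pos[of k i] by (simp add: T_def f_def)

lemma T_0: "T 0 = P"
proof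
  fix i
  obtain c where "c > 0" "M *v hom_coords (r (2 * i)) = c *\<^sub>R hom_coords (P i)" using vertices by blast
  then show "T 0 i = P i" by (simp add: T_def v_0 aff_hom)
qed

lemma det_M: "Determinants.det M \<noteq> 0" using M_inv invertible_det_nz by blast

lemma det3_v: "det3 (v k a) (v k b) (v k c) = lam ^ k * mu ^ k * det3 (hom_coords (r a)) (hom_coords (r b)) (hom_coords (r c))"
  by (simp add: det3_expand v_def algebra_simps)

text \<open>The chain point \<open>j + 3\<close> neighbours both \<open>j + 2\<close> and
  \<open>j + 4\<close>, so \<open>v_segment\<close> places the new vertex on both diagonals. They
  are distinct because three points of a circle are not collinear.\<close>

lemma T_lines_meet: "\<exists>!z. z \<in> affine hull {T k i, T k (i + 2)} \<inter> affine hull {T k (i + 1), T k (i + 3)}"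
  and T_Suc_meet: "T (Suc k) i \<in> affine hull {T k i, T k (i + 2)} \<inter> affine hull {T k (i + 1), T k (i + 3)}"
proof -
  define j where "j = 2 * i + 3 * int k"
  have idx: "2 * i + 3 * int (Suc k) = j + 3" "2 * (i + 1) + 3 * int k = j + 2" "2 * (i + 2) + 3 * int k = j + 4" "2 * (i + 3) + 3 * int k = j + 2 + 4"
    by (simp_all add: j_def)
  have Tn: "T (Suc k) i = aff (M *v v (Suc k) (j + 3))" "T k i = aff (M *v v k j)" "T k (i + 1) = aff (M *v v k (j + 2))"
    "T k (i + 2) = aff (M *v v k (j + 4))" "T k (i + 3) = aff (M *v v k (j + 2 + 4))"
    unfolding T_def idx by (simp_all add: j_def)
  have f3: "(M *v v k j) $ 3 > 0" "(M *v v k (j + 2)) $ 3 > 0" "(M *v v k (j + 4)) $ 3 > 0" "(M *v v k (j + 2 + 4)) $ 3 > 0"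
    using f_pos[of k i] f_pos[of k "i + 1"] f_pos[of k "i + 2"] f_pos[of k "i + 3"] unfolding idx j_def[symmetric] by (simp_all add: f_def)
  obtain t where t: "0 < t" "t < 1" "\<And>k. v (Suc k) (j + 3) = v k j + t *\<^sub>R (v k (j + 4) - v k j)"
    using v_segment[of "j + 3" j] by auto
  obtain t' where t': "0 < t'" "t' < 1" "\<And>k. v (Suc k) (j + 3) = v k (j + 2) + t' *\<^sub>R (v k (j + 2 + 4) - v k (j + 2))"
    using v_segment[of "j + 3" "j + 2"] by auto
  have 1: "T (Suc k) i \<in> affine hull {T k i, T k (i + 2)}"
    unfolding Tn by (rule aff_in_affine_hull[OF f3(1,3) t(1,2) f_segment[OF t(3)]])
  have 2: "T (Suc k) i \<in> affine hull {T k (i + 1), T k (i + 3)}"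
    unfolding Tn by (rule aff_in_affine_hull[OF f3(2,4) t'(1,2) f_segment[OF t'(3)]])
  then show meet: "T (Suc k) i \<in> affine hull {T k i, T k (i + 2)} \<inter> affine hull {T k (i + 1), T k (i + 3)}"
    using 1 by blast
  have "det3 (hom_coords (r j)) (hom_coords (r (j + 4))) (hom_coords (r (j + 2))) \<noteq> 0"
    using circle_noncollinear[OF r_circle r_circle r_circle r_neq_4[of j], of "j + 2"] r_neq[of j] r_neq[of "j + 2"]
    by (simp add: add.assoc)
  then have "det3 (M *v v k j) (M *v v k (j + 4)) (M *v v k (j + 2)) \<noteq> 0"
    unfolding det3_matrix_mult det3_v using det_M lam_pos mu_pos by simp
  then have nd: "det3 (hom_coords (T k i)) (hom_coords (T k (i + 2))) (hom_coords (T k (i + 1))) \<noteq> 0"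
    unfolding Tn using f3 by (simp add: hom_aff det3_scale)
  show "\<exists>!z. z \<in> affine hull {T k i, T k (i + 2)} \<inter> affine hull {T k (i + 1), T k (i + 3)}"
    using affine_lines_unique_meet[OF 1 2 nd] meet by blast
qed

lemma pentagram_T: "pentagram (T k) = T (Suc k)"
  unfolding pentagram_def using the1_equality[OF T_lines_meet T_Suc_meet] by (intro ext) blast

lemma pentagram_iterate: "(pentagram ^^ k) P = T k"
  by (induction k) (simp_all add: T_0 pentagram_T)

lemma T_ngon: "ngon n (T k)"
  unfolding ngon_def
proof
  fix i
  have "2 * (i + int n) + 3 * int k = (2 * i + 3 * int k) + 2 * int n" by simp
  then show "T k (i + int n) = T k i" unfolding T_def v_def by (simp only: r_periodic)
qed

end

section \<open>Signed area, centroid and homotheties\<close>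

lemma det2_expand: "det2 p q = p$1 * q$2 - p$2 * q$1"
  by (simp add: Determinants.det_2)

lemma det2_combination: "det2 (x *\<^sub>R u + y *\<^sub>R v) (x' *\<^sub>R u + y' *\<^sub>R v) = (x * y' - y * x') * det2 u v"
  by (simp add: det2_expand algebra_simps)

lemma det2_independent:
  assumes "det2 u v \<noteq> 0" "x *\<^sub>R u + y *\<^sub>R v = x' *\<^sub>R u + y' *\<^sub>R v"
  shows "x = x'" "y = y'"
proof -
  have "det2 (x *\<^sub>R u + y *\<^sub>R v) v = det2 (x' *\<^sub>R u + y' *\<^sub>R v) v" "det2 u (x *\<^sub>R u + y *\<^sub>R v) = det2 u (x' *\<^sub>R u + y' *\<^sub>R v)"
    using assms(2) by simp_all
  moreover have "det2 (x *\<^sub>R u + y *\<^sub>R v) v = x * det2 u v" "det2 u (x *\<^sub>R u + y *\<^sub>R v) = y * det2 u v" for x y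
    by (simp_all add: det2_expand algebra_simps)
  ultimately show "x = x'" "y = y'" using assms(1) by (metis mult_right_cancel)+
qed

lemma periodic_sum_shift:
  fixes f :: "int \<Rightarrow> 'a :: ab_group_add"
  assumes "\<And>i. f (i + int n) = f i"
  shows "(\<Sum>i = 0..<int n. f (i + m)) = (\<Sum>i = 0..<int n. f i)"
proof -
  have one: "(\<Sum>i = 0..<int n. g (i + 1)) = (\<Sum>i = 0..<int n. g i)" if "\<And>i. g (i + int n) = g i" for g :: "int \<Rightarrow> 'a"
  proof (cases "n = 0")
    case False
    have "(\<Sum>i = 0..<int n. g (i + 1)) = (\<Sum>i = 1..<int n + 1. g i)"
      by (rule sum.reindex_bij_witness[of _ "\<lambda>i. i - 1" "\<lambda>i. i + 1"]) auto
    also have "{1..<int n + 1} = insert (int n) {1..<int n}" using False by auto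
    also have "(\<Sum>i \<in> \<dots>. g i) = g 0 + (\<Sum>i = 1..<int n. g i)" using that[of 0] by simp
    also have "\<dots> = (\<Sum>i \<in> insert 0 {1..<int n}. g i)" by simp
    also have "insert 0 {1..<int n} = {0..<int n}" using False by auto
    finally show ?thesis .
  qed simp
  show ?thesis
  proof (induction m rule: int_induct[where k = 0])
    case (step1 m)
    have "(\<Sum>i = 0..<int n. f (i + 1 + m)) = (\<Sum>i = 0..<int n. f (i + m))"
      by (rule one[of "\<lambda>i. f (i + m)"]) (metis assms add.assoc add.commute)
    then show ?case using step1 by (simp add: add_ac)
  next
    case (step2 m)
    have "(\<Sum>i = 0..<int n. f (i + 1 + (m - 1))) = (\<Sum>i = 0..<int n. f (i + (m - 1)))"
      by (rule one[of "\<lambda>i. f (i + (m - 1))"]) (metis assms add.assoc add.commute)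
    then show ?case using step2 by (simp add: add_ac)
  qed simp
qed

definition sarea :: "nat \<Rightarrow> polygon \<Rightarrow> real" where
  "sarea n P = 1 / 2 * (\<Sum>i = 0..<int n. det2 (P i) (P (i + 1)))"

lemma area_sarea: "area n P = \<bar>sarea n P\<bar>" by (simp only: area_def sarea_def)

lemma sarea_translate:
  assumes "ngon n P"
  shows "sarea n (\<lambda>i. P i - w) = sarea n P"
proof -
  have per: "P (i + int n) = P i" for i using assms by (simp add: ngon_def)
  have "(\<Sum>i = 0..<int n. det2 (P i - w) (P (i + 1) - w)) = (\<Sum>i = 0..<int n. det2 (P i) (P (i + 1)) + (det2 w (P i) - det2 w (P (i + 1))))"
    by (intro sum.cong refl) (simp add: det2_expand algebra_simps)
  also have "\<dots> = (\<Sum>i = 0..<int n. det2 (P i) (P (i + 1)))"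
    using periodic_sum_shift[of "\<lambda>i. det2 w (P i)" n 1] per by (simp add: sum.distrib sum_subtractf)
  finally show ?thesis by (simp only: sarea_def)
qed

lemma sarea_scale: "sarea n (\<lambda>i. k *\<^sub>R P i) = k\<^sup>2 * sarea n P"
  unfolding sarea_def by (simp add: det2_expand sum_distrib_left power2_eq_square algebra_simps)

lemma sarea_homothety:
  assumes "ngon n P"
  shows "sarea n (\<lambda>i. w + k *\<^sub>R (P i - c)) = k\<^sup>2 * sarea n P"
proof -
  have ng: "ngon n (\<lambda>i. w + k *\<^sub>R (P i - c))" using assms by (simp add: ngon_def)
  have "sarea n (\<lambda>i. w + k *\<^sub>R (P i - c)) = sarea n (\<lambda>i. w + k *\<^sub>R (P i - c) - w)"
    by (rule sarea_translate[OF ng, symmetric])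
  also have "\<dots> = k\<^sup>2 * sarea n (\<lambda>i. P i - c)" by (simp add: sarea_scale)
  finally show ?thesis by (simp add: sarea_translate[OF assms])
qed

lemma sarea_shift:
  assumes "ngon n P" shows "sarea n (shift m P) = sarea n P"
proof -
  define g where "g i = det2 (P i) (P (i + 1))" for i
  have "P (i + int n) = P i" "P (i + int n + 1) = P (i + 1)" for i
    using assms add.assoc[of i "int n" 1] add.commute[of "int n" 1] add.assoc[of i 1 "int n"] by (metis ngon_def)+
  then have "(\<Sum>i = 0..<int n. g (i + m)) = (\<Sum>i = 0..<int n. g i)"
    by (intro periodic_sum_shift) (simp only: g_def)
  moreover have "det2 (shift m P i) (shift m P (i + 1)) = g (i + m)" for i
    by (simp add: g_def shift_def add_ac)
  ultimately show ?thesis by (simp only: sarea_def g_def)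
qed

lemma centroid_shift: "ngon n P \<Longrightarrow> centroid n (shift m P) = centroid n P"
  using periodic_sum_shift[of P n m] unfolding centroid_def shift_def ngon_def by simp

lemma ngon_shift: "ngon n P \<Longrightarrow> ngon n (shift m P)"
  unfolding ngon_def shift_def by (metis add.commute add.left_commute)

lemma centroid_homothety:
  assumes "n > 0"
  shows "centroid n (\<lambda>i. w + k *\<^sub>R (P i - c)) = w + k *\<^sub>R (centroid n P - c)"
proof -
  have "(\<Sum>i = 0..<int n. w + k *\<^sub>R (P i - c)) = real n *\<^sub>R w + k *\<^sub>R ((\<Sum>i = 0..<int n. P i) - real n *\<^sub>R c)"
    by (simp only: sum.distrib sum_subtractf scaleR_sum_right[symmetric] sum_constant_scaleR card_atLeastLessThan_int) simp
  then show ?thesis using assms by (simp add: centroid_def scaleR_right_distrib scaleR_right_diff_distrib)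
qed

lemma centroid_translate:
  assumes "n > 0" shows "centroid n (\<lambda>i. P i - c) = centroid n P - c"
  using centroid_homothety[OF assms, of 0 1 P c] by simp

lemma sarea_combination:
  assumes "ngon n P" "\<And>i. P i - c = x i *\<^sub>R u + y i *\<^sub>R v"
  shows "sarea n P = 1 / 2 * (\<Sum>i = 0..<int n. x i * y (i + 1) - y i * x (i + 1)) * det2 u v"
proof -
  have "sarea n P = sarea n (\<lambda>i. P i - c)" by (rule sarea_translate[OF assms(1), symmetric])
  also have "\<dots> = 1 / 2 * (\<Sum>i = 0..<int n. x i * y (i + 1) - y i * x (i + 1)) * det2 u v"
    unfolding sarea_def assms(2) det2_combination by (simp only: sum_distrib_right mult.assoc)
  finally show ?thesis .
qed

lemma limit_area_eq: "limit_area n u v a b = 1 / 2 * (\<Sum>i = 0..<int n. a i * b (i + 1) - b i * a (i + 1)) * det2 u v"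
  unfolding limit_area_def det2_combination by (simp only: sum_distrib_right mult.assoc)

lemma affine_hull_homothety:
  assumes "k \<noteq> 0"
  shows "w + k *\<^sub>R (z - c) \<in> affine hull {w + k *\<^sub>R (p - c), w + k *\<^sub>R (q - c)} \<longleftrightarrow> z \<in> affine hull {p, q}"
proof -
  have "w + k *\<^sub>R (z - c) = s *\<^sub>R (w + k *\<^sub>R (p - c)) + t *\<^sub>R (w + k *\<^sub>R (q - c)) \<longleftrightarrow> z = s *\<^sub>R p + t *\<^sub>R q"
    if "s + t = 1" for s t
  proof -
    have "s *\<^sub>R (w + k *\<^sub>R (p - c)) + t *\<^sub>R (w + k *\<^sub>R (q - c)) = (s + t) *\<^sub>R (w - k *\<^sub>R c) + k *\<^sub>R (s *\<^sub>R p + t *\<^sub>R q)"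
      by (simp add: algebra_simps)
    also have "\<dots> = (w - k *\<^sub>R c) + k *\<^sub>R (s *\<^sub>R p + t *\<^sub>R q)" unfolding that by simp
    finally have e: "s *\<^sub>R (w + k *\<^sub>R (p - c)) + t *\<^sub>R (w + k *\<^sub>R (q - c)) = (w - k *\<^sub>R c) + k *\<^sub>R (s *\<^sub>R p + t *\<^sub>R q)" .
    have "w + k *\<^sub>R (z - c) = (w - k *\<^sub>R c) + k *\<^sub>R z" by (simp add: scaleR_right_diff_distrib)
    then have "w + k *\<^sub>R (z - c) = s *\<^sub>R (w + k *\<^sub>R (p - c)) + t *\<^sub>R (w + k *\<^sub>R (q - c)) \<longleftrightarrow> k *\<^sub>R z = k *\<^sub>R (s *\<^sub>R p + t *\<^sub>R q)"
      unfolding e by simp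
    then show ?thesis using assms by simp
  qed
  then show ?thesis unfolding affine_hull_2 by blast
qed

text \<open>The map is a definite description, so it commutes with a homothety once the diagonals
  are known to meet in exactly one point.\<close>

lemma pentagram_homothety:
  assumes "k \<noteq> 0" and ex1: "\<And>i. \<exists>!z. z \<in> affine hull {P i, P (i + 2)} \<inter> affine hull {P (i + 1), P (i + 3)}"
  shows "pentagram (\<lambda>i. w + k *\<^sub>R (P i - c)) = (\<lambda>i. w + k *\<^sub>R (pentagram P i - c))"
proof
  fix i
  define h where "h z = w + k *\<^sub>R (z - c)" for z
  have inP: "pentagram P i \<in> affine hull {P i, P (i + 2)} \<inter> affine hull {P (i + 1), P (i + 3)}"
    unfolding pentagram_def by (rule theI'[OF ex1])
  have iff: "h z \<in> affine hull {h (P i), h (P (i + 2))} \<inter> affine hull {h (P (i + 1)), h (P (i + 3))}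
     \<longleftrightarrow> z \<in> affine hull {P i, P (i + 2)} \<inter> affine hull {P (i + 1), P (i + 3)}" for z
    unfolding h_def Int_iff affine_hull_homothety[OF assms(1)] ..
  have "(THE z. z \<in> affine hull {h (P i), h (P (i + 2))} \<inter> affine hull {h (P (i + 1)), h (P (i + 3))}) = h (pentagram P i)"
  proof (rule the_equality)
    show "h (pentagram P i) \<in> affine hull {h (P i), h (P (i + 2))} \<inter> affine hull {h (P (i + 1)), h (P (i + 3))}"
      using inP iff by blast
    fix z assume z: "z \<in> affine hull {h (P i), h (P (i + 2))} \<inter> affine hull {h (P (i + 1)), h (P (i + 3))}"
    define z' where "z' = c + (1 / k) *\<^sub>R (z - w)"
    have zz: "z = h z'" using assms(1) by (simp add: z'_def h_def)
    then have "z' \<in> affine hull {P i, P (i + 2)} \<inter> affine hull {P (i + 1), P (i + 3)}" using z iff by blast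
    then show "z = h (pentagram P i)" using ex1 inP zz by blast
  qed
  then show "pentagram (\<lambda>i. w + k *\<^sub>R (P i - c)) i = w + k *\<^sub>R (pentagram P i - c)"
    unfolding pentagram_def[of "\<lambda>i. w + k *\<^sub>R (P i - c)"] h_def .
qed

text \<open>Each normalization is a homothety, and homotheties commute with the pentagram map. All
  of them can therefore be replaced by a single one at the end, as centroid and area are kept at
  those of \<open>P\<close>.\<close>

lemma normalized_pentagram_iterate:
  assumes "n > 0" and ng: "\<And>k. ngon n ((pentagram ^^ k) P)" and area: "\<And>k. area n ((pentagram ^^ k) P) \<noteq> 0"
    and ex1: "\<And>k i. \<exists>!z. z \<in> affine hull {(pentagram ^^ k) P i, (pentagram ^^ k) P (i + 2)} \<inter>
      affine hull {(pentagram ^^ k) P (i + 1), (pentagram ^^ k) P (i + 3)}"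
  shows "(normalized_pentagram n ^^ k) P = (\<lambda>i. centroid n P +
    sqrt (area n P / area n ((pentagram ^^ k) P)) *\<^sub>R ((pentagram ^^ k) P i - centroid n ((pentagram ^^ k) P)))"
proof (induction k)
  case 0
  show ?case using area[of 0] by simp
next
  case (Suc k)
  define Q where "Q = (pentagram ^^ k) P"
  define c where "c = sqrt (area n P / area n Q)"
  have anz: "area n P > 0" "area n Q > 0" "area n (pentagram Q) > 0"
    using area[of 0] area[of k] area[of "Suc k"] by (simp_all add: Q_def area_sarea)
  then have c: "c > 0" "c\<^sup>2 * area n Q = area n P" by (simp_all add: c_def)
  define N where "N = (\<lambda>i. centroid n P + c *\<^sub>R (Q i - centroid n Q))"
  have N: "(normalized_pentagram n ^^ k) P = N" using Suc by (simp only: N_def Q_def c_def)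
  have ngQ: "ngon n Q" "ngon n (pentagram Q)" using ng[of k] ng[of "Suc k"] by (simp_all add: Q_def)
  have pN: "pentagram N = (\<lambda>i. centroid n P + c *\<^sub>R (pentagram Q i - centroid n Q))"
    unfolding N_def by (rule pentagram_homothety) (use c ex1[of k] in \<open>simp_all add: Q_def\<close>)
  have "area n N = c\<^sup>2 * area n Q" unfolding N_def area_sarea sarea_homothety[OF ngQ(1)] by (simp add: abs_mult)
  then have aN: "area n N = area n P" using c by simp
  have apN: "area n (pentagram N) = c\<^sup>2 * area n (pentagram Q)"
    unfolding pN area_sarea sarea_homothety[OF ngQ(2)] by (simp add: abs_mult)
  have cN: "centroid n N = centroid n P" unfolding N_def centroid_homothety[OF assms(1)] by simp
  have cpN: "centroid n (pentagram N) = centroid n P + c *\<^sub>R (centroid n (pentagram Q) - centroid n Q)"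
    unfolding pN centroid_homothety[OF assms(1)] by simp
  \<comment> \<open>Consecutive normalizing factors telescope.\<close>
  have sq: "sqrt (area n P / (c\<^sup>2 * area n (pentagram Q))) * c = sqrt (area n P / area n (pentagram Q))"
    using c by (simp add: real_sqrt_divide real_sqrt_mult)
  have diff: "pentagram N i - centroid n (pentagram N) = c *\<^sub>R (pentagram Q i - centroid n (pentagram Q))" for i
    unfolding cpN using fun_cong[OF pN, of i] by (simp add: scaleR_right_diff_distrib)
  have "(normalized_pentagram n ^^ Suc k) P = normalized_pentagram n N" using N by simp
  also have "\<dots> = (\<lambda>i. centroid n P + sqrt (area n P / area n (pentagram Q)) *\<^sub>R (pentagram Q i - centroid n (pentagram Q)))"
    by (simp only: normalized_pentagram_def aN apN cN diff scaleR_scaleR sq)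
  finally show ?case by (simp add: Q_def)
qed

section \<open>Affine coordinates, area and normalized iterates\<close>

context poncelet_normal_form begin

text \<open>Otherwise the linear part of the denominator would be positive at all vertices: seen
  from the centre they would lie in one half-plane, and turning in a constant direction they could
  not close up.\<close>

lemma center_pos: "M$3$3 > 0"
proof (rule ccontr)
  assume "\<not> M$3$3 > 0"
  define F where "F i = M$3$1 * x (2 * i) + M$3$2 * y (2 * i)" for i
  define H where "H i = M$3$1 * y (2 * i) - M$3$2 * x (2 * i)" for i
  have F: "F i > 0" for i using f_pos[of 0 i] \<open>\<not> M$3$3 > 0\<close> by (simp add: f_eq F_def)
  have "F i * H (i + 1) - H i * F (i + 1) = ((M$3$1)\<^sup>2 + (M$3$2)\<^sup>2) * cr (2 * i)" for i
    by (simp add: F_def H_def cr_def power2_eq_square distrib_left[of 2 i] algebra_simps)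
  then have eq: "cr 0 * (F i * H (i + 1) - H i * F (i + 1)) = ((M$3$1)\<^sup>2 + (M$3$2)\<^sup>2) * (cr 0 * cr (2 * i))" for i
    by simp
  have "(M$3$1)\<^sup>2 + (M$3$2)\<^sup>2 > 0"
    using F[of 0] by (auto simp: F_def sum_power2_gt_zero_iff)
  then have FH: "cr 0 * (F i * H (i + 1) - H i * F (i + 1)) > 0" for i
    unfolding eq by (rule mult_pos_pos[OF _ cr_sign])
  \<comment> \<open>The slope of the vertex in the frame of that half-plane; it increases strictly
    and yet has period \<open>n\<close>.\<close>
  define g where "g i = cr 0 * (H i / F i)" for i
  have g_step: "g i < g (i + 1)" for i
  proof -
    have "g (i + 1) - g i = cr 0 * (F i * H (i + 1) - H i * F (i + 1)) / (F i * F (i + 1))"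
      using F[of i] F[of "i + 1"] by (simp add: g_def field_simps)
    also have "\<dots> > 0" using FH[of i] F by simp
    finally show ?thesis by simp
  qed
  have "g 0 < g (int m)" if "0 < m" for m
    using that
  proof (induction m rule: nat_induct_non_zero)
    case 1 then show ?case using g_step[of 0] by simp
  next
    case (Suc m) then show ?case using g_step[of "int m"] by (simp add: add.commute)
  qed
  then have "g 0 < g (int n)" using n5 by simp
  moreover have "r (2 * int n) = r (2 * 0)" using r_periodic[of 0] by simp
  then have "g (int n) = g 0" unfolding g_def F_def H_def by (simp only:)
  ultimately show False by simp
qed

text \<open>\<open>ctr\<close> is the image of the centre under \<open>M\<close>.
  \<open>dirU\<close> and \<open>dirV\<close> are the directions of the lines joining it to the
  images of the two points at infinity on the axes.\<close>

definition ctr :: "real^2" where "ctr = vector [M$1$3 / M$3$3, M$2$3 / M$3$3]"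
definition dirU :: "real^2" where "dirU = vector [M$1$1 - M$3$1 * ctr$1, M$2$1 - M$3$1 * ctr$2]"
definition dirV :: "real^2" where "dirV = vector [M$1$2 - M$3$2 * ctr$1, M$2$2 - M$3$2 * ctr$2]"

lemma det2_UV: "det2 dirU dirV \<noteq> 0"
proof -
  have "M$3$3 * det2 dirU dirV = Determinants.det M"
    using center_pos by (simp add: det2_expand dirU_def dirV_def ctr_def Determinants.det_3 field_simps)
  then show ?thesis using det_M by auto
qed

lemma T_coords:
  defines "j \<equiv> \<lambda>k i. 2 * i + 3 * int k"
  shows "T k i - ctr = (lam ^ k * x (j k i) / f k (j k i)) *\<^sub>R dirU + (mu ^ k * y (j k i) / f k (j k i)) *\<^sub>R dirV"
proof -
  define a b where "a = lam ^ k * x (j k i)" and "b = mu ^ k * y (j k i)"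
  define g where "g = f k (j k i)"
  have g: "g = M$3$1 * a + M$3$2 * b + M$3$3" by (simp add: g_def f_eq a_def b_def)
  have gpos: "g > 0" using f_pos[of k i] by (simp add: g_def j_def)
  have Mv: "M *v v k (j k i) = vector [M$1$1 * a + M$1$2 * b + M$1$3, M$2$1 * a + M$2$2 * b + M$2$3, g]"
    by (simp add: matrix_mult_vec_3 v_def a_def b_def g[unfolded a_def b_def])
  have Tk: "T k i = aff (M *v v k (j k i))" by (simp add: T_def j_def)
  have c: "ctr$1 * M$3$3 = M$1$3" "ctr$2 * M$3$3 = M$2$3" using center_pos by (simp_all add: ctr_def)
  have "T k i $ 1 = (M$1$1 * a + M$1$2 * b + M$1$3) / g" "T k i $ 2 = (M$2$1 * a + M$2$2 * b + M$2$3) / g"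
    unfolding Tk Mv by (simp_all add: aff_def)
  moreover have "(M$1$1 * a + M$1$2 * b + M$1$3) / g - ctr$1 = a / g * dirU$1 + b / g * dirV$1"
    using gpos unfolding c(1)[symmetric] by (simp add: dirU_def dirV_def field_simps) (simp add: g algebra_simps)
  moreover have "(M$2$1 * a + M$2$2 * b + M$2$3) / g - ctr$2 = a / g * dirU$2 + b / g * dirV$2"
    using gpos unfolding c(2)[symmetric] by (simp add: dirU_def dirV_def field_simps) (simp add: g algebra_simps)
  ultimately show ?thesis by (simp add: vec2_eq_iff a_def b_def g_def)
qed

text \<open>Every term of the shoelace sum is a positive multiple of some \<open>cr\<close>, so
  nothing cancels.\<close>

lemma T_area_nonzero: "area n (T k) \<noteq> 0"
proof -
  define j where "j i = 2 * i + 3 * int k" for i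
  define X Y where "X i = lam ^ k * x (j i) / f k (j i)" and "Y i = mu ^ k * y (j i) / f k (j i)" for i
  have j1: "j (i + 1) = j i + 2" for i by (simp add: j_def)
  have XY: "X i * Y (i + 1) - Y i * X (i + 1) = lam ^ k * mu ^ k / (f k (j i) * f k (j (i + 1))) * cr (j i)" for i
    by (simp add: X_def Y_def j1 cr_def diff_divide_distrib right_diff_distrib mult_ac)
  have "cr 0 * (X i * Y (i + 1) - Y i * X (i + 1)) > 0" for i
  proof -
    have "0 < lam ^ k * mu ^ k / (f k (j i) * f k (j (i + 1)))"
      unfolding j_def by (intro divide_pos_pos mult_pos_pos zero_less_power lam_pos mu_pos f_pos)
    from mult_pos_pos[OF this cr_sign[of "j i"]] show ?thesis unfolding XY by (simp only: mult.left_commute)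
  qed
  then have "(\<Sum>i = 0..<int n. cr 0 * (X i * Y (i + 1) - Y i * X (i + 1))) > 0"
    using n5 by (intro sum_pos) auto
  then have "(\<Sum>i = 0..<int n. X i * Y (i + 1) - Y i * X (i + 1)) \<noteq> 0" by (auto simp: sum_distrib_left[symmetric])
  moreover have "sarea n (T k) = 1 / 2 * (\<Sum>i = 0..<int n. X i * Y (i + 1) - Y i * X (i + 1)) * det2 dirU dirV"
    by (rule sarea_combination[OF T_ngon, where c = ctr]) (simp add: T_coords X_def Y_def j_def)
  ultimately show ?thesis using det2_UV by (auto simp: area_sarea)
qed

lemma normalized_T:
  "(normalized_pentagram n ^^ k) P = (\<lambda>i. centroid n P + sqrt (area n P / area n (T k)) *\<^sub>R (T k i - centroid n (T k)))"
proof -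
  have "(normalized_pentagram n ^^ k) P = (\<lambda>i. centroid n P +
    sqrt (area n P / area n ((pentagram ^^ k) P)) *\<^sub>R ((pentagram ^^ k) P i - centroid n ((pentagram ^^ k) P)))"
    by (rule normalized_pentagram_iterate) (use n5 T_ngon T_area_nonzero T_lines_meet in \<open>simp_all only: pentagram_iterate, simp\<close>)
  then show ?thesis unfolding pentagram_iterate .
qed

text \<open>The shift cancels the drift of the chain index: vertex \<open>i\<close> of
  \<open>tower e m\<close> has index \<open>2 * i + 3 * int e\<close> for all
  \<open>m\<close>.\<close>

definition tower :: "nat \<Rightarrow> nat \<Rightarrow> polygon" where "tower e m = shift (- 3 * int m) (T (2 * m + e))"

lemma tower_hom: "M *v v (2 * m + e) (2 * i + 3 * int e) = f (2 * m + e) (2 * i + 3 * int e) *\<^sub>R hom_coords (tower e m i)"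
  and tower_f_pos: "f (2 * m + e) (2 * i + 3 * int e) > 0"
  and tower_coords: "tower e m i - ctr = (lam ^ (2 * m + e) * x (2 * i + 3 * int e) / f (2 * m + e) (2 * i + 3 * int e)) *\<^sub>R dirU
     + (mu ^ (2 * m + e) * y (2 * i + 3 * int e) / f (2 * m + e) (2 * i + 3 * int e)) *\<^sub>R dirV"
proof -
  have i: "2 * (i + - 3 * int m) + 3 * int (2 * m + e) = 2 * i + 3 * int e" by simp
  show "M *v v (2 * m + e) (2 * i + 3 * int e) = f (2 * m + e) (2 * i + 3 * int e) *\<^sub>R hom_coords (tower e m i)"
    using T_hom[of "2 * m + e" "i + - 3 * int m"] unfolding i tower_def shift_def .
  show "f (2 * m + e) (2 * i + 3 * int e) > 0" using f_pos[of "2 * m + e" "i + - 3 * int m"] unfolding i .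
  show "tower e m i - ctr = (lam ^ (2 * m + e) * x (2 * i + 3 * int e) / f (2 * m + e) (2 * i + 3 * int e)) *\<^sub>R dirU
     + (mu ^ (2 * m + e) * y (2 * i + 3 * int e) / f (2 * m + e) (2 * i + 3 * int e)) *\<^sub>R dirV"
    using T_coords[of "2 * m + e" "i + - 3 * int m"] unfolding i tower_def shift_def .
qed

lemma tower_0: "tower e 0 = (pentagram ^^ e) P"
  by (simp add: tower_def shift_def pentagram_iterate)

lemma tower_ngon: "ngon n (tower e m)" unfolding tower_def by (rule ngon_shift[OF T_ngon])

lemma tower_area: "area n (tower e m) = area n (T (2 * m + e))"
  unfolding tower_def area_sarea by (simp only: sarea_shift[OF T_ngon])

lemma tower_centroid: "centroid n (tower e m) = centroid n (T (2 * m + e))"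
  unfolding tower_def by (rule centroid_shift[OF T_ngon])

lemma compensated_tower:
  "compensated n P e m i = centroid n P + sqrt (area n P / area n (tower e m)) *\<^sub>R (tower e m i - centroid n (tower e m))"
  unfolding tower_area tower_centroid by (simp add: compensated_def normalized_T shift_def tower_def)

definition dil :: "real^3 \<Rightarrow> real^3" where "dil w = vector [lam\<^sup>2 * w$1, mu\<^sup>2 * w$2, w$3]"

lemma dil_v: "dil (v k j) = v (k + 2) j"
  by (simp add: dil_def v_def vec3_eq_iff power_add power2_eq_square)

lemma dil_linear: "dil (u + w) = dil u + dil w" "dil (c *\<^sub>R w) = c *\<^sub>R dil w"
  by (simp_all add: dil_def vec3_eq_iff algebra_simps)

lemma det3_dil: "det3 (dil a) (dil b) (dil c) = lam\<^sup>2 * mu\<^sup>2 * det3 a b c"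
  by (simp add: det3_expand dil_def algebra_simps)

end

section \<open>The Darboux-Schwartz projectivity in diagonal coordinates\<close>

lemma det3_independent:
  assumes "det3 x y z \<noteq> 0" "a *\<^sub>R x + b *\<^sub>R y + c *\<^sub>R z = a' *\<^sub>R x + b' *\<^sub>R y + c' *\<^sub>R z"
  shows "a = a'" "b = b'" "c = c'"
proof -
  have d: "det3 (a *\<^sub>R x + b *\<^sub>R y + c *\<^sub>R z) y z = a * det3 x y z" "det3 x (a *\<^sub>R x + b *\<^sub>R y + c *\<^sub>R z) z = b * det3 x y z"
    "det3 x y (a *\<^sub>R x + b *\<^sub>R y + c *\<^sub>R z) = c * det3 x y z" for a b c
    by (simp_all add: det3_add det3_scale)
  show "a = a'" "b = b'" "c = c'"
    using d[of a b c] d[of a' b' c'] assms(1) unfolding assms(2) by simp_all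
qed

context poncelet_normal_form begin

text \<open>If the points agreed, both diagonals through the new vertex would pass through
  \<open>r j\<close>, their only common point, but \<open>t\<close> is positive. Together with
  \<open>r_neq_4\<close> this gives four distinct vertices.\<close>

lemma r_neq_6: "r j \<noteq> r (j + 6)"
proof
  assume eq: "r j = r (j + 6)"
  obtain t where t: "0 < t" "v 1 (j + 3) = v 0 j + t *\<^sub>R (v 0 (j + 4) - v 0 j)"
    using v_segment[of "j + 3" j] by auto
  obtain t' where t': "v 1 (j + 3) = v 0 (j + 2) + t' *\<^sub>R (v 0 (j + 6) - v 0 (j + 2))"
    using v_segment[of "j + 3" "j + 2"] by (auto simp: add.assoc)
  have "v 0 (j + 6) = v 0 j" by (simp add: v_0 eq)
  then have "v 0 j + t *\<^sub>R (v 0 (j + 4) - v 0 j) = v 0 (j + 2) + t' *\<^sub>R (v 0 j - v 0 (j + 2))"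
    using t(2) t' by simp
  then have "det3 (v 0 j) (v 0 (j + 2)) (v 0 j + t *\<^sub>R (v 0 (j + 4) - v 0 j))
    = det3 (v 0 j) (v 0 (j + 2)) (v 0 (j + 2) + t' *\<^sub>R (v 0 j - v 0 (j + 2)))" by (rule arg_cong)
  then have "det3 (v 0 j) (v 0 (j + 2)) (v 0 (j + 4)) = 0"
    using t(1) unfolding det3_add det3_diff det3_scale by simp
  then show False
    using circle_noncollinear[OF r_circle r_circle r_circle r_neq[of j], of "j + 4"] r_neq_4[of j] r_neq[of "j + 2"]
    by (simp add: v_0 add.assoc)
qed

text \<open>Four points in general position determine a projectivity, and \<open>G\<close> after
  \<open>M\<close> agrees with \<open>M\<close> after \<open>dil\<close> on the vertices. This
  identifies the given \<open>G\<close> and not merely some projectivity with the right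
  image.\<close>

lemma darboux_schwartz_conjugate:
  assumes "darboux_schwartz G P"
  obtains c where "c \<noteq> 0" "\<And>w. (c *\<^sub>R G) *v (M *v w) = M *v dil w"
proof -
  obtain Q where Q: "proj_maps G P Q" "pentagram (pentagram P) = shift 3 Q"
    using assms by (auto simp: darboux_schwartz_def)
  have T2: "T 2 = shift 3 Q" using Q(2) pentagram_iterate[of 2] by (simp add: numeral_2_eq_2)
  then have QT: "Q i = T 2 (i - 3)" for i by (simp add: shift_def fun_eq_iff)
  define h where "h i = hom_coords (r (2 * i))" for i
  have h: "\<exists>e. e \<noteq> 0 \<and> G *v (M *v h i) = e *\<^sub>R (M *v dil (h i))" for i
  proof -
    obtain c where c: "c > 0" "M *v h i = c *\<^sub>R hom_coords (P i)" using vertices[of i] by (auto simp: h_def)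
    obtain d where d: "d \<noteq> 0" "G *v hom_coords (P i) = d *\<^sub>R hom_coords (Q i)" using Q(1) by (auto simp: proj_maps_def)
    \<comment> \<open>The shift by three built into \<open>G\<close> cancels the drift of two
      pentagram steps, so \<open>G\<close> preserves the chain index.\<close>
    have idx: "2 * (i - 3) + 3 * int 2 = 2 * i" by simp
    define g where "g = f 2 (2 * i)"
    have g: "g > 0" using f_pos[of 2 "i - 3"] unfolding idx g_def .
    have "M *v dil (h i) = g *\<^sub>R hom_coords (Q i)"
      using T_hom[of 2 "i - 3"] dil_v[of 0 "2 * i"] unfolding idx QT g_def h_def v_0[symmetric] add_0 by (simp only:)
    then have "hom_coords (Q i) = (1 / g) *\<^sub>R (M *v dil (h i))" using g by simp
    then have "G *v (M *v h i) = (c * d / g) *\<^sub>R (M *v dil (h i))"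
      using c d by (simp add: matrix_vector_mult_scaleR)
    moreover have "c * d / g \<noteq> 0" using c d g by simp
    ultimately show ?thesis by blast
  qed
  then obtain e where e: "\<And>i. e i \<noteq> 0" "\<And>i. G *v (M *v h i) = e i *\<^sub>R (M *v dil (h i))" by metis
  have ne: "r 0 \<noteq> r 2" "r 0 \<noteq> r 4" "r 0 \<noteq> r 6" "r 2 \<noteq> r 4" "r 2 \<noteq> r 6" "r 4 \<noteq> r 6"
    using r_neq[of 0] r_neq_4[of 0] r_neq_6[of 0] r_neq[of 2] r_neq_4[of 2] r_neq[of 4] by simp_all
  have h0123: "h 0 = hom_coords (r 0)" "h 1 = hom_coords (r 2)" "h 2 = hom_coords (r 4)" "h 3 = hom_coords (r 6)"
    by (simp_all add: h_def)
  have dnz: "det3 (h 0) (h 1) (h 2) \<noteq> 0" "det3 (h 3) (h 1) (h 2) \<noteq> 0" "det3 (h 0) (h 3) (h 2) \<noteq> 0" "det3 (h 0) (h 1) (h 3) \<noteq> 0"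
    unfolding h0123 by (rule circle_noncollinear[OF r_circle r_circle r_circle]; simp add: ne ne[symmetric])+
  obtain a b c where abc: "h 3 = a *\<^sub>R h 0 + b *\<^sub>R h 1 + c *\<^sub>R h 2" by (rule det3_nonzero_basis[OF dnz(1)])
  \<comment> \<open>No three of the four points are collinear. Nonzero coefficients are what forces
    the four factors \<open>e i\<close> to coincide.\<close>
  have abc_nz: "a \<noteq> 0" "b \<noteq> 0" "c \<noteq> 0"
    using dnz(2-4) unfolding abc by (auto simp: det3_add det3_scale)
  define k where "k i = M *v dil (h i)" for i
  have knz: "det3 (k 0) (k 1) (k 2) \<noteq> 0"
    unfolding k_def det3_matrix_mult det3_dil using det_M dnz(1) lam_pos mu_pos by simp
  have lin: "G *v (M *v (a *\<^sub>R h 0 + b *\<^sub>R h 1 + c *\<^sub>R h 2)) = (a * e 0) *\<^sub>R k 0 + (b * e 1) *\<^sub>R k 1 + (c * e 2) *\<^sub>R k 2" for a b c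
    by (simp add: matrix_vector_right_distrib matrix_vector_mult_scaleR e(2) k_def)
  have lin': "M *v dil (a *\<^sub>R h 0 + b *\<^sub>R h 1 + c *\<^sub>R h 2) = a *\<^sub>R k 0 + b *\<^sub>R k 1 + c *\<^sub>R k 2" for a b c
    by (simp add: matrix_vector_right_distrib matrix_vector_mult_scaleR dil_linear k_def)
  have "(a * e 0) *\<^sub>R k 0 + (b * e 1) *\<^sub>R k 1 + (c * e 2) *\<^sub>R k 2 = (a * e 3) *\<^sub>R k 0 + (b * e 3) *\<^sub>R k 1 + (c * e 3) *\<^sub>R k 2"
    using lin[of a b c] e(2)[of 3] lin'[of a b c] unfolding abc[symmetric] by (simp add: scaleR_right_distrib mult.commute)
  from det3_independent[OF knz this] have ee: "e 0 = e 3" "e 1 = e 3" "e 2 = e 3" using abc_nz by simp_all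
  have "((1 / e 3) *\<^sub>R G) *v (M *v w) = M *v dil w" for w
  proof -
    obtain a b c where w: "w = a *\<^sub>R h 0 + b *\<^sub>R h 1 + c *\<^sub>R h 2" by (rule det3_nonzero_basis[OF dnz(1)])
    show ?thesis using e(1)[of 3] unfolding w lin' scaleR_matrix_vector_assoc[symmetric] lin ee by (simp add: scaleR_right_distrib)
  qed
  moreover have "1 / e 3 \<noteq> 0" using e(1) by simp
  ultimately show ?thesis using that by blast
qed

end

section \<open>Two-scale asymptotics\<close>

lemma filterlim_even_odd:
  assumes "filterlim (\<lambda>j. F (2 * j)) G sequentially" "filterlim (\<lambda>j. F (2 * j + 1)) G sequentially"
  shows "filterlim F G sequentially"
  unfolding filterlim_iff
proof (intro allI impI)
  fix Q assume "eventually Q G"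
  then have "\<forall>\<^sub>F j in sequentially. Q (F (2 * j))" "\<forall>\<^sub>F j in sequentially. Q (F (2 * j + 1))"
    using assms unfolding filterlim_iff by blast+
  then obtain N N' where N: "\<And>j. j \<ge> N \<Longrightarrow> Q (F (2 * j))" "\<And>j. j \<ge> N' \<Longrightarrow> Q (F (2 * j + 1))"
    unfolding eventually_sequentially by blast
  have "Q (F k)" if k: "k \<ge> 2 * N + 2 * N'" for k
  proof (cases "even k")
    case True
    then obtain j where "k = 2 * j" by blast
    then show ?thesis using N(1)[of j] k by simp
  next
    case False
    then obtain j where "k = 2 * j + 1" by (metis oddE)
    then show ?thesis using N(2)[of j] k by simp
  qed
  then show "\<forall>\<^sub>F k in sequentially. Q (F k)" unfolding eventually_sequentially by blast
qed

text \<open>The comparison point on the hyperbola has the same first coordinate; the distance to it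
  is the error of the product divided by a coordinate that tends to infinity.\<close>

lemma asymptotic_to_hyperbola:
  assumes z: "\<And>m. z m = p + X m *\<^sub>R u + Y m *\<^sub>R v" and "u \<noteq> 0"
    and XY: "(\<lambda>m. X m * Y m) \<longlonglongrightarrow> c" and X: "filterlim (\<lambda>m. \<bar>X m\<bar>) at_top sequentially" and Y: "Y \<longlonglongrightarrow> 0"
  shows "asymptotic_to z (hyperbola p u v c)"
  unfolding asymptotic_to_def
proof
  have "norm u > 0" using assms(2) by simp
  then have "filterlim (\<lambda>m. norm u * \<bar>X m\<bar>) at_top sequentially"
    by (intro filterlim_tendsto_pos_mult_at_top[OF tendsto_const _ X])
  moreover have "(\<lambda>m. - norm p - \<bar>Y m\<bar> * norm v) \<longlonglongrightarrow> - norm p - \<bar>0\<bar> * norm v"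
    by (intro tendsto_intros Y)
  ultimately have "filterlim (\<lambda>m. (- norm p - \<bar>Y m\<bar> * norm v) + norm u * \<bar>X m\<bar>) at_top sequentially"
    by (intro filterlim_tendsto_add_at_top)
  then show "filterlim (\<lambda>m. norm (z m)) at_top sequentially"
  proof (rule filterlim_at_top_mono, intro always_eventually allI)
    fix m
    have "norm (X m *\<^sub>R u) = norm (z m - p - Y m *\<^sub>R v)" by (simp add: z)
    also have "\<dots> \<le> norm (z m) + norm p + norm (Y m *\<^sub>R v)"
      using norm_triangle_ineq4[of "z m - p" "Y m *\<^sub>R v"] norm_triangle_ineq4[of "z m" p] by linarith
    finally show "(- norm p - \<bar>Y m\<bar> * norm v) + norm u * \<bar>X m\<bar> \<le> norm (z m)" by (simp add: mult.commute)
  qed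
  have "(\<lambda>m. \<bar>X m * Y m - c\<bar> * inverse \<bar>X m\<bar> * norm v) \<longlonglongrightarrow> \<bar>c - c\<bar> * 0 * norm v"
    by (intro tendsto_intros XY filterlim_compose[OF tendsto_inverse_0_at_top[OF filterlim_ident] X])
  then have lim: "(\<lambda>m. \<bar>X m * Y m - c\<bar> * inverse \<bar>X m\<bar> * norm v) \<longlonglongrightarrow> 0" by simp
  have "\<forall>\<^sub>F m in sequentially. 0 < \<bar>X m\<bar>" using X unfolding filterlim_at_top_dense by blast
  then have ev: "\<forall>\<^sub>F m in sequentially. X m \<noteq> 0" by (rule eventually_mono) simp
  show "(\<lambda>m. infdist (z m) (hyperbola p u v c)) \<longlonglongrightarrow> 0"
  proof (rule tendsto_sandwich[OF _ _ tendsto_const lim])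
    show "\<forall>\<^sub>F m in sequentially. 0 \<le> infdist (z m) (hyperbola p u v c)" by (simp add: infdist_nonneg)
    show "\<forall>\<^sub>F m in sequentially. infdist (z m) (hyperbola p u v c) \<le> \<bar>X m * Y m - c\<bar> * inverse \<bar>X m\<bar> * norm v"
      using ev
    proof eventually_elim
      case (elim m)
      define w where "w = p + X m *\<^sub>R u + (c / X m) *\<^sub>R v"
      have "w \<in> hyperbola p u v c" unfolding hyperbola_def w_def 
        by (intro CollectI exI[of _ "X m"] exI[of _ "c / X m"]) (simp add: elim)
      then have "infdist (z m) (hyperbola p u v c) \<le> dist (z m) w" by (rule infdist_le)
      also have "z m - w = ((X m * Y m - c) * inverse (X m)) *\<^sub>R v"
        using elim by (simp add: z w_def left_diff_distrib scaleR_left_diff_distrib divide_inverse)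
      then have "dist (z m) w = \<bar>X m * Y m - c\<bar> * inverse \<bar>X m\<bar> * norm v"
        by (simp add: dist_norm abs_mult)
      finally show ?case .
    qed
  qed
qed

text \<open>The difference to the centroid is the mean of the differences to the vertices.\<close>

lemma norm_diff_centroid_le_diameter:
  assumes "n > 0" "ngon n Q"
  shows "norm (Q i - centroid n Q) \<le> diameter (range Q)"
proof -
  have per: "Q i = Q (i mod int n)" for i
  proof -
    have step: "Q (j + m * int n) = Q j" for j m
    proof (induction m rule: int_induct[where k = 0])
      case (step1 m) then show ?case using assms(2) by (simp add: ngon_def distrib_right add.assoc[symmetric])
    next
      case (step2 m)
      have "Q (j + (m - 1) * int n + int n) = Q (j + (m - 1) * int n)" using assms(2) by (simp add: ngon_def)
      then show ?case using step2 by (simp add: left_diff_distrib)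
    qed simp
    show ?thesis using step[of "i mod int n" "i div int n"] by (simp add: add.commute)
  qed
  have "range Q \<subseteq> Q ` {0..<int n}"
  proof
    fix z assume "z \<in> range Q"
    then obtain i where "z = Q i" by blast
    then have "z = Q (i mod int n)" by (rule trans[OF _ per])
    moreover have "i mod int n \<in> {0..<int n}" using assms(1) by simp
    ultimately show "z \<in> Q ` {0..<int n}" by blast
  qed
  then have "finite (range Q)" by (rule finite_subset) simp
  then have bd: "bounded (range Q)" by (rule finite_imp_bounded)
  have "real n *\<^sub>R (Q i - centroid n Q) = (\<Sum>j = 0..<int n. Q i - Q j)"
    using assms(1) by (simp only: sum_subtractf sum_constant_scaleR) (simp add: centroid_def scaleR_right_diff_distrib)
  also have "norm \<dots> \<le> (\<Sum>j = 0..<int n. diameter (range Q))"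
    using diameter_bounded_bound[OF bd, of "Q i"] by (intro sum_norm_le) (simp add: dist_norm)
  finally have "real n * norm (Q i - centroid n Q) \<le> real n * diameter (range Q)" by simp
  then show ?thesis using assms(1) by simp
qed

text \<open>Arbitrary asymptotic data, with nothing known about the scales. \<open>A\<close> stands
  for the area to which the polygons are normalized.\<close>

locale two_scale_sequence =
  fixes n :: nat and R :: "nat \<Rightarrow> polygon" and u v :: "real^2" and \<alpha> \<beta> :: "nat \<Rightarrow> real" and a b :: "int \<Rightarrow> real"
    and x y :: "nat \<Rightarrow> int \<Rightarrow> real" and A :: real
  assumes n_pos: "n > 0" and ng: "ngon n (R j)" and area_nz: "area n (R j) \<noteq> 0" and indep: "det2 u v \<noteq> 0"
    and al_nz: "\<alpha> j \<noteq> 0" and be_nz: "\<beta> j \<noteq> 0"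
    and coords: "R j i - centroid n (R j) = x j i *\<^sub>R u + y j i *\<^sub>R v"
    and x_lim: "(\<lambda>j. x j i / \<alpha> j) \<longlonglongrightarrow> a i" and y_lim: "(\<lambda>j. y j i / \<beta> j) \<longlonglongrightarrow> b i"
    and ratio: "(\<lambda>j. \<bar>\<beta> j\<bar> / \<bar>\<alpha> j\<bar>) \<longlonglongrightarrow> 0"
    and L_nz: "limit_area n u v a b \<noteq> 0" and A_pos: "A > 0"
begin

text \<open>Area is bilinear in the two coordinates, so relative to the product of the scales it
  converges to the limit area.\<close>

definition w :: "nat \<Rightarrow> real" where "w j = area n (R j) / \<bar>\<alpha> j * \<beta> j\<bar>"

lemma w_pos: "w j > 0" using area_nz[of j] al_nz[of j] be_nz[of j] by (simp add: w_def area_sarea)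

lemma w_lim: "w \<longlonglongrightarrow> \<bar>limit_area n u v a b\<bar>"
proof -
  have e: "sarea n (R j) / (\<alpha> j * \<beta> j) =
    1 / 2 * (\<Sum>i = 0..<int n. (x j i / \<alpha> j) * (y j (i + 1) / \<beta> j) - (y j i / \<beta> j) * (x j (i + 1) / \<alpha> j)) * det2 u v" for j
  proof -
    have "(\<Sum>i = 0..<int n. (x j i / \<alpha> j) * (y j (i + 1) / \<beta> j) - (y j i / \<beta> j) * (x j (i + 1) / \<alpha> j))
      = (\<Sum>i = 0..<int n. x j i * y j (i + 1) - y j i * x j (i + 1)) / (\<alpha> j * \<beta> j)"
      by (simp add: sum_divide_distrib diff_divide_distrib mult.commute)
    then show ?thesis unfolding sarea_combination[OF ng[of j] coords[of j]] by simp
  qed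
  have "(\<lambda>j. sarea n (R j) / (\<alpha> j * \<beta> j)) \<longlonglongrightarrow> limit_area n u v a b"
    unfolding e limit_area_eq by (intro tendsto_intros x_lim y_lim)
  then have "(\<lambda>j. \<bar>sarea n (R j) / (\<alpha> j * \<beta> j)\<bar>) \<longlonglongrightarrow> \<bar>limit_area n u v a b\<bar>" by (rule tendsto_rabs)
  then show ?thesis by (simp add: w_def[abs_def] area_sarea abs_divide)
qed

definition X :: "nat \<Rightarrow> int \<Rightarrow> real" where "X j i = sqrt (A / area n (R j)) * x j i"
definition Y :: "nat \<Rightarrow> int \<Rightarrow> real" where "Y j i = sqrt (A / area n (R j)) * y j i"

lemma scaled_coords: "sqrt (A / area n (R j)) *\<^sub>R (R j i - centroid n (R j)) = X j i *\<^sub>R u + Y j i *\<^sub>R v"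
  unfolding coords X_def Y_def by (simp add: scaleR_right_distrib)

lemma sqrt_sq: "sqrt (A / area n (R j)) * sqrt (A / area n (R j)) = A / area n (R j)"
  using A_pos by (intro real_sqrt_mult_self[THEN trans]) (simp add: area_sarea)

lemma area_w: "area n (R j) = w j * (\<bar>\<alpha> j\<bar> * \<bar>\<beta> j\<bar>)"
  using al_nz[of j] be_nz[of j] by (simp add: w_def abs_mult)

text \<open>The two square roots combine to \<open>A\<close> divided by the area, in which the
  scales occur by absolute value; only the sign of their product is left.\<close>

lemma XY_lim: "(\<lambda>j. sgn (\<alpha> j * \<beta> j) * (X j i * Y j i)) \<longlonglongrightarrow> A / \<bar>limit_area n u v a b\<bar> * (a i * b i)"
proof -
  have "sgn (\<alpha> j * \<beta> j) * (X j i * Y j i) = A / w j * ((x j i / \<alpha> j) * (y j i / \<beta> j))" for j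
  proof -
    have "X j i * Y j i = sqrt (A / area n (R j)) * sqrt (A / area n (R j)) * (x j i * y j i)" by (simp only: X_def Y_def mult_ac)
    then have "X j i * Y j i = A / area n (R j) * (x j i * y j i)" unfolding sqrt_sq .
    moreover have "sgn t = \<bar>t\<bar> / t" if "t \<noteq> 0" for t :: real using that by (auto simp: sgn_if abs_if)
    then have "sgn (\<alpha> j * \<beta> j) = \<bar>\<alpha> j\<bar> * \<bar>\<beta> j\<bar> / (\<alpha> j * \<beta> j)"
      using al_nz[of j] be_nz[of j] by (metis abs_mult mult_eq_0_iff)
    ultimately show ?thesis using al_nz[of j] be_nz[of j] w_pos[of j] by (simp add: area_w)
  qed
  then show ?thesis
    by (simp only:) (intro tendsto_mult tendsto_divide tendsto_const x_lim y_lim w_lim, use L_nz in simp)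
qed

text \<open>The square is a convergent factor times the ratio of the scales. For \<open>X\<close>
  the reciprocal ratio appears, which yields divergence.\<close>

lemma Y_lim: "(\<lambda>j. Y j i) \<longlonglongrightarrow> 0"
proof -
  have rearrange: "A / (w * (a * b)) * t = A / w * (t / (b * b)) * (b / a)" if "a \<noteq> 0" "b \<noteq> 0" "w \<noteq> 0" for a b w t :: real
    using that by (simp add: field_simps)
  have "(Y j i)\<^sup>2 = A / w j * (y j i / \<beta> j)\<^sup>2 * (\<bar>\<beta> j\<bar> / \<bar>\<alpha> j\<bar>)" for j
  proof -
    have "(Y j i)\<^sup>2 = sqrt (A / area n (R j)) * sqrt (A / area n (R j)) * (y j i)\<^sup>2"
      by (simp only: Y_def power2_eq_square mult_ac)
    then have "(Y j i)\<^sup>2 = A / area n (R j) * (y j i)\<^sup>2" unfolding sqrt_sq .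
    moreover have "(y j i / \<beta> j)\<^sup>2 = (y j i)\<^sup>2 / (\<bar>\<beta> j\<bar> * \<bar>\<beta> j\<bar>)" by (simp add: power_divide power2_eq_square)
    ultimately show ?thesis unfolding area_w
      using rearrange[of "\<bar>\<alpha> j\<bar>" "\<bar>\<beta> j\<bar>" "w j" "(y j i)\<^sup>2"] al_nz[of j] be_nz[of j] w_pos[of j] by simp
  qed
  moreover have "(\<lambda>j. A / w j * (y j i / \<beta> j)\<^sup>2 * (\<bar>\<beta> j\<bar> / \<bar>\<alpha> j\<bar>)) \<longlonglongrightarrow> A / \<bar>limit_area n u v a b\<bar> * (b i)\<^sup>2 * 0"
    by (intro tendsto_mult tendsto_divide tendsto_power tendsto_const y_lim w_lim ratio) (use L_nz in simp)
  ultimately have "(\<lambda>j. (Y j i)\<^sup>2) \<longlonglongrightarrow> 0" by simp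
  then have "(\<lambda>j. sqrt ((Y j i)\<^sup>2)) \<longlonglongrightarrow> sqrt 0" by (rule tendsto_real_sqrt)
  then show ?thesis by (simp add: tendsto_rabs_zero_iff)
qed

lemma X_lim:
  assumes "a i \<noteq> 0"
  shows "filterlim (\<lambda>j. \<bar>X j i\<bar>) at_top sequentially"
proof -
  have rearrange: "A / (w * (a * b)) * t = A / w * (t / (a * a)) * inverse (b / a)" if "a \<noteq> 0" "b \<noteq> 0" "w \<noteq> 0" for a b w t :: real
    using that by (simp add: field_simps)
  have "(X j i)\<^sup>2 = A / w j * (x j i / \<alpha> j)\<^sup>2 * inverse (\<bar>\<beta> j\<bar> / \<bar>\<alpha> j\<bar>)" for j
  proof -
    have "(X j i)\<^sup>2 = sqrt (A / area n (R j)) * sqrt (A / area n (R j)) * (x j i)\<^sup>2"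
      by (simp only: X_def power2_eq_square mult_ac)
    then have "(X j i)\<^sup>2 = A / area n (R j) * (x j i)\<^sup>2" unfolding sqrt_sq .
    moreover have "(x j i / \<alpha> j)\<^sup>2 = (x j i)\<^sup>2 / (\<bar>\<alpha> j\<bar> * \<bar>\<alpha> j\<bar>)" by (simp add: power_divide power2_eq_square)
    ultimately show ?thesis unfolding area_w
      using rearrange[of "\<bar>\<alpha> j\<bar>" "\<bar>\<beta> j\<bar>" "w j" "(x j i)\<^sup>2"] al_nz[of j] be_nz[of j] w_pos[of j] by simp
  qed
  moreover have "filterlim (\<lambda>j. A / w j * (x j i / \<alpha> j)\<^sup>2 * inverse (\<bar>\<beta> j\<bar> / \<bar>\<alpha> j\<bar>)) at_top sequentially"
  proof (rule filterlim_tendsto_pos_mult_at_top)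
    show "(\<lambda>j. A / w j * (x j i / \<alpha> j)\<^sup>2) \<longlonglongrightarrow> A / \<bar>limit_area n u v a b\<bar> * (a i)\<^sup>2"
      by (intro tendsto_mult tendsto_divide tendsto_power tendsto_const x_lim w_lim) (use L_nz in simp)
    show "A / \<bar>limit_area n u v a b\<bar> * (a i)\<^sup>2 > 0" using A_pos L_nz assms by simp
    show "filterlim (\<lambda>j. inverse (\<bar>\<beta> j\<bar> / \<bar>\<alpha> j\<bar>)) at_top sequentially"
      by (rule filterlim_inverse_at_top[OF ratio]) (use al_nz be_nz in simp)
  qed
  ultimately have "filterlim (\<lambda>j. (X j i)\<^sup>2) at_top sequentially" by simp
  then have "filterlim (\<lambda>j. sqrt ((X j i)\<^sup>2)) at_top sequentially" by (rule filterlim_compose[OF sqrt_at_top])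
  then show ?thesis by simp
qed

lemma a_nonzero: obtains i where "a i \<noteq> 0"
proof -
  have "\<exists>i. a i \<noteq> 0" using L_nz by (rule contrapos_np) (simp add: limit_area_eq)
  then show ?thesis using that by blast
qed

lemma subsequence_limits:
  assumes \<phi>: "strict_mono \<phi>" and \<sigma>: "\<sigma> \<in> {-1, 1}" "\<And>m. sgn (\<alpha> (\<phi> m) * \<beta> (\<phi> m)) = \<sigma>"
  shows "(\<lambda>m. X (\<phi> m) i * Y (\<phi> m) i) \<longlonglongrightarrow> \<sigma> * (A / \<bar>limit_area n u v a b\<bar>) * a i * b i"
    and "a i * b i \<noteq> 0 \<Longrightarrow> asymptotic_to (\<lambda>m. p + (X (\<phi> m) i *\<^sub>R u + Y (\<phi> m) i *\<^sub>R v))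
      (hyperbola p u v (\<sigma> * (A / \<bar>limit_area n u v a b\<bar>) * a i * b i))"
proof -
  have \<phi>': "filterlim \<phi> sequentially sequentially" by (rule filterlim_subseq[OF \<phi>])
  have "(\<lambda>m. \<sigma> * (X (\<phi> m) i * Y (\<phi> m) i)) \<longlonglongrightarrow> A / \<bar>limit_area n u v a b\<bar> * (a i * b i)"
    using filterlim_compose[OF XY_lim \<phi>'] \<sigma>(2) by simp
  then have "(\<lambda>m. \<sigma> * (\<sigma> * (X (\<phi> m) i * Y (\<phi> m) i))) \<longlonglongrightarrow> \<sigma> * (A / \<bar>limit_area n u v a b\<bar> * (a i * b i))"
    by (rule tendsto_mult_left)
  moreover have "\<sigma> * (\<sigma> * t) = t" for t using \<sigma>(1) by auto
  ultimately show lim: "(\<lambda>m. X (\<phi> m) i * Y (\<phi> m) i) \<longlonglongrightarrow> \<sigma> * (A / \<bar>limit_area n u v a b\<bar>) * a i * b i"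
    by (simp add: mult.assoc)
  assume "a i * b i \<noteq> 0"
  then have "a i \<noteq> 0" by simp
  show "asymptotic_to (\<lambda>m. p + (X (\<phi> m) i *\<^sub>R u + Y (\<phi> m) i *\<^sub>R v))
      (hyperbola p u v (\<sigma> * (A / \<bar>limit_area n u v a b\<bar>) * a i * b i))"
  proof (rule asymptotic_to_hyperbola[OF _ _ lim])
    show "u \<noteq> 0" using indep by (auto simp: det2_expand)
    show "filterlim (\<lambda>m. \<bar>X (\<phi> m) i\<bar>) at_top sequentially" by (rule filterlim_compose[OF X_lim[OF \<open>a i \<noteq> 0\<close>] \<phi>'])
    show "(\<lambda>m. Y (\<phi> m) i) \<longlonglongrightarrow> 0" by (rule filterlim_compose[OF Y_lim \<phi>'])
  qed (simp add: add.assoc)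
qed

end

section \<open>Two-scale data of the even and odd iterates\<close>

text \<open>The third coordinate 1 fixes the factor. Consequently the sequence hidden in
  \<open>nondeg_two_scale_under\<close> can only be \<open>tower\<close>.\<close>

lemma proj_maps_unique:
  assumes "proj_maps A P Q" "proj_maps A P Q'" shows "Q = Q'"
proof
  fix i
  obtain c c' where c: "c \<noteq> 0" "A *v hom_coords (P i) = c *\<^sub>R hom_coords (Q i)"
    "A *v hom_coords (P i) = c' *\<^sub>R hom_coords (Q' i)" using assms unfolding proj_maps_def by blast
  then have e: "c *\<^sub>R hom_coords (Q i) = c' *\<^sub>R hom_coords (Q' i)" by simp
  then have "c = c'" by (simp add: vec3_eq_iff)
  then have "hom_coords (Q i) = hom_coords (Q' i)" using e c(1) by simp
  then show "Q i = Q' i" by (simp add: hom_inj)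
qed

lemma centroid_scaleR_pair:
  "centroid n (\<lambda>i. X i *\<^sub>R u + Y i *\<^sub>R v) = ((\<Sum>i = 0..<int n. X i) / real n) *\<^sub>R u + ((\<Sum>i = 0..<int n. Y i) / real n) *\<^sub>R v"
  by (simp add: centroid_def sum.distrib scaleR_right_distrib flip: scaleR_sum_left)

context poncelet_normal_form begin

definition idx :: "nat \<Rightarrow> int \<Rightarrow> int" where "idx e i = 2 * i + 3 * int e"

definition TX :: "nat \<Rightarrow> nat \<Rightarrow> int \<Rightarrow> real" where
  "TX e m i = lam ^ (2 * m + e) * x (idx e i) / f (2 * m + e) (idx e i)"
definition TY :: "nat \<Rightarrow> nat \<Rightarrow> int \<Rightarrow> real" where
  "TY e m i = mu ^ (2 * m + e) * y (idx e i) / f (2 * m + e) (idx e i)"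

definition mean :: "(int \<Rightarrow> real) \<Rightarrow> real" where "mean g = (\<Sum>i = 0..<int n. g i) / real n"

lemma n_pos: "n > 0" using n5 by simp

lemma tower_centered:
  "tower e m i - centroid n (tower e m) = (TX e m i - mean (TX e m)) *\<^sub>R dirU + (TY e m i - mean (TY e m)) *\<^sub>R dirV"
proof -
  have t: "tower e m i - ctr = TX e m i *\<^sub>R dirU + TY e m i *\<^sub>R dirV" for i
    unfolding TX_def TY_def idx_def by (rule tower_coords)
  have "centroid n (tower e m) - ctr = centroid n (\<lambda>i. tower e m i - ctr)" by (rule centroid_translate[OF n_pos, symmetric])
  also have "\<dots> = mean (TX e m) *\<^sub>R dirU + mean (TY e m) *\<^sub>R dirV"
    unfolding t mean_def by (rule centroid_scaleR_pair)
  finally have "tower e m i - centroid n (tower e m)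
    = (TX e m i *\<^sub>R dirU + TY e m i *\<^sub>R dirV) - (mean (TX e m) *\<^sub>R dirU + mean (TY e m) *\<^sub>R dirV)"
    using t[of i] by (simp add: algebra_simps)
  then show ?thesis by (simp add: algebra_simps)
qed

lemma power_odd_lim:
  assumes "0 < a" "a < (1::real)" shows "(\<lambda>m. a ^ (2 * m + e)) \<longlonglongrightarrow> 0"
proof -
  have "(\<lambda>m. a ^ m) \<longlonglongrightarrow> 0" using assms by (intro LIMSEQ_power_zero) simp
  moreover have "filterlim (\<lambda>m. 2 * m + e) sequentially sequentially"
    by (rule filterlim_subseq) (simp add: strict_mono_def)
  ultimately show ?thesis by (rule filterlim_compose)
qed

lemma f_lim: "(\<lambda>m. f (2 * m + e) j) \<longlonglongrightarrow> M$3$3"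
proof -
  have "mu < 1" using mu_less_lam lam_less_1 by simp
  then have "(\<lambda>m. M$3$1 * (lam ^ (2 * m + e) * x j) + M$3$2 * (mu ^ (2 * m + e) * y j) + M$3$3)
     \<longlonglongrightarrow> M$3$1 * (0 * x j) + M$3$2 * (0 * y j) + M$3$3"
    by (intro tendsto_intros power_odd_lim lam_pos lam_less_1 mu_pos)
  then show ?thesis by (simp add: f_eq[abs_def])
qed

text \<open>The denominators tend to the constant \<open>M$3$3\<close>: the projective distortion
  fades, and the rescaled limit shape is an affine image of the chain polygon.\<close>

lemma TX_lim: "(\<lambda>m. TX e m i / lam ^ (2 * m + e)) \<longlonglongrightarrow> x (idx e i) / M$3$3"
  and TY_lim: "(\<lambda>m. TY e m i / mu ^ (2 * m + e)) \<longlonglongrightarrow> y (idx e i) / M$3$3"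
proof -
  have e: "TX e m i / lam ^ (2 * m + e) = x (idx e i) / f (2 * m + e) (idx e i)"
    "TY e m i / mu ^ (2 * m + e) = y (idx e i) / f (2 * m + e) (idx e i)" for m
    using lam_pos mu_pos by (simp_all add: TX_def TY_def)
  show "(\<lambda>m. TX e m i / lam ^ (2 * m + e)) \<longlonglongrightarrow> x (idx e i) / M$3$3"
    "(\<lambda>m. TY e m i / mu ^ (2 * m + e)) \<longlonglongrightarrow> y (idx e i) / M$3$3"
    unfolding e using center_pos by (auto intro!: tendsto_divide tendsto_const f_lim)
qed

lemma idx_Suc: "idx e (i + 1) = idx e i + 2" by (simp add: idx_def)

lemma r_idx_periodic: "r (idx e (i + int n)) = r (idx e i)"
proof -
  have "idx e (i + int n) = idx e i + 2 * int n" by (simp add: idx_def)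
  then show ?thesis by (simp only: r_periodic)
qed

lemma sum_cr_nonzero: "(\<Sum>i = 0..<int n. cr (idx e i)) \<noteq> 0"
proof -
  have "(\<Sum>i = 0..<int n. cr 0 * cr (idx e i)) > 0" using n_pos cr_sign by (intro sum_pos) auto
  then show ?thesis by (auto simp: sum_distrib_left[symmetric])
qed

text \<open>Limit shape in the coordinates \<open>dirU\<close>, \<open>dirV\<close>; the factor
  \<open>k\<close> is \<open>1 / M$3$3\<close> in general and 1 for the Jacobi form. Its centred
  coordinates \<open>ca\<close> and \<open>cb\<close> become the limit coefficients.\<close>

definition base :: "nat \<Rightarrow> real \<Rightarrow> polygon" where "base e k = (\<lambda>i. k *\<^sub>R r (idx e i))"

lemma base_ngon: "ngon n (base e k)" by (simp add: ngon_def base_def r_idx_periodic)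

lemma sarea_base: "sarea n (base e k) = k\<^sup>2 / 2 * (\<Sum>i = 0..<int n. cr (idx e i))"
  unfolding base_def sarea_scale by (simp add: sarea_def cr_def det2_expand idx_Suc)

definition ca :: "nat \<Rightarrow> real \<Rightarrow> int \<Rightarrow> real" where "ca e k i = (base e k i - centroid n (base e k)) $ 1"
definition cb :: "nat \<Rightarrow> real \<Rightarrow> int \<Rightarrow> real" where "cb e k i = (base e k i - centroid n (base e k)) $ 2"

lemma ca_eq: "ca e k i = k * x (idx e i) - mean (\<lambda>i. k * x (idx e i))"
  and cb_eq: "cb e k i = k * y (idx e i) - mean (\<lambda>i. k * y (idx e i))"
  by (simp_all add: ca_def cb_def base_def centroid_def mean_def)

lemma limit_area_centered: "limit_area n (t *\<^sub>R u) w (\<lambda>i. ca e k i / t) (cb e k) = sarea n (base e k) * det2 u w" if "t \<noteq> 0"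
proof -
  have "limit_area n (t *\<^sub>R u) w (\<lambda>i. ca e k i / t) (cb e k)
    = 1 / 2 * (\<Sum>i = 0..<int n. ca e k i * cb e k (i + 1) - cb e k i * ca e k (i + 1)) * det2 u w"
  proof -
    have "det2 (t *\<^sub>R u) w = t * det2 u w" by (simp add: det2_expand algebra_simps)
    moreover have "(\<Sum>i = 0..<int n. ca e k i / t * cb e k (i + 1) - cb e k i * (ca e k (i + 1) / t))
      = (\<Sum>i = 0..<int n. ca e k i * cb e k (i + 1) - cb e k i * ca e k (i + 1)) / t"
      by (simp add: sum_divide_distrib diff_divide_distrib)
    ultimately show ?thesis using that by (simp only: limit_area_eq) simp
  qed
  moreover have "1 / 2 * (\<Sum>i = 0..<int n. ca e k i * cb e k (i + 1) - cb e k i * ca e k (i + 1))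
    = sarea n (\<lambda>i. base e k i - centroid n (base e k))"
    unfolding sarea_def det2_expand ca_def cb_def ..
  ultimately show ?thesis by (simp add: sarea_translate[OF base_ngon])
qed

lemma tower_proj_maps:
  assumes c: "c \<noteq> 0" and conj: "\<And>w. (c *\<^sub>R G) *v (M *v w) = M *v dil w"
  shows "proj_maps G (tower e m) (tower e (Suc m))"
  unfolding proj_maps_def
proof
  fix i
  define g g' where "g = f (2 * m + e) (idx e i)" and "g' = f (2 * Suc m + e) (idx e i)"
  have pos: "g > 0" "g' > 0" unfolding g_def g'_def idx_def by (rule tower_f_pos)+
  have 1: "M *v v (2 * m + e) (idx e i) = g *\<^sub>R hom_coords (tower e m i)"
    "M *v v (2 * Suc m + e) (idx e i) = g' *\<^sub>R hom_coords (tower e (Suc m) i)"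
    unfolding g_def g'_def idx_def by (rule tower_hom)+
  have "2 * Suc m + e = (2 * m + e) + 2" by simp
  then have "M *v dil (v (2 * m + e) (idx e i)) = g' *\<^sub>R hom_coords (tower e (Suc m) i)"
    using 1(2) dil_v[of "2 * m + e" "idx e i"] by simp
  then have "(c *\<^sub>R G) *v (g *\<^sub>R hom_coords (tower e m i)) = g' *\<^sub>R hom_coords (tower e (Suc m) i)"
    using conj[of "v (2 * m + e) (idx e i)"] unfolding 1(1) by simp
  then have "(c * g) *\<^sub>R (G *v hom_coords (tower e m i)) = g' *\<^sub>R hom_coords (tower e (Suc m) i)"
    by (simp add: scaleR_matrix_vector_assoc[symmetric] matrix_vector_mult_scaleR mult.commute)
  then have "(1 / (c * g)) *\<^sub>R ((c * g) *\<^sub>R (G *v hom_coords (tower e m i))) = (1 / (c * g)) *\<^sub>R (g' *\<^sub>R hom_coords (tower e (Suc m) i))"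
    by simp
  then have "G *v hom_coords (tower e m i) = (g' / (c * g)) *\<^sub>R hom_coords (tower e (Suc m) i)"
    using c pos by simp
  moreover have "g' / (c * g) \<noteq> 0" using c pos by simp
  ultimately show "\<exists>d. d \<noteq> 0 \<and> G *v hom_coords (tower e m i) = d *\<^sub>R hom_coords (tower e (Suc m) i)" by blast
qed

text \<open>The scales are the powers of \<open>lam\<close> and \<open>mu\<close>, and the limit
  area is a nonzero multiple of a sum of \<open>cr\<close> of constant sign. The factor
  \<open>t\<close> allows for every vector along the spectral direction.\<close>

lemma two_scale_exists:
  assumes c: "c \<noteq> 0" and conj: "\<And>w. (c *\<^sub>R G) *v (M *v w) = M *v dil w" and t: "t \<noteq> 0"
  shows "\<exists>\<alpha> \<beta> a b. nondeg_two_scale_under n G ((pentagram ^^ e) P) (t *\<^sub>R dirU) dirV \<alpha> \<beta> a b"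
proof -
  define k where "k = 1 / M$3$3"
  have k: "k \<noteq> 0" using center_pos by (simp add: k_def)
  have "two_scale n (tower e) (t *\<^sub>R dirU) dirV (\<lambda>m. lam ^ (2 * m + e)) (\<lambda>m. mu ^ (2 * m + e)) (\<lambda>i. ca e k i / t) (cb e k)"
    unfolding two_scale_def
  proof (intro conjI allI exI)
    show "ngon n (tower e j)" for j by (rule tower_ngon)
    show "area n (tower e j) \<noteq> 0" for j unfolding tower_area by (rule T_area_nonzero)
    show "det2 (t *\<^sub>R dirU) dirV \<noteq> 0" using det2_UV t by (simp add: det2_expand)
    show "lam ^ (2 * j + e) \<noteq> 0" "mu ^ (2 * j + e) \<noteq> 0" for j using lam_pos mu_pos by simp_all
    show "tower e j i - centroid n (tower e j) = ((TX e j i - mean (TX e j)) / t) *\<^sub>R (t *\<^sub>R dirU) + (TY e j i - mean (TY e j)) *\<^sub>R dirV" for j i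
      using tower_centered[of e j i] t by simp
    show "(\<lambda>j. (TX e j i - mean (TX e j)) / t / lam ^ (2 * j + e)) \<longlonglongrightarrow> ca e k i / t" for i
    proof -
      have "(TX e j i - mean (TX e j)) / t / lam ^ (2 * j + e) = (TX e j i / lam ^ (2 * j + e) - (\<Sum>i = 0..<int n. TX e j i / lam ^ (2 * j + e)) / real n) / t" for j
        by (simp add: mean_def diff_divide_distrib sum_divide_distrib mult_ac)
      then show ?thesis unfolding ca_eq mean_def k_def
        by (simp only:) (intro tendsto_divide tendsto_diff tendsto_sum tendsto_const, use TX_lim n_pos t in simp_all)
    qed
    show "(\<lambda>j. (TY e j i - mean (TY e j)) / mu ^ (2 * j + e)) \<longlonglongrightarrow> cb e k i" for i
    proof -
      have "(TY e j i - mean (TY e j)) / mu ^ (2 * j + e) = TY e j i / mu ^ (2 * j + e) - (\<Sum>i = 0..<int n. TY e j i / mu ^ (2 * j + e)) / real n" for j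
        by (simp add: mean_def diff_divide_distrib sum_divide_distrib mult_ac)
      then show ?thesis unfolding cb_eq mean_def k_def
        by (simp only:) (intro tendsto_divide tendsto_diff tendsto_sum tendsto_const, use TY_lim n_pos in simp_all)
    qed
    have "(\<lambda>j. (mu / lam) ^ (2 * j + e)) \<longlonglongrightarrow> 0"
      by (rule power_odd_lim) (use lam_pos mu_pos mu_less_lam in simp_all)
    then show "(\<lambda>j. \<bar>mu ^ (2 * j + e)\<bar> / \<bar>lam ^ (2 * j + e)\<bar>) \<longlonglongrightarrow> 0"
      using lam_pos mu_pos by (simp add: power_divide)
  qed
  moreover have "limit_area n (t *\<^sub>R dirU) dirV (\<lambda>i. ca e k i / t) (cb e k) \<noteq> 0"
    unfolding limit_area_centered[OF t] sarea_base using det2_UV sum_cr_nonzero k by simp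
  ultimately show ?thesis
    unfolding nondeg_two_scale_under_def using tower_proj_maps[OF c conj] tower_0[of e] by blast
qed

text \<open>Bridge from arbitrary data to the explicit iterates; all limits below pass through
  it.\<close>

lemma two_scale_tower:
  assumes c: "c \<noteq> 0" and conj: "\<And>w. (c *\<^sub>R G) *v (M *v w) = M *v dil w"
    and data: "nondeg_two_scale_under n G ((pentagram ^^ e) P) u w \<alpha>' \<beta>' a b"
  obtains xx yy where "two_scale_sequence n (tower e) u w \<alpha>' \<beta>' a b xx yy (area n P)"
proof -
  obtain R where R: "R 0 = (pentagram ^^ e) P" "\<And>j. proj_maps G (R j) (R (Suc j))" "two_scale n R u w \<alpha>' \<beta>' a b"
    and L: "limit_area n u w a b \<noteq> 0" using data unfolding nondeg_two_scale_under_def by blast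
  have "R j = tower e j" for j
  proof (induction j)
    case 0 then show ?case by (simp add: R(1) tower_0)
  next
    case (Suc j) then show ?case using proj_maps_unique[OF R(2)[of j]] tower_proj_maps[OF c conj, of e j] by simp
  qed
  then have "R = tower e" by blast
  then have ts: "two_scale n (tower e) u w \<alpha>' \<beta>' a b" using R(3) by simp
  then obtain xx yy where "\<And>j i. tower e j i - centroid n (tower e j) = xx j i *\<^sub>R u + yy j i *\<^sub>R w"
    "\<And>i. (\<lambda>j. xx j i / \<alpha>' j) \<longlonglongrightarrow> a i" "\<And>i. (\<lambda>j. yy j i / \<beta>' j) \<longlonglongrightarrow> b i"
    unfolding two_scale_def by blast
  moreover have "area n P > 0" using T_area_nonzero[of 0] by (simp add: T_0 area_sarea)
  ultimately have "two_scale_sequence n (tower e) u w \<alpha>' \<beta>' a b xx yy (area n P)"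
    using ts L n_pos unfolding two_scale_def by unfold_locales auto
  then show ?thesis using that by blast
qed

end

section \<open>Spectrum and flattening\<close>

text \<open>\<open>H\<close> is similar to a diagonal matrix. The similarity is used at each real
  argument, and polynomials with equal values agree.\<close>

lemma char_polynomial_eqI:
  fixes H M :: "real^3^3"
  assumes M: "invertible M" and conj: "\<And>w. H *v (M *v w) = M *v vector [a * w$1, b * w$2, w$3]"
  shows "char_polynomial H = [:-1, 1:] * [:a * b, - (a + b), 1:]"
proof -
  define L :: "real^3^3" where "L = vector [vector [a, 0, 0], vector [0, b, 0], vector [0, 0, 1]]"
  have poly_char: "poly (char_polynomial A) t = Determinants.det (t *\<^sub>R Finite_Cartesian_Product.mat 1 - A)" for A :: "real^3^3" and t
    unfolding char_polynomial_def
    by (simp add: Determinants.det_3 Finite_Cartesian_Product.mat_def algebra_simps)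
  have "L *v w = vector [a * w$1, b * w$2, w$3]" for w by (simp add: L_def matrix_mult_vec_3)
  then have "(H ** M) *v w = (M ** L) *v w" for w using conj by (simp add: matrix_vector_mul_assoc[symmetric])
  then have HM: "H ** M = M ** L" by (simp add: matrix_eq)
  have "poly (char_polynomial H) t = poly ([:-1, 1:] * [:a * b, - (a + b), 1:]) t" for t
  proof -
    have "(t *\<^sub>R Finite_Cartesian_Product.mat 1 - H) ** M = t *\<^sub>R M - H ** M"
      by (simp add: matrix_eq matrix_vector_mul_assoc[symmetric] matrix_vector_mult_diff_rdistrib scaleR_matrix_vector_assoc[symmetric])
    also have "\<dots> = M ** (t *\<^sub>R Finite_Cartesian_Product.mat 1 - L)" unfolding HM
      by (simp add: matrix_eq matrix_vector_mul_assoc[symmetric] matrix_vector_mult_diff_rdistrib matrix_vector_mult_diff_distrib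
        scaleR_matrix_vector_assoc[symmetric] matrix_vector_mult_scaleR)
    finally have "Determinants.det (t *\<^sub>R Finite_Cartesian_Product.mat 1 - H) * Determinants.det M
      = Determinants.det M * Determinants.det (t *\<^sub>R Finite_Cartesian_Product.mat 1 - L)" by (metis det_mul)
    moreover have "Determinants.det M \<noteq> 0" using M invertible_det_nz by blast
    ultimately have "Determinants.det (t *\<^sub>R Finite_Cartesian_Product.mat 1 - H) = Determinants.det (t *\<^sub>R Finite_Cartesian_Product.mat 1 - L)" by simp
    also have "\<dots> = (t - 1) * (t * t - (a + b) * t + a * b)"
      by (simp add: L_def Determinants.det_3 Finite_Cartesian_Product.mat_def algebra_simps)
    finally show ?thesis by (simp add: poly_char algebra_simps)
  qed
  then show ?thesis by (metis poly_eq_poly_eq_iff ext)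
qed

context poncelet_normal_form begin

lemma M_inj: "M *v w = M *v w' \<Longrightarrow> w = w'"
proof -
  have "inj ((*v) M)" using M_inv invertible_eq_bij bij_is_inj by blast
  then show "M *v w = M *v w' \<Longrightarrow> w = w'" by (rule injD)
qed

lemma M_surj: obtains w where "z = M *v w"
proof -
  have "surj ((*v) M)" using M_inv invertible_eq_bij bij_is_surj by blast
  then show ?thesis using that by (rule surjE)
qed

lemma eigen_iff:
  assumes conj: "\<And>w. H *v (M *v w) = M *v dil w"
  shows "eigenvec H t z \<longleftrightarrow> (\<exists>w. z = M *v w \<and> w \<noteq> 0 \<and> (lam\<^sup>2 - t) * w$1 = 0 \<and> (mu\<^sup>2 - t) * w$2 = 0 \<and> (1 - t) * w$3 = 0)"
proof -
  have "eigenvec H t (M *v w) \<longleftrightarrow> w \<noteq> 0 \<and> (lam\<^sup>2 - t) * w$1 = 0 \<and> (mu\<^sup>2 - t) * w$2 = 0 \<and> (1 - t) * w$3 = 0" for w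
  proof -
    have "M *v w = 0 \<longleftrightarrow> w = 0" using M_inj[of w 0] by auto
    moreover have "H *v (M *v w) = t *\<^sub>R (M *v w) \<longleftrightarrow> dil w = t *\<^sub>R w"
    proof -
      have "t *\<^sub>R (M *v w) = M *v (t *\<^sub>R w)" by (simp add: matrix_vector_mult_scaleR)
      then show ?thesis unfolding conj by (auto dest: M_inj)
    qed
    moreover have "dil w = t *\<^sub>R w \<longleftrightarrow> (lam\<^sup>2 - t) * w$1 = 0 \<and> (mu\<^sup>2 - t) * w$2 = 0 \<and> (1 - t) * w$3 = 0"
      by (auto simp: dil_def vec3_eq_iff left_diff_distrib)
    ultimately show ?thesis by (simp add: eigenvec_def)
  qed
  note key = this
  obtain w where z: "z = M *v w" by (rule M_surj)
  show ?thesis unfolding z key by (auto dest: M_inj)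
qed

lemma lam_mu_sq: "0 < mu\<^sup>2" "mu\<^sup>2 < lam\<^sup>2" "lam\<^sup>2 < 1"
  using mu_pos mu_less_lam lam_less_1 lam_pos by (simp_all add: power_strict_mono power_less_one_iff)

lemma eigenvalues:
  assumes conj: "\<And>w. H *v (M *v w) = M *v dil w"
  shows "{t. \<exists>z. eigenvec H t z} = {1, lam\<^sup>2, mu\<^sup>2}"
proof -
  have 1: "(\<exists>z. eigenvec H t z) \<longleftrightarrow> (\<exists>w :: real^3. w \<noteq> 0 \<and> (lam\<^sup>2 - t) * w$1 = 0 \<and> (mu\<^sup>2 - t) * w$2 = 0 \<and> (1 - t) * w$3 = 0)" for t
    by (simp only: eigen_iff[OF conj]) (subst ex_comm, simp only: ex_simps simp_thms)
  have 2: "(\<exists>w :: real^3. w \<noteq> 0 \<and> (lam\<^sup>2 - t) * w$1 = 0 \<and> (mu\<^sup>2 - t) * w$2 = 0 \<and> (1 - t) * w$3 = 0)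
    \<longleftrightarrow> t = 1 \<or> t = lam\<^sup>2 \<or> t = mu\<^sup>2" for t
  proof
    assume "\<exists>w :: real^3. w \<noteq> 0 \<and> (lam\<^sup>2 - t) * w$1 = 0 \<and> (mu\<^sup>2 - t) * w$2 = 0 \<and> (1 - t) * w$3 = 0"
    then obtain w :: "real^3" where w: "w \<noteq> 0" "lam\<^sup>2 - t = 0 \<or> w$1 = 0" "mu\<^sup>2 - t = 0 \<or> w$2 = 0" "1 - t = 0 \<or> w$3 = 0"
      by (auto simp only: mult_eq_0_iff)
    have "w$1 \<noteq> 0 \<or> w$2 \<noteq> 0 \<or> w$3 \<noteq> 0" using w(1) by (simp add: vec3_eq_iff)
    then show "t = 1 \<or> t = lam\<^sup>2 \<or> t = mu\<^sup>2" using w(2-4) by argo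
  next
    assume "t = 1 \<or> t = lam\<^sup>2 \<or> t = mu\<^sup>2"
    then consider "t = 1" | "t = lam\<^sup>2" | "t = mu\<^sup>2" by blast
    then show "\<exists>w :: real^3. w \<noteq> 0 \<and> (lam\<^sup>2 - t) * w$1 = 0 \<and> (mu\<^sup>2 - t) * w$2 = 0 \<and> (1 - t) * w$3 = 0"
    proof cases
      case 1 show ?thesis unfolding 1 by (intro exI[of _ "vector [0, 0, 1]"]) (simp add: vec3_eq_iff)
    next
      case 2 show ?thesis unfolding 2 by (intro exI[of _ "vector [1, 0, 0]"]) (simp add: vec3_eq_iff)
    next
      case 3 show ?thesis unfolding 3 by (intro exI[of _ "vector [0, 1, 0]"]) (simp add: vec3_eq_iff)
    qed
  qed
  have "(\<exists>z. eigenvec H t z) \<longleftrightarrow> t = 1 \<or> t = lam\<^sup>2 \<or> t = mu\<^sup>2" for t using 1[of t] 2[of t] by (rule trans)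
  note e = this
  have "{t. \<exists>z. eigenvec H t z} = {t. t = 1 \<or> t = lam\<^sup>2 \<or> t = mu\<^sup>2}" by (rule Collect_cong[OF e])
  also have "\<dots> = {1, lam\<^sup>2, mu\<^sup>2}" by blast
  finally show ?thesis .
qed

text \<open>The eigenpoints for 1 and \<open>lam^2\<close> are the images of the centre and of the
  point at infinity on the first axis. By construction \<open>dirU\<close> is the combination of
  them without third coordinate.\<close>

lemma affine_direction_iff:
  assumes conj: "\<And>w. H *v (M *v w) = M *v dil w" and X: "eigenvec H 1 X1" "eigenvec H (lam\<^sup>2) X2"
  shows "affine_direction X1 X2 u \<longleftrightarrow> (\<exists>t. t \<noteq> 0 \<and> u = t *\<^sub>R dirU)"
proof -
  obtain w1 where w1: "X1 = M *v w1" "w1 \<noteq> 0" "w1 $ 1 = 0" "w1 $ 2 = 0"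
    using X(1) lam_mu_sq unfolding eigen_iff[OF conj] by auto
  obtain w2 where w2: "X2 = M *v w2" "w2 \<noteq> 0" "w2 $ 2 = 0" "w2 $ 3 = 0"
    using X(2) lam_mu_sq unfolding eigen_iff[OF conj] by auto
  define k l where "k = w1 $ 3" and "l = w2 $ 1"
  have kl: "k \<noteq> 0" "l \<noteq> 0" using w1 w2 by (auto simp: k_def l_def vec3_eq_iff)
  have X1: "X1 $ 1 = k * M$1$3" "X1 $ 2 = k * M$2$3" "X1 $ 3 = k * M$3$3"
    using w1 by (simp_all add: matrix_mult_vec_3 k_def)
  have X2: "X2 $ 1 = l * M$1$1" "X2 $ 2 = l * M$2$1" "X2 $ 3 = l * M$3$1"
    using w2 by (simp_all add: matrix_mult_vec_3 l_def)
  have c: "M$1$3 = ctr$1 * M$3$3" "M$2$3 = ctr$2 * M$3$3" using center_pos by (simp_all add: ctr_def)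
  have span: "(vector [u$1, u$2, 0] :: real^3) \<in> span {X1, X2} \<longleftrightarrow> (\<exists>a b. u$1 = a * X1$1 + b * X2$1 \<and> u$2 = a * X1$2 + b * X2$2 \<and> 0 = a * X1$3 + b * X2$3)"
  proof -
    have pt: "vector [u$1, u$2, 0] - a *\<^sub>R X1 = b *\<^sub>R X2 \<longleftrightarrow> u$1 = a * X1$1 + b * X2$1 \<and> u$2 = a * X1$2 + b * X2$2 \<and> 0 = a * X1$3 + b * X2$3" for a b
      unfolding vec3_eq_iff by (simp, argo)
    have "(vector [u$1, u$2, 0] :: real^3) \<in> span {X1, X2} \<longleftrightarrow> (\<exists>a b. vector [u$1, u$2, 0] - a *\<^sub>R X1 = b *\<^sub>R X2)"
      by (auto simp: span_breakdown_eq span_singleton)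
    then show ?thesis unfolding pt .
  qed
  have nz: "dirU \<noteq> 0" using det2_UV by (auto simp: det2_expand)
  have nz1: "\<not> (X1 $ 3 = 0 \<and> X2 $ 3 = 0)" using X1(3) kl center_pos by simp
  show ?thesis
  proof
    assume "affine_direction X1 X2 u"
    then obtain a b where u: "u \<noteq> 0" and ab: "u$1 = a * X1$1 + b * X2$1" "u$2 = a * X1$2 + b * X2$2" "0 = a * X1$3 + b * X2$3"
      unfolding affine_direction_def span by blast
    have z: "a * k * M$3$3 = - (b * l * M$3$1)" using ab(3) by (simp add: X1 X2 mult.assoc)
    have "u$1 = (b * l) * dirU$1" "u$2 = (b * l) * dirU$2"
    proof -
      have "u$1 = ctr$1 * (a * k * M$3$3) + b * l * M$1$1" using ab(1) unfolding X1 X2 c by (simp add: mult_ac)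
      then show "u$1 = (b * l) * dirU$1" unfolding z by (simp add: dirU_def algebra_simps)
      have "u$2 = ctr$2 * (a * k * M$3$3) + b * l * M$2$1" using ab(2) unfolding X1 X2 c by (simp add: mult_ac)
      then show "u$2 = (b * l) * dirU$2" unfolding z by (simp add: dirU_def algebra_simps)
    qed
    then have "u = (b * l) *\<^sub>R dirU" by (simp add: vec2_eq_iff)
    moreover have "b * l \<noteq> 0" using u calculation by auto
    ultimately show "\<exists>t. t \<noteq> 0 \<and> u = t *\<^sub>R dirU" by blast
  next
    assume "\<exists>t. t \<noteq> 0 \<and> u = t *\<^sub>R dirU"
    then obtain t where t: "t \<noteq> 0" "u = t *\<^sub>R dirU" by blast
    \<comment> \<open>The coefficient \<open>b\<close> produces \<open>t\<close> times the first
      column of \<open>M\<close>, and \<open>a\<close> cancels the third coordinate.\<close>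
    define a b where "a = - (t * M$3$1 / (k * M$3$3))" and "b = t / l"
    have bl: "b * (l * z) = t * z" for z using kl by (simp add: b_def)
    have ak: "a * (k * (z * M$3$3)) = - (t * M$3$1 * z)" for z using kl center_pos by (simp add: a_def)
    have "u$1 = a * X1$1 + b * X2$1 \<and> u$2 = a * X1$2 + b * X2$2 \<and> 0 = a * X1$3 + b * X2$3"
      unfolding X1 X2 c bl ak using ak[of 1] by (simp add: t dirU_def algebra_simps)
    then have "(vector [u$1, u$2, 0] :: real^3) \<in> span {X1, X2}" unfolding span by blast
    then show "affine_direction X1 X2 u" unfolding affine_direction_def using nz nz1 t by simp
  qed
qed

text \<open>Coordinates with respect to \<open>u\<close> and \<open>w\<close> are unique, so the
  given \<open>X\<close> and \<open>Y\<close> are those of the locale.\<close>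

lemma two_scale_clause:
  assumes c: "c \<noteq> 0" and conj: "\<And>w. (c *\<^sub>R G) *v (M *v w) = M *v dil w"
    and data: "nondeg_two_scale_under n G ((pentagram ^^ e) P) u w \<alpha>' \<beta>' a b"
    and XY: "\<And>j i. compensated n P e j i - centroid n P = X j i *\<^sub>R u + Y j i *\<^sub>R w"
    and \<phi>: "strict_mono \<phi>" "\<sigma> \<in> {-1, 1}" "\<And>m. sgn (\<alpha>' (\<phi> m) * \<beta>' (\<phi> m)) = \<sigma>"
  shows "(\<lambda>m. X (\<phi> m) i * Y (\<phi> m) i) \<longlonglongrightarrow> \<sigma> * (area n P / \<bar>limit_area n u w a b\<bar>) * a i * b i"
    and "a i * b i \<noteq> 0 \<Longrightarrow> asymptotic_to (\<lambda>m. compensated n P e (\<phi> m) i)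
      (hyperbola (centroid n P) u w (\<sigma> * (area n P / \<bar>limit_area n u w a b\<bar>) * a i * b i))"
proof -
  obtain xx yy where "two_scale_sequence n (tower e) u w \<alpha>' \<beta>' a b xx yy (area n P)"
    by (rule two_scale_tower[OF c conj data])
  then interpret ts: two_scale_sequence n "tower e" u w \<alpha>' \<beta>' a b xx yy "area n P" .
  have comp: "compensated n P e j i = centroid n P + (ts.X j i *\<^sub>R u + ts.Y j i *\<^sub>R w)" for j i
    unfolding compensated_tower ts.scaled_coords ..
  have "X j i *\<^sub>R u + Y j i *\<^sub>R w = ts.X j i *\<^sub>R u + ts.Y j i *\<^sub>R w" for j i
    using XY[of j i] comp[of j i] by simp
  then have e: "X j i = ts.X j i" "Y j i = ts.Y j i" for j i
    using det2_independent[OF ts.indep] by blast+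
  show "(\<lambda>m. X (\<phi> m) i * Y (\<phi> m) i) \<longlonglongrightarrow> \<sigma> * (area n P / \<bar>limit_area n u w a b\<bar>) * a i * b i"
    unfolding e by (rule ts.subsequence_limits(1)[OF \<phi>])
  show "asymptotic_to (\<lambda>m. compensated n P e (\<phi> m) i)
      (hyperbola (centroid n P) u w (\<sigma> * (area n P / \<bar>limit_area n u w a b\<bar>) * a i * b i))" if "a i * b i \<noteq> 0"
    unfolding comp by (rule ts.subsequence_limits(2)[OF \<phi> that])
qed

lemma compensated_ngon: "ngon n (compensated n P e m)"
  unfolding ngon_def compensated_tower using tower_ngon[of e m] by (simp add: ngon_def)

lemma normalized_compensated: "(normalized_pentagram n ^^ (2 * m + e)) P i = compensated n P e m (i + 3 * int m)"
  by (simp add: compensated_def shift_def)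

lemma centroid_compensated: "centroid n (compensated n P e m) = centroid n P"
  unfolding compensated_tower[abs_def] centroid_homothety[OF n_pos] by simp

text \<open>The second coordinates bound the distance to the line, and one diverging first
  coordinate forces the diameter to grow. Even and odd iterates have separate data and are joined at
  the end.\<close>

lemma flattening:
  assumes c: "c \<noteq> 0" and conj: "\<And>w. (c *\<^sub>R G) *v (M *v w) = M *v dil w" and t: "t \<noteq> 0" "u = t *\<^sub>R dirU"
  shows "(\<lambda>k. Max ((\<lambda>i. infdist ((normalized_pentagram n ^^ k) P i) (affine_line (centroid n P) u)) ` {0..<int n})) \<longlonglongrightarrow> 0"
    and "filterlim (\<lambda>k. diameter (range ((normalized_pentagram n ^^ k) P))) at_top sequentially"
proof -
  define F where "F k = Max ((\<lambda>i. infdist ((normalized_pentagram n ^^ k) P i) (affine_line (centroid n P) u)) ` {0..<int n})" for k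
  define dm where "dm k = diameter (range ((normalized_pentagram n ^^ k) P))" for k
  have main: "(\<lambda>m. F (2 * m + e)) \<longlonglongrightarrow> 0 \<and> filterlim (\<lambda>m. dm (2 * m + e)) at_top sequentially" for e
  proof -
    obtain \<alpha>' \<beta>' a b where data: "nondeg_two_scale_under n G ((pentagram ^^ e) P) u dirV \<alpha>' \<beta>' a b"
      using two_scale_exists[OF c conj t(1)] t(2) by blast
    obtain xx yy where "two_scale_sequence n (tower e) u dirV \<alpha>' \<beta>' a b xx yy (area n P)"
      by (rule two_scale_tower[OF c conj data])
    then interpret ts: two_scale_sequence n "tower e" u dirV \<alpha>' \<beta>' a b xx yy "area n P" .
    have comp: "compensated n P e j i = centroid n P + (ts.X j i *\<^sub>R u + ts.Y j i *\<^sub>R dirV)" for j i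
      unfolding compensated_tower ts.scaled_coords ..
    \<comment> \<open>A bound common to all vertices, so the relabelling between iterate and
      compensated polygon is harmless for the maximum.\<close>
    define S where "S m = (\<Sum>i = 0..<int n. \<bar>ts.Y m i\<bar>) * norm dirV" for m
    have "S \<longlonglongrightarrow> (\<Sum>i = 0..<int n. \<bar>0\<bar>) * norm dirV" unfolding S_def[abs_def] by (intro tendsto_intros ts.Y_lim)
    then have S0: "S \<longlonglongrightarrow> 0" by simp
    have inf: "infdist (compensated n P e m i) (affine_line (centroid n P) u) \<le> S m" for m i
    proof -
      define i' where "i' = i mod int n"
      have i': "i' \<in> {0..<int n}" using n_pos by (simp add: i'_def)
      have "compensated n P e m (j + k * int n) = compensated n P e m j" for j k
      proof (induction k rule: int_induct[where k = 0])
        case (step1 k) then show ?case using compensated_ngon[of e m] by (simp add: ngon_def distrib_right add.assoc[symmetric])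
      next
        case (step2 k)
        have "compensated n P e m (j + (k - 1) * int n + int n) = compensated n P e m (j + (k - 1) * int n)"
          using compensated_ngon[of e m] by (simp add: ngon_def)
        then show ?case using step2 by (simp add: left_diff_distrib)
      qed simp
      from this[of i' "i div int n"] have ci: "compensated n P e m i = compensated n P e m i'" by (simp add: i'_def add.commute)
      have "infdist (compensated n P e m i') (affine_line (centroid n P) u) \<le> dist (compensated n P e m i') (centroid n P + ts.X m i' *\<^sub>R u)"
        unfolding affine_line_def by (intro infdist_le rangeI)
      also have "\<dots> = \<bar>ts.Y m i'\<bar> * norm dirV" by (simp add: comp dist_norm)
      also have "\<dots> \<le> S m" unfolding S_def using member_le_sum[of i' "{0..<int n}" "\<lambda>i. \<bar>ts.Y m i\<bar>"] i' by (intro mult_right_mono) auto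
      finally show ?thesis unfolding ci .
    qed
    have bnd: "0 \<le> F (2 * m + e) \<and> F (2 * m + e) \<le> S m" for m
    proof
      show "F (2 * m + e) \<le> S m" unfolding F_def normalized_compensated using inf n_pos by (intro Max.boundedI) auto
      have "infdist ((normalized_pentagram n ^^ (2 * m + e)) P 0) (affine_line (centroid n P) u) \<le> F (2 * m + e)"
        unfolding F_def using n_pos by (intro Max_ge) auto
      then show "0 \<le> F (2 * m + e)" using infdist_nonneg order_trans by blast
    qed
    have F: "(\<lambda>m. F (2 * m + e)) \<longlonglongrightarrow> 0"
      by (rule tendsto_sandwich[OF _ _ tendsto_const S0]) (use bnd in auto)
    obtain i where i: "a i \<noteq> 0" by (rule ts.a_nonzero)
    have "u \<noteq> 0" using ts.indep by (auto simp: det2_expand)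
    then have "filterlim (\<lambda>m. norm u * \<bar>ts.X m i\<bar>) at_top sequentially"
      by (intro filterlim_tendsto_pos_mult_at_top[OF tendsto_const _ ts.X_lim[OF i]]) simp
    moreover have "(\<lambda>m. - (\<bar>ts.Y m i\<bar> * norm dirV)) \<longlonglongrightarrow> - (\<bar>0\<bar> * norm dirV)" by (intro tendsto_intros ts.Y_lim)
    ultimately have "filterlim (\<lambda>m. - (\<bar>ts.Y m i\<bar> * norm dirV) + norm u * \<bar>ts.X m i\<bar>) at_top sequentially"
      by (intro filterlim_tendsto_add_at_top)
    then have D: "filterlim (\<lambda>m. dm (2 * m + e)) at_top sequentially"
    proof (rule filterlim_at_top_mono, intro always_eventually allI)
      fix m
      have "range ((normalized_pentagram n ^^ (2 * m + e)) P) = range (compensated n P e m)"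
      proof (intro equalityI subsetI)
        fix z assume "z \<in> range ((normalized_pentagram n ^^ (2 * m + e)) P)"
        then obtain l where "z = (normalized_pentagram n ^^ (2 * m + e)) P l" by blast
        then show "z \<in> range (compensated n P e m)" unfolding normalized_compensated by blast
      next
        fix z assume "z \<in> range (compensated n P e m)"
        then obtain l where "z = compensated n P e m l" by blast
        then have "z = (normalized_pentagram n ^^ (2 * m + e)) P (l - 3 * int m)" unfolding normalized_compensated by simp
        then show "z \<in> range ((normalized_pentagram n ^^ (2 * m + e)) P)" by blast
      qed
      then have "norm (compensated n P e m i - centroid n P) \<le> dm (2 * m + e)"
        using norm_diff_centroid_le_diameter[OF n_pos compensated_ngon[of e m], of i] by (simp add: dm_def centroid_compensated)
      moreover have "norm (ts.X m i *\<^sub>R u) - norm (ts.Y m i *\<^sub>R dirV) \<le> norm (ts.X m i *\<^sub>R u + ts.Y m i *\<^sub>R dirV)"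
        by (rule norm_diff_ineq)
      ultimately show "- (\<bar>ts.Y m i\<bar> * norm dirV) + norm u * \<bar>ts.X m i\<bar> \<le> dm (2 * m + e)" by (simp add: comp mult.commute)
    qed
    show ?thesis using F D by blast
  qed
  have "F \<longlonglongrightarrow> 0" by (rule filterlim_even_odd) (use main[of 0] main[of 1] in simp_all)
  then show "(\<lambda>k. Max ((\<lambda>i. infdist ((normalized_pentagram n ^^ k) P i) (affine_line (centroid n P) u)) ` {0..<int n})) \<longlonglongrightarrow> 0"
    unfolding F_def[abs_def] .
  have "filterlim dm at_top sequentially" by (rule filterlim_even_odd) (use main[of 0] main[of 1] in simp_all)
  then show "filterlim (\<lambda>k. diameter (range ((normalized_pentagram n ^^ k) P))) at_top sequentially" unfolding dm_def[abs_def] .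
qed

text \<open>For \<open>M\<close> the identity all denominators are 1, and area and coordinate
  product carry the same power of \<open>lam * mu\<close>. So the product is independent of
  \<open>j\<close>, and being constant it equals the limit that any data predict.\<close>

lemma diagonal_exact:
  assumes c: "c \<noteq> 0" and conj: "\<And>w. (c *\<^sub>R G) *v (M *v w) = M *v dil w" and M1: "M = Finite_Cartesian_Product.mat 1"
    and data: "nondeg_two_scale_under n G ((pentagram ^^ e) P) (vector [1, 0]) (vector [0, 1]) \<alpha>' \<beta>' a b"
    and \<phi>: "strict_mono (\<phi> :: nat \<Rightarrow> nat)" "\<sigma> \<in> {-1, 1}" "\<And>m. sgn (\<alpha>' (\<phi> m) * \<beta>' (\<phi> m)) = \<sigma>"
  shows "compensated n P e j i \<in> hyperbola (centroid n P) (vector [1, 0]) (vector [0, 1])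
     (\<sigma> * (area n P / \<bar>limit_area n (vector [1, 0]) (vector [0, 1]) a b\<bar>) * a i * b i)"
proof -
  have Mv: "M *v w = w" for w by (simp add: M1)
  have f1: "f k l = 1" for k l by (simp add: f_def Mv v_def)
  have UV: "dirU = vector [1, 0]" "dirV = vector [0, 1]"
    unfolding dirU_def dirV_def ctr_def by (simp_all add: M1 Finite_Cartesian_Product.mat_def)
  define cx cy where "cx = x (idx e i) - mean (\<lambda>i. x (idx e i))" and "cy = y (idx e i) - mean (\<lambda>i. y (idx e i))"
  define k where "k m = sqrt (area n P / area n (tower e m))" for m
  have TXY: "TX e m l = lam ^ (2 * m + e) * x (idx e l)" "TY e m l = mu ^ (2 * m + e) * y (idx e l)" for m l
    by (simp_all add: TX_def TY_def f1)
  have m1: "mean (\<lambda>i. s * g i) = s * mean g" for s g by (simp add: mean_def sum_distrib_left)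
  have tc: "tower e m i - centroid n (tower e m) = (lam ^ (2 * m + e) * cx) *\<^sub>R vector [1, 0] + (mu ^ (2 * m + e) * cy) *\<^sub>R vector [0, 1]" for m
    unfolding tower_centered TXY UV m1 cx_def cy_def by (simp only: right_diff_distrib)
  define X Y where "X m = k m * (lam ^ (2 * m + e) * cx)" and "Y m = k m * (mu ^ (2 * m + e) * cy)" for m
  have comp: "compensated n P e m i = centroid n P + (X m *\<^sub>R vector [1, 0] + Y m *\<^sub>R vector [0, 1])" for m
    unfolding compensated_tower tc X_def Y_def k_def by (simp only: scaleR_right_distrib scaleR_scaleR)
  define q where "q = sarea n (base e 1)"
  have area_m: "area n (tower e m) = (lam * mu) ^ (2 * m + e) * \<bar>q\<bar>" for m
  proof -
    have pt: "TX e m l * TY e m (l + 1) - TY e m l * TX e m (l + 1) = (lam * mu) ^ (2 * m + e) * cr (idx e l)" for l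
      by (simp add: TXY cr_def idx_Suc power_mult_distrib right_diff_distrib)
    have "sarea n (tower e m) = 1 / 2 * (\<Sum>l = 0..<int n. TX e m l * TY e m (l + 1) - TY e m l * TX e m (l + 1)) * det2 dirU dirV"
      by (rule sarea_combination[OF tower_ngon, where c = ctr]) (simp add: TX_def TY_def idx_def tower_coords)
    also have "\<dots> = (lam * mu) ^ (2 * m + e) * q"
      unfolding pt sum_distrib_left[symmetric] q_def sarea_base UV by (simp add: det2_expand)
    finally show ?thesis using lam_pos mu_pos by (simp add: area_sarea abs_mult)
  qed
  have q: "q \<noteq> 0" using sum_cr_nonzero by (simp add: q_def sarea_base)
  have apos: "area n (tower e m) > 0" for m unfolding area_m using q lam_pos mu_pos by simp
  have XY: "X m * Y m = area n P / \<bar>q\<bar> * (cx * cy)" for m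
  proof -
    have "k m * k m = area n P / area n (tower e m)" unfolding k_def
      by (rule real_sqrt_mult_self[THEN trans]) (use apos[of m] in \<open>simp add: area_sarea[of n P]\<close>)
    moreover have "X m * Y m = (k m * k m) * ((lam * mu) ^ (2 * m + e) * (cx * cy))"
      by (simp only: X_def Y_def power_mult_distrib mult_ac)
    moreover have "a / (z * b) * (z * d) = a / b * d" if "z \<noteq> 0" for a b d z :: real using that by simp
    moreover have "(lam * mu) ^ (2 * m + e) \<noteq> 0" using lam_pos mu_pos by simp
    ultimately show ?thesis unfolding area_m by (simp only:)
  qed
  obtain xx yy where "two_scale_sequence n (tower e) (vector [1, 0]) (vector [0, 1]) \<alpha>' \<beta>' a b xx yy (area n P)"
    by (rule two_scale_tower[OF c conj data])
  then interpret ts: two_scale_sequence n "tower e" "vector [1, 0]" "vector [0, 1]" \<alpha>' \<beta>' a b xx yy "area n P" .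
  have "ts.X m i = X m" "ts.Y m i = Y m" for m
  proof -
    have "ts.X m i *\<^sub>R vector [1, 0] + ts.Y m i *\<^sub>R vector [0, 1] = X m *\<^sub>R vector [1, 0] + Y m *\<^sub>R (vector [0, 1] :: real^2)"
      unfolding ts.scaled_coords[symmetric] using comp[of m] unfolding compensated_tower by simp
    then show "ts.X m i = X m" "ts.Y m i = Y m" using det2_independent[OF ts.indep] by blast+
  qed
  then have "(\<lambda>m. area n P / \<bar>q\<bar> * (cx * cy)) \<longlonglongrightarrow> \<sigma> * (area n P / \<bar>limit_area n (vector [1, 0]) (vector [0, 1]) a b\<bar>) * a i * b i"
    using ts.subsequence_limits(1)[OF \<phi>, of i] by (simp add: XY)
  then have "area n P / \<bar>q\<bar> * (cx * cy) = \<sigma> * (area n P / \<bar>limit_area n (vector [1, 0]) (vector [0, 1]) a b\<bar>) * a i * b i"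
    by (rule LIMSEQ_unique[OF tendsto_const])
  then have "X j * Y j = \<sigma> * (area n P / \<bar>limit_area n (vector [1, 0]) (vector [0, 1]) a b\<bar>) * a i * b i" using XY by simp
  then show ?thesis unfolding hyperbola_def comp by (auto simp: add.assoc)
qed

end

section \<open>The discriminant\<close>

text \<open>The minors are again given by entry functions, so the expansion can be iterated
  symbolically.\<close>

lemma det_mat_Suc:
  "Determinant.det (Matrix.mat (Suc n) (Suc n) f) = (\<Sum>j<Suc n. (-1) ^ j * f (0, j) *
     Determinant.det (Matrix.mat n n (\<lambda>(i, k). f (Suc i, if k < j then k else Suc k))))"
proof -
  let ?A = "Matrix.mat (Suc n) (Suc n) f"
  have "Determinant.det ?A = (\<Sum>j<Suc n. ?A $$ (0, j) * cofactor ?A 0 j)"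
    by (rule laplace_expansion_row) auto
  also have "\<dots> = (\<Sum>j<Suc n. (-1) ^ j * f (0, j) * Determinant.det (Matrix.mat n n (\<lambda>(i, k). f (Suc i, if k < j then k else Suc k))))"
  proof (rule sum.cong[OF refl])
    fix j assume "j \<in> {..<Suc n}"
    then have j: "j < Suc n" by simp
    have "mat_delete ?A 0 j = Matrix.mat n n (\<lambda>(i, k). f (Suc i, if k < j then k else Suc k))"
      by (rule eq_matI) (auto simp: mat_delete_def)
    then show "?A $$ (0, j) * cofactor ?A 0 j = (-1) ^ j * f (0, j) * Determinant.det (Matrix.mat n n (\<lambda>(i, k). f (Suc i, if k < j then k else Suc k)))"
      using j by (simp add: cofactor_def)
  qed
  finally show ?thesis .
qed

lemma det_mat_2: "Determinant.det (Matrix.mat 2 2 f) = f (0,0) * f (1,1) - f (0,1) * f (1,0)"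
  for f :: "nat \<times> nat \<Rightarrow> real"
  by (simp add: numeral_2_eq_2 det_mat_Suc)

lemma det_mat_3: "Determinant.det (Matrix.mat 3 3 f) = f (0,0) * (f (1,1) * f (2,2) - f (1,2) * f (2,1))
    - f (0,1) * (f (1,0) * f (2,2) - f (1,2) * f (2,0)) + f (0,2) * (f (1,0) * f (2,1) - f (1,1) * f (2,0))"
  for f :: "nat \<times> nat \<Rightarrow> real"
proof -
  have "Determinant.det (Matrix.mat (Suc 2) (Suc 2) f) = f (0,0) * (f (1,1) * f (2,2) - f (1,2) * f (2,1))
    - f (0,1) * (f (1,0) * f (2,2) - f (1,2) * f (2,0)) + f (0,2) * (f (1,0) * f (2,1) - f (1,1) * f (2,0))"
    unfolding det_mat_Suc[of 2] det_mat_2 by (simp add: lessThan_Suc numeral_2_eq_2)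
  then show ?thesis by simp
qed

text \<open>A direct evaluation of the 5 by 5 Sylvester determinant. In degree three the sign in
  \<open>poly_disc\<close> is -1, which is why the resultant comes out negated.\<close>

lemma poly_disc_cubic:
  fixes s d :: real
  shows "poly_disc ([:-1, 1:] * [:d, - s, 1:]) = (s\<^sup>2 - 4 * d) * (1 - s + d)\<^sup>2"
proof -
  define a b c where "a = - d" and "b = d + s" and "c = - s - 1"
  define p q r where "p = b" and "q = 2 * c" and "r = (3 :: real)"
  have cubic: "[:-1, 1:] * [:d, - s, 1:] = [:a, b, c, 1:]" by (simp add: a_def b_def c_def)
  have pd: "pderiv [:a, b, c, 1:] = [:p, q, r:]" by (simp add: pderiv_pCons p_def q_def r_def)
  \<comment> \<open>Entries of the Sylvester matrix: two shifted rows of the cubic, then three of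
    its derivative.\<close>
  define g where "g = (\<lambda>(i :: nat, j :: nat). if i < 2 then (if i \<le> j \<and> j - i \<le> 3 then coeff [:a, b, c, 1:] (3 + i - j) else 0)
    else if i - 2 \<le> j \<and> j \<le> i then coeff [:p, q, r:] (i - j) else 0)"
  have deg: "degree [:a, b, c, 1:] = 3" "degree [:p, q, r:] = 2" by (simp_all add: r_def)
  have res: "resultant [:a, b, c, 1:] [:p, q, r:] = Determinant.det (Matrix.mat (Suc 4) (Suc 4) g)"
    unfolding resultant_def sylvester_mat_def sylvester_mat_sub_def deg g_def by simp
  have g0: "g (0, 0) = 1" "g (0, Suc 0) = c" "g (0, 2) = b" "g (0, 3) = a" "g (0, 4) = 0"
    by (simp_all add: g_def numeral_eq_Suc)
  have g1: "g (Suc 0, 0) = 0" "g (Suc 0, Suc 0) = 1" "g (Suc 0, 2) = c" "g (Suc 0, 3) = b" "g (Suc 0, 4) = a"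
    by (simp_all add: g_def numeral_eq_Suc)
  have g2: "g (2, 0) = r" "g (2, Suc 0) = q" "g (2, 2) = p" "g (2, 3) = 0" "g (2, 4) = 0"
    by (simp_all add: g_def numeral_eq_Suc)
  have g3: "g (3, 0) = 0" "g (3, Suc 0) = r" "g (3, 2) = q" "g (3, 3) = p" "g (3, 4) = 0"
    by (simp_all add: g_def numeral_eq_Suc)
  have g4: "g (4, 0) = 0" "g (4, Suc 0) = 0" "g (4, 2) = r" "g (4, 3) = q" "g (4, 4) = p"
    by (simp_all add: g_def numeral_eq_Suc)
  have d4: "Determinant.det (Matrix.mat 4 4 f) = f (0,0) * Determinant.det (Matrix.mat 3 3 (\<lambda>(i, k). f (Suc i, Suc k)))
    - f (0,1) * Determinant.det (Matrix.mat 3 3 (\<lambda>(i, k). f (Suc i, if k < 1 then k else Suc k)))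
    + f (0,2) * Determinant.det (Matrix.mat 3 3 (\<lambda>(i, k). f (Suc i, if k < 2 then k else Suc k)))
    - f (0,3) * Determinant.det (Matrix.mat 3 3 (\<lambda>(i, k). f (Suc i, if k < 3 then k else Suc k)))"
    for f :: "nat \<times> nat \<Rightarrow> real"
    using det_mat_Suc[of 3 f] by (simp add: lessThan_Suc eval_nat_numeral)
  have d5: "Determinant.det (Matrix.mat (Suc 4) (Suc 4) f) = f (0,0) * Determinant.det (Matrix.mat 4 4 (\<lambda>(i, k). f (Suc i, Suc k)))
    - f (0,1) * Determinant.det (Matrix.mat 4 4 (\<lambda>(i, k). f (Suc i, if k < 1 then k else Suc k)))
    + f (0,2) * Determinant.det (Matrix.mat 4 4 (\<lambda>(i, k). f (Suc i, if k < 2 then k else Suc k)))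
    - f (0,3) * Determinant.det (Matrix.mat 4 4 (\<lambda>(i, k). f (Suc i, if k < 3 then k else Suc k)))
    + f (0,4) * Determinant.det (Matrix.mat 4 4 (\<lambda>(i, k). f (Suc i, if k < 4 then k else Suc k)))"
    for f :: "nat \<times> nat \<Rightarrow> real"
    using det_mat_Suc[of 4 f] by (simp add: lessThan_Suc eval_nat_numeral)
  have e: "Suc (Suc 0) = 2" "Suc 2 = 3" "Suc 3 = 4" by simp_all
  have "resultant [:a, b, c, 1:] [:p, q, r:] = - ((s\<^sup>2 - 4 * d) * (1 - s + d)\<^sup>2)"
    unfolding res d5 d4 det_mat_3
    by (simp add: e g0 g1 g2 g3 g4)
      (simp add: a_def b_def c_def p_def q_def r_def power2_eq_square algebra_simps)
  then show ?thesis unfolding cubic poly_disc_def pd deg by simp (simp add: numeral_3_eq_3)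
qed

section \<open>Jacobi elliptic functions\<close>

locale jacobi_modulus =
  fixes k :: real
  assumes k_pos: "0 < k" and k_less_1: "k < 1"
begin

definition g :: "real \<Rightarrow> real" where "g \<theta> = 1 / sqrt (1 - k\<^sup>2 * (sin \<theta>)\<^sup>2)"

lemma radicand_pos: "1 - k\<^sup>2 * (sin \<theta>)\<^sup>2 > 0"
proof -
  have "k\<^sup>2 < 1" using k_pos k_less_1 by (simp add: power_less_one_iff)
  moreover have "(sin \<theta>)\<^sup>2 \<le> 1" by (simp add: abs_square_le_1)
  ultimately show ?thesis using mult_left_le[of "(sin \<theta>)\<^sup>2" "k\<^sup>2"] by simp
qed

lemma g_ge_1: "g \<theta> \<ge> 1"
proof -
  have "sqrt (1 - k\<^sup>2 * (sin \<theta>)\<^sup>2) \<le> 1" by simp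
  moreover have "sqrt (1 - k\<^sup>2 * (sin \<theta>)\<^sup>2) > 0" using radicand_pos by simp
  ultimately show ?thesis by (simp add: g_def)
qed

lemma g_continuous: "continuous_on A g"
  unfolding g_def[abs_def] using radicand_pos by (intro continuous_intros) (simp add: less_imp_neq[symmetric])

abbreviation F :: "real \<Rightarrow> real" where "F \<phi> \<equiv> elliptic_F \<phi> k"

lemma F_deriv: "(F has_real_derivative g \<phi>) (at \<phi>)"
proof -
  \<comment> \<open>The interval contains the base point 0 and has \<open>\<phi>\<close> in its
    interior, so the derivative within it is the full derivative.\<close>
  define R where "R = \<bar>\<phi>\<bar> + 1"
  have "((\<lambda>u. LBINT y=ereal 0..ereal u. g y) has_vector_derivative g \<phi>) (at \<phi> within {-R..R})"
    by (rule interval_integral_FTC2[OF _ _ g_continuous]) (auto simp: R_def)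
  moreover have "at \<phi> within {-R..R} = at \<phi>" by (rule at_within_interior) (auto simp: R_def interior_atLeastAtMost_real)
  ultimately show ?thesis
    unfolding elliptic_F_def g_def[symmetric] by (simp add: has_real_derivative_iff_has_vector_derivative)
qed

lemma F_zero: "F 0 = 0" by (simp add: elliptic_F_def)

text \<open>The integrand is at least 1. Expansion gives injectivity and surjectivity of
  \<open>F\<close> and makes the amplitude, its inverse, Lipschitz.\<close>

lemma F_expanding: "x \<le> y \<Longrightarrow> y - x \<le> F y - F x"
proof -
  assume "x \<le> y"
  have "F x - x \<le> F y - y"
  proof (rule DERIV_nonneg_imp_nondecreasing[OF \<open>x \<le> y\<close>])
    fix z
    have "((\<lambda>z. F z - z) has_real_derivative g z - 1) (at z)" by (intro derivative_intros F_deriv)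
    then show "\<exists>d. ((\<lambda>z. F z - z) has_real_derivative d) (at z) \<and> 0 \<le> d" using g_ge_1[of z] by (intro exI[of _ "g z - 1"]) simp
  qed
  then show ?thesis by simp
qed

lemma F_strict_mono: "x < y \<Longrightarrow> F x < F y"
  using F_expanding[of x y] by linarith

lemma F_inj: "F x = F y \<Longrightarrow> x = y"
  using F_strict_mono[of x y] F_strict_mono[of y x] by (cases x y rule: linorder_cases) auto

lemma F_surj: "\<exists>\<phi>. F \<phi> = u"
proof -
  define R where "R = \<bar>u\<bar>"
  have "F (-R) \<le> u" "u \<le> F R" using F_expanding[of "-R" 0] F_expanding[of 0 R] F_zero by (auto simp: R_def)
  moreover have "continuous_on {-R..R} F" using F_deriv by (intro continuous_at_imp_continuous_on ballI DERIV_isCont) blast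
  moreover have "-R \<le> R" by (simp add: R_def)
  ultimately show ?thesis using IVT'[of F "-R" u R] by blast
qed

abbreviation am :: "real \<Rightarrow> real" where "am u \<equiv> jacobi_am u k"

lemma F_am: "F (am u) = u"
proof -
  obtain \<phi> where "F \<phi> = u" using F_surj by blast
  moreover have "\<psi> = \<phi>" if "F \<psi> = u" for \<psi> by (rule F_inj) (simp add: that \<open>F \<phi> = u\<close>)
  ultimately show ?thesis unfolding jacobi_am_def by (rule theI)
qed

lemma am_eqI: "F \<phi> = u \<Longrightarrow> am u = \<phi>"
  by (rule F_inj) (simp add: F_am)

lemma am_strict_mono: "u < v \<Longrightarrow> am u < am v"
proof (rule ccontr)
  assume "u < v" "\<not> am u < am v"
  then have "F (am v) \<le> F (am u)" using F_strict_mono[of "am v" "am u"] by (cases "am v = am u") auto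
  then show False using \<open>u < v\<close> by (simp add: F_am)
qed

lemma am_lipschitz: "\<bar>am u - am v\<bar> \<le> \<bar>u - v\<bar>"
  using F_expanding[of "am u" "am v"] F_expanding[of "am v" "am u"] by (cases "am u \<le> am v") (auto simp: F_am)

lemma am_isCont: "isCont am u"
  unfolding continuous_at_eps_delta by (auto simp: dist_real_def intro!: exI le_less_trans[OF am_lipschitz])

definition dn :: "real \<Rightarrow> real" where "dn u = sqrt (1 - k\<^sup>2 * (sin (am u))\<^sup>2)"
definition sn :: "real \<Rightarrow> real" where "sn u = sin (am u)"
definition cn :: "real \<Rightarrow> real" where "cn u = cos (am u)"

lemma am_deriv: "(am has_real_derivative dn u) (at u)"
proof -
  have "(am has_real_derivative inverse (g (am u))) (at u)"
  proof (rule DERIV_inverse_function[where f = F and a = "u - 1" and b = "u + 1"])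
    show "(F has_real_derivative g (am u)) (at (am u))" by (rule F_deriv)
    show "g (am u) \<noteq> 0" using g_ge_1[of "am u"] by simp
    show "isCont am u" by (rule am_isCont)
  qed (simp_all add: F_am)
  then show ?thesis by (simp add: g_def dn_def)
qed

lemma dn_pos: "dn u > 0" using radicand_pos by (simp add: dn_def)

lemma dn_sq: "(dn u)\<^sup>2 = 1 - k\<^sup>2 * (sn u)\<^sup>2" using radicand_pos[of "am u"] by (simp add: dn_def sn_def)

lemma cn_sq: "(cn u)\<^sup>2 = 1 - (sn u)\<^sup>2" by (simp add: cn_def sn_def cos_squared_eq)

lemma sn_deriv: "(sn has_real_derivative cn u * dn u) (at u)"
  unfolding sn_def[abs_def] cn_def by (rule DERIV_chain2[OF DERIV_sin am_deriv])

lemma cn_deriv: "(cn has_real_derivative - sn u * dn u) (at u)"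
  unfolding cn_def[abs_def] sn_def by (rule DERIV_chain2[OF DERIV_cos am_deriv])

lemma dn_deriv: "(dn has_real_derivative - k\<^sup>2 * sn u * cn u) (at u)"
proof -
  have dn_sn: "dn = (\<lambda>u. sqrt (1 - k\<^sup>2 * (sn u)\<^sup>2))" by (simp add: dn_def sn_def fun_eq_iff)
  have dn_u: "dn u = sqrt (1 - k\<^sup>2 * (sn u)\<^sup>2)" by (simp add: dn_def sn_def)
  have "((\<lambda>u. 1 - k\<^sup>2 * (sn u)\<^sup>2) has_real_derivative - 2 * k\<^sup>2 * sn u * (cn u * dn u)) (at u)"
    by (auto intro!: derivative_eq_intros sn_deriv)
  moreover have "1 - k\<^sup>2 * (sn u)\<^sup>2 > 0" using radicand_pos[of "am u"] by (simp add: sn_def)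
  ultimately have d: "((\<lambda>u. sqrt (1 - k\<^sup>2 * (sn u)\<^sup>2)) has_real_derivative
      inverse (sqrt (1 - k\<^sup>2 * (sn u)\<^sup>2)) / 2 * (- 2 * k\<^sup>2 * sn u * (cn u * dn u))) (at u)"
    by (intro DERIV_chain2[OF DERIV_real_sqrt])
  have "(dn has_real_derivative inverse (dn u) / 2 * (- 2 * k\<^sup>2 * sn u * (cn u * dn u))) (at u)"
    by (subst dn_sn) (use d in \<open>simp only: dn_u\<close>)
  moreover have "inverse (dn u) / 2 * (- 2 * k\<^sup>2 * sn u * (cn u * dn u)) = - k\<^sup>2 * sn u * cn u"
    using dn_pos[of u] by (simp add: field_simps)
  ultimately show ?thesis by (simp only:)
qed

lemma shift_derivs:
  "((\<lambda>m. sn (m + \<delta>)) has_real_derivative cn (m + \<delta>) * dn (m + \<delta>)) (at m)"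
  "((\<lambda>m. cn (m + \<delta>)) has_real_derivative - sn (m + \<delta>) * dn (m + \<delta>)) (at m)"
  "((\<lambda>m. dn (m + \<delta>)) has_real_derivative - k\<^sup>2 * sn (m + \<delta>) * cn (m + \<delta>)) (at m)"
  using sn_deriv[of "m + \<delta>"] cn_deriv[of "m + \<delta>"] dn_deriv[of "m + \<delta>"] by (simp_all add: DERIV_shift)

text \<open>Common denominator of the addition formulas.\<close>

definition D :: "real \<Rightarrow> real \<Rightarrow> real" where "D u v = 1 - k\<^sup>2 * (sn u)\<^sup>2 * (sn v)\<^sup>2"

lemma D_pos: "D u v > 0"
proof -
  have "(sn v)\<^sup>2 \<le> 1" by (simp add: sn_def abs_square_le_1)
  then have "(k\<^sup>2 * (sn u)\<^sup>2) * (sn v)\<^sup>2 \<le> k\<^sup>2 * (sn u)\<^sup>2" by (intro mult_left_le) auto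
  moreover have "k\<^sup>2 * (sn u)\<^sup>2 < 1" using radicand_pos[of "am u"] by (simp add: sn_def)
  ultimately show ?thesis by (simp add: D_def)
qed

lemma am_zero: "am 0 = 0" by (rule am_eqI[OF F_zero])

lemma sn_0: "sn 0 = 0" and cn_0: "cn 0 = 1" and dn_0: "dn 0 = 1"
  by (simp_all add: sn_def cn_def dn_def am_zero)

lemma quotient_const:
  assumes "\<And>m. (N has_real_derivative N' m) (at m)" "\<And>m. (E has_real_derivative E' m) (at m)" "\<And>m. E m \<noteq> (0 :: real)"
    "\<And>m. N' m * E m = N m * E' m"
  shows "N m / E m = N 0 / E 0"
proof -
  have "((\<lambda>m. N m / E m) has_real_derivative 0) (at m)" for m
    using DERIV_divide[OF assms(1,2,3), of m] assms(4)[of m] by (simp add: mult.commute)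
  then show ?thesis by (intro DERIV_isconst_all) blast
qed

lemma D_deriv: "((\<lambda>m. D (m + \<delta>) m) has_real_derivative
   - 2 * k\<^sup>2 * sn (m + \<delta>) * sn m * (cn (m + \<delta>) * dn (m + \<delta>) * sn m + sn (m + \<delta>) * cn m * dn m)) (at m)"
  unfolding D_def
  by (auto intro!: derivative_eq_intros sn_deriv shift_derivs(1) simp: power2_eq_square algebra_simps)

text \<open>The addition theorems: both left-hand sides, divided by D, have derivative 0 in m.\<close>

lemma cn_diff: "cn (m + \<delta>) * cn m + sn (m + \<delta>) * sn m * dn (m + \<delta>) * dn m = cn \<delta> * D (m + \<delta>) m"
proof -
  define N where "N m = cn (m + \<delta>) * cn m + sn (m + \<delta>) * sn m * dn (m + \<delta>) * dn m" for m
  have N: "(N has_real_derivative - 2 * k\<^sup>2 * sn (m + \<delta>) * sn m * (sn (m + \<delta>) * cn (m + \<delta>) * dn m + sn m * cn m * dn (m + \<delta>))) (at m)" for m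
  proof -
    define s c d s' c' d' where "s = sn (m + \<delta>)" "c = cn (m + \<delta>)" "d = dn (m + \<delta>)" "s' = sn m" "c' = cn m" "d' = dn m"
    note defs = this
    have "(N has_real_derivative (- s * d * c' + c * (- s' * d') + ((c * d * s' + s * (c' * d')) * d * d' + s * s' * (- k\<^sup>2 * s * c) * d' + s * s' * d * (- k\<^sup>2 * s' * c')))) (at m)"
      unfolding N_def[abs_def] defs
      by (auto intro!: derivative_eq_intros sn_deriv cn_deriv dn_deriv shift_derivs simp: algebra_simps)
    moreover have "(- s * d * c' + c * (- s' * d') + ((c * d * s' + s * (c' * d')) * d * d' + s * s' * (- k\<^sup>2 * s * c) * d' + s * s' * d * (- k\<^sup>2 * s' * c')))
      = c * s' * d' * (d\<^sup>2 - 1 - k\<^sup>2 * s\<^sup>2) + s * c' * d * (d'\<^sup>2 - 1 - k\<^sup>2 * s'\<^sup>2)"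
      by (simp add: power2_eq_square algebra_simps)
    moreover have "\<dots> = - 2 * k\<^sup>2 * s * s' * (s * c * d' + s' * c' * d)"
    proof -
      have "d\<^sup>2 = 1 - k\<^sup>2 * s\<^sup>2" "d'\<^sup>2 = 1 - k\<^sup>2 * s'\<^sup>2" by (simp_all add: defs dn_sq)
      then show ?thesis by (simp only:) (simp add: power2_eq_square algebra_simps)
    qed
    ultimately show ?thesis by (simp add: defs)
  qed
  have "N m / D (m + \<delta>) m = N 0 / D (0 + \<delta>) 0"
  proof (rule quotient_const[OF N D_deriv])
    show "D (m + \<delta>) m \<noteq> 0" for m using D_pos[of "m + \<delta>" m] by simp
    fix m
    define s c d s' c' d' where "s = sn (m + \<delta>)" "c = cn (m + \<delta>)" "d = dn (m + \<delta>)" "s' = sn m" "c' = cn m" "d' = dn m"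
    note defs = this
    have "(c * c' + s * s' * d * d') * (c * d * s' + s * c' * d') = s * c * d' * (c'\<^sup>2 + s'\<^sup>2 * d\<^sup>2) + s' * c' * d * (c\<^sup>2 + s\<^sup>2 * d'\<^sup>2)"
      by (simp add: power2_eq_square algebra_simps)
    \<comment> \<open>Both brackets reduce to the denominator by the quadratic relations between sn,
      cn and dn; this makes the derivative of the quotient vanish.\<close>
    also have "c'\<^sup>2 + s'\<^sup>2 * d\<^sup>2 = D (m + \<delta>) m" by (simp add: defs dn_sq cn_sq D_def algebra_simps)
    also have "c\<^sup>2 + s\<^sup>2 * d'\<^sup>2 = D (m + \<delta>) m" by (simp add: defs dn_sq cn_sq D_def algebra_simps)
    finally have e: "(c * c' + s * s' * d * d') * (c * d * s' + s * c' * d') = (s * c * d' + s' * c' * d) * D (m + \<delta>) m"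
      by (simp add: algebra_simps)
    have "- 2 * k\<^sup>2 * s * s' * (s * c * d' + s' * c' * d) * D (m + \<delta>) m = - 2 * k\<^sup>2 * s * s' * ((c * c' + s * s' * d * d') * (c * d * s' + s * c' * d'))"
      unfolding e by simp
    also have "\<dots> = N m * (- 2 * k\<^sup>2 * s * s' * (c * d * s' + s * c' * d'))" by (simp add: N_def defs)
    finally show "- 2 * k\<^sup>2 * sn (m + \<delta>) * sn m * (sn (m + \<delta>) * cn (m + \<delta>) * dn m + sn m * cn m * dn (m + \<delta>)) * D (m + \<delta>) m
       = N m * (- 2 * k\<^sup>2 * sn (m + \<delta>) * sn m * (cn (m + \<delta>) * dn (m + \<delta>) * sn m + sn (m + \<delta>) * cn m * dn m))"
      unfolding defs .
  qed
  then have "N m / D (m + \<delta>) m = cn \<delta>" by (simp add: N_def D_def sn_0 cn_0 dn_0)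
  then have "N m = cn \<delta> * D (m + \<delta>) m" using D_pos[of "m + \<delta>" m] by (simp add: divide_eq_eq)
  then show ?thesis unfolding N_def .
qed

lemma dn_diff: "dn (m + \<delta>) * dn m + k\<^sup>2 * sn (m + \<delta>) * sn m * cn (m + \<delta>) * cn m = dn \<delta> * D (m + \<delta>) m"
proof -
  define N where "N m = dn (m + \<delta>) * dn m + k\<^sup>2 * sn (m + \<delta>) * sn m * cn (m + \<delta>) * cn m" for m
  have N: "(N has_real_derivative - 2 * k\<^sup>2 * sn (m + \<delta>) * sn m * (sn m * cn (m + \<delta>) * dn m + sn (m + \<delta>) * cn m * dn (m + \<delta>))) (at m)" for m
  proof -
    define s c d s' c' d' where "s = sn (m + \<delta>)" "c = cn (m + \<delta>)" "d = dn (m + \<delta>)" "s' = sn m" "c' = cn m" "d' = dn m"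
    note defs = this
    have "(N has_real_derivative (- k\<^sup>2 * s * c * d' + d * (- k\<^sup>2 * s' * c') + k\<^sup>2 * ((c * d * s' + s * (c' * d')) * c * c' + s * s' * (- s * d) * c' + s * s' * c * (- s' * d')))) (at m)"
      unfolding N_def[abs_def] defs
      by (auto intro!: derivative_eq_intros sn_deriv cn_deriv dn_deriv shift_derivs simp: algebra_simps)
    moreover have "(- k\<^sup>2 * s * c * d' + d * (- k\<^sup>2 * s' * c') + k\<^sup>2 * ((c * d * s' + s * (c' * d')) * c * c' + s * s' * (- s * d) * c' + s * s' * c * (- s' * d')))
      = k\<^sup>2 * s * c * d' * (c'\<^sup>2 - s'\<^sup>2 - 1) + k\<^sup>2 * d * s' * c' * (c\<^sup>2 - s\<^sup>2 - 1)"
      by (simp add: power2_eq_square algebra_simps)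
    moreover have "\<dots> = - 2 * k\<^sup>2 * s * s' * (s' * c * d' + s * c' * d)"
    proof -
      have "c\<^sup>2 = 1 - s\<^sup>2" "c'\<^sup>2 = 1 - s'\<^sup>2" by (simp_all add: defs cn_sq)
      then show ?thesis by (simp only:) (simp add: power2_eq_square algebra_simps)
    qed
    ultimately show ?thesis by (simp add: defs)
  qed
  have "N m / D (m + \<delta>) m = N 0 / D (0 + \<delta>) 0"
  proof (rule quotient_const[OF N D_deriv])
    show "D (m + \<delta>) m \<noteq> 0" for m using D_pos[of "m + \<delta>" m] by simp
    fix m
    define s c d s' c' d' where "s = sn (m + \<delta>)" "c = cn (m + \<delta>)" "d = dn (m + \<delta>)" "s' = sn m" "c' = cn m" "d' = dn m"
    note defs = this
    have "(d * d' + k\<^sup>2 * s * s' * c * c') * (c * d * s' + s * c' * d') = c * s' * d' * (d\<^sup>2 + k\<^sup>2 * s\<^sup>2 * c'\<^sup>2) + s * c' * d * (d'\<^sup>2 + k\<^sup>2 * s'\<^sup>2 * c\<^sup>2)"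
      by (simp add: power2_eq_square algebra_simps)
    also have "d\<^sup>2 + k\<^sup>2 * s\<^sup>2 * c'\<^sup>2 = D (m + \<delta>) m" by (simp add: defs dn_sq cn_sq D_def algebra_simps)
    also have "d'\<^sup>2 + k\<^sup>2 * s'\<^sup>2 * c\<^sup>2 = D (m + \<delta>) m" by (simp add: defs dn_sq cn_sq D_def algebra_simps)
    finally have e: "(d * d' + k\<^sup>2 * s * s' * c * c') * (c * d * s' + s * c' * d') = (s' * c * d' + s * c' * d) * D (m + \<delta>) m"
      by (simp add: algebra_simps)
    have "- 2 * k\<^sup>2 * s * s' * (s' * c * d' + s * c' * d) * D (m + \<delta>) m = - 2 * k\<^sup>2 * s * s' * ((d * d' + k\<^sup>2 * s * s' * c * c') * (c * d * s' + s * c' * d'))"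
      unfolding e by simp
    also have "\<dots> = N m * (- 2 * k\<^sup>2 * s * s' * (c * d * s' + s * c' * d'))" by (simp add: N_def defs)
    finally show "- 2 * k\<^sup>2 * sn (m + \<delta>) * sn m * (sn m * cn (m + \<delta>) * dn m + sn (m + \<delta>) * cn m * dn (m + \<delta>)) * D (m + \<delta>) m
       = N m * (- 2 * k\<^sup>2 * sn (m + \<delta>) * sn m * (cn (m + \<delta>) * dn (m + \<delta>) * sn m + sn (m + \<delta>) * cn m * dn m))"
      unfolding defs .
  qed
  then have "N m / D (m + \<delta>) m = dn \<delta>" by (simp add: N_def D_def sn_0 cn_0 dn_0)
  then have "N m = dn \<delta> * D (m + \<delta>) m" using D_pos[of "m + \<delta>" m] by (simp add: divide_eq_eq)
  then show ?thesis unfolding N_def .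
qed

text \<open>After multiplication by the denominator, \<open>dn_diff\<close> replaces the dn factor.
  The terms with \<open>k^2\<close> cancel, and the numerator of \<open>cn_diff\<close>
  remains.\<close>

lemma chord_identity: "sn m * sn (m + \<delta>) * dn \<delta> + cn m * cn (m + \<delta>) = cn \<delta>"
proof -
  define s c d s' c' d' where "s = sn (m + \<delta>)" "c = cn (m + \<delta>)" "d = dn (m + \<delta>)" "s' = sn m" "c' = cn m" "d' = dn m"
  note defs = this
  have "(s' * s * dn \<delta> + c' * c) * D (m + \<delta>) m = s' * s * (dn \<delta> * D (m + \<delta>) m) + c' * c * D (m + \<delta>) m" by (simp add: algebra_simps)
  also have "dn \<delta> * D (m + \<delta>) m = d * d' + k\<^sup>2 * s * s' * c * c'" using dn_diff[of m \<delta>] by (simp add: defs)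
  also have "s' * s * (d * d' + k\<^sup>2 * s * s' * c * c') + c' * c * D (m + \<delta>) m = c * c' + s * s' * d * d'"
    by (simp add: D_def defs power2_eq_square algebra_simps)
  also have "\<dots> = cn \<delta> * D (m + \<delta>) m" using cn_diff[of m \<delta>] by (simp add: defs)
  finally have "(s' * s * dn \<delta> + c' * c) * D (m + \<delta>) m = cn \<delta> * D (m + \<delta>) m" .
  moreover have "D (m + \<delta>) m \<noteq> 0" using D_pos[of "m + \<delta>" m] by simp
  ultimately show ?thesis by (simp add: defs)
qed

abbreviation K :: real where "K \<equiv> elliptic_K k"

lemma am_K: "am K = pi / 2" by (rule am_eqI) (simp add: elliptic_K_def)

lemma K_pos: "K > 0" using F_strict_mono[of 0 "pi/2"] by (simp add: elliptic_K_def F_zero)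

lemma F_odd: "F (- \<phi>) = - F \<phi>"
proof -
  have d: "((\<lambda>x. F (- x) + F x) has_real_derivative 0) (at x)" for x
    by (rule derivative_eq_intros F_deriv DERIV_chain2[OF F_deriv] refl)+ (simp add: g_def)
  have "F (- \<phi>) + F \<phi> = F (- 0) + F 0" by (rule DERIV_isconst_all) (use d in blast)
  then show ?thesis by (simp add: F_zero)
qed

lemma F_reflect: "F (pi - \<phi>) + F \<phi> = F pi"
proof -
  have d: "((\<lambda>x. F (pi - x) + F x) has_real_derivative 0) (at x)" for x
    by (rule derivative_eq_intros F_deriv DERIV_chain2[OF F_deriv] refl)+ (simp add: g_def)
  have "F (pi - \<phi>) + F \<phi> = F (pi - 0) + F 0" by (rule DERIV_isconst_all) (use d in blast)
  then show ?thesis by (simp add: F_zero)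
qed

lemma F_pi: "F pi = 2 * K" using F_reflect[of "pi / 2"] by (simp add: elliptic_K_def)

lemma F_shift: "F (\<phi> + pi) = F \<phi> + 2 * K"
  using F_reflect[of "- \<phi>"] by (simp add: F_odd F_pi add.commute)

lemma am_shift: "am (u + 2 * K) = am u + pi"
  by (rule am_eqI) (simp add: F_shift F_am)

lemma am_minus: "am (- u) = - am u"
  by (rule am_eqI) (simp add: F_odd F_am)

lemma sn_minus: "sn (- u) = - sn u" and cn_minus: "cn (- u) = cn u" and dn_minus: "dn (- u) = dn u"
  by (simp_all add: sn_def cn_def dn_def am_minus)

lemma sn_cn_period: "sn (u + 4 * K) = sn u" "cn (u + 4 * K) = cn u"
proof -
  have "am (u + 4 * K) = am (u + 2 * K + 2 * K)" by (simp add: algebra_simps)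
  also have "\<dots> = am u + 2 * pi" by (simp only: am_shift)
  finally show "sn (u + 4 * K) = sn u" "cn (u + 4 * K) = cn u" by (simp_all add: sn_def cn_def)
qed

lemma cn_pos: "\<bar>u\<bar> < K \<Longrightarrow> cn u > 0"
  using am_strict_mono[of u K] am_strict_mono[of "-K" u] unfolding cn_def am_minus am_K
  by (intro cos_gt_zero_pi) auto

lemma sn_pos: "0 < u \<Longrightarrow> u < K \<Longrightarrow> sn u > 0"
  using am_strict_mono[of 0 u] am_strict_mono[of u K] unfolding sn_def am_zero am_K
  by (intro sin_gt_zero) auto

lemma cn_double: "cn (2 * u) * D u u = (cn u)\<^sup>2 - (sn u)\<^sup>2 * (dn u)\<^sup>2"
  using cn_diff[of "-u" "2 * u"] by (simp add: sn_minus cn_minus dn_minus D_def power2_eq_square algebra_simps)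

text \<open>The amplitude grows by an amount strictly between 0 and \<open>pi\<close>.\<close>

lemma sn_cn_neq:
  assumes "0 < h" "h < 2 * K" shows "sn u \<noteq> sn (u + h) \<or> cn u \<noteq> cn (u + h)"
proof (rule ccontr)
  assume "\<not> ?thesis"
  then have e: "sin (am u) = sin (am (u + h))" "cos (am u) = cos (am (u + h))" by (simp_all add: sn_def cn_def)
  have "sin (am (u + h) - am u) = 0" unfolding sin_diff e by simp
  moreover have "am u < am (u + h)" "am (u + h) < am u + pi"
    using am_strict_mono[of u "u + h"] am_strict_mono[of "u + h" "u + 2 * K"] assms by (simp_all add: am_shift)
  then have "sin (am (u + h) - am u) > 0" by (intro sin_gt_zero) auto
  ultimately show False by simp
qed

text \<open>The chain samples the curve at half steps \<open>\<delta>\<close>; dividing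
  \<open>chord_identity\<close> by cn of \<open>\<delta>\<close> gives the two coefficients. For
  \<open>n\<close> at least 5 a full step is shorter than a quarter period.\<close>

lemma jacobi_normal_form:
  assumes "n \<ge> 5"
  shows "\<exists>r \<alpha> \<beta>. poncelet_normal_form n (Finite_Cartesian_Product.mat 1) r \<alpha> \<beta> (jacobi_polygon n k u0)"
proof -
  define \<delta> where "\<delta> = 2 * K / real n"
  define r :: "int \<Rightarrow> real^2" where "r j = vector [sn (u0 + of_int j * \<delta>), cn (u0 + of_int j * \<delta>)]" for j
  have n_delta: "2 * real n * \<delta> = 4 * K" using assms by (simp add: \<delta>_def)
  have "4 * K / real n < K" using K_pos assms by (simp add: divide_less_eq)
  then have \<delta>: "0 < \<delta>" "2 * \<delta> < K" using K_pos assms by (simp_all add: \<delta>_def)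
  have cn: "cn \<delta> > 0" and sn: "sn \<delta> > 0" using \<delta> by (simp_all add: cn_pos sn_pos)
  have k2: "0 < k\<^sup>2" "k\<^sup>2 < 1" using k_pos k_less_1 by (simp_all add: power_less_one_iff)
  have cn_dn: "cn \<delta> < dn \<delta>"
  proof (rule power_less_imp_less_base)
    have "k\<^sup>2 * (sn \<delta>)\<^sup>2 < 1 * (sn \<delta>)\<^sup>2" using k2 sn by (intro mult_strict_right_mono) auto
    then show "(cn \<delta>)\<^sup>2 < (dn \<delta>)\<^sup>2" by (simp add: cn_sq dn_sq)
  qed (use dn_pos[of \<delta>] in simp)
  have dn_1: "dn \<delta> < 1"
  proof (rule power_less_imp_less_base)
    show "(dn \<delta>)\<^sup>2 < 1\<^sup>2" using k2 sn by (simp add: dn_sq)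
  qed simp
  have "poncelet_normal_form n (Finite_Cartesian_Product.mat 1) r (dn \<delta> / cn \<delta>) (1 / cn \<delta>) (jacobi_polygon n k u0)"
  proof
    show "n \<ge> 5" by fact
    show "invertible (Finite_Cartesian_Product.mat 1 :: real^3^3)" by (simp add: invertible_det_nz)
    fix j :: int
    have s: "u0 + of_int (j + 1) * \<delta> = u0 + of_int j * \<delta> + \<delta>" "u0 + of_int (j + 2) * \<delta> = u0 + of_int j * \<delta> + 2 * \<delta>"
      by (simp_all add: algebra_simps)
    have "u0 + of_int (j + 2 * int n) * \<delta> = u0 + of_int j * \<delta> + 2 * real n * \<delta>" by (simp add: algebra_simps)
    then have "u0 + of_int (j + 2 * int n) * \<delta> = u0 + of_int j * \<delta> + 4 * K" by (simp only: n_delta)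
    then show "r (j + 2 * int n) = r j" by (simp only: r_def sn_cn_period)
    show "(r j $ 1)\<^sup>2 + (r j $ 2)\<^sup>2 = 1" by (simp add: r_def cn_sq)
    have "(sn (u0 + of_int j * \<delta>) * sn (u0 + of_int j * \<delta> + \<delta>) * dn \<delta> + cn (u0 + of_int j * \<delta>) * cn (u0 + of_int j * \<delta> + \<delta>)) / cn \<delta> = 1"
      using cn by (simp add: chord_identity)
    then show "dn \<delta> / cn \<delta> * r j $ 1 * r (j + 1) $ 1 + 1 / cn \<delta> * r j $ 2 * r (j + 1) $ 2 = 1"
      unfolding r_def s by (simp add: add_divide_distrib mult_ac)
    show "r j \<noteq> r (j + 2)"
      using sn_cn_neq[of "2 * \<delta>" "u0 + of_int j * \<delta>"] \<delta> K_pos unfolding r_def s by (simp add: vec2_eq_iff)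
  next
    show "1 < dn \<delta> / cn \<delta>" "dn \<delta> / cn \<delta> < 1 / cn \<delta>"
      using cn cn_dn dn_1 by (simp_all add: divide_strict_right_mono)
    \<comment> \<open>By the duplication formula the condition \<open>small_step\<close> is the
      positivity of cn at a full step.\<close>
    have "0 < cn (2 * \<delta>) * D \<delta> \<delta>" using \<delta> D_pos by (simp add: cn_pos)
    also have "\<dots> = (cn \<delta>)\<^sup>2 * (1 + (dn \<delta>)\<^sup>2) - (dn \<delta>)\<^sup>2"
    proof -
      have "(sn \<delta>)\<^sup>2 = 1 - (cn \<delta>)\<^sup>2" by (simp add: cn_sq)
      then show ?thesis unfolding cn_double by (simp only:) (simp add: algebra_simps)
    qed
    finally have "(dn \<delta>)\<^sup>2 / ((cn \<delta>)\<^sup>2 * (cn \<delta>)\<^sup>2) < (cn \<delta>)\<^sup>2 * (1 + (dn \<delta>)\<^sup>2) / ((cn \<delta>)\<^sup>2 * (cn \<delta>)\<^sup>2)"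
      using cn by (intro divide_strict_right_mono) auto
    also have "\<dots> = (1 + (dn \<delta>)\<^sup>2) / (cn \<delta>)\<^sup>2" using cn by (intro mult_divide_mult_cancel_left) simp
    finally show "(dn \<delta> / cn \<delta>)\<^sup>2 * (1 / cn \<delta>)\<^sup>2 < (dn \<delta> / cn \<delta>)\<^sup>2 + (1 / cn \<delta>)\<^sup>2"
      by (simp add: power_divide add_divide_distrib)
  next
    fix i :: int
    have h: "of_int (2 * i) * \<delta> = of_int i * (4 * K / real n)" by (simp add: \<delta>_def)
    have "r (2 * i) = jacobi_polygon n k u0 i"
      unfolding r_def h by (simp add: jacobi_polygon_def Let_def sn_def cn_def jacobi_sn_def jacobi_cn_def)
    then show "\<exists>c>0. Finite_Cartesian_Product.mat 1 *v hom_coords (r (2 * i)) = c *\<^sub>R hom_coords (jacobi_polygon n k u0 i)"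
      by (intro exI[of _ 1]) simp
  qed
  then show ?thesis by blast
qed

end

section \<open>Uniqueness of the normalization and the main statement\<close>

lemma eigenvec_rescale:
  assumes "c \<noteq> 0" "eigenvec (c *\<^sub>R G) t x"
  shows "eigenvec (c' *\<^sub>R G) (c' / c * t) x"
proof -
  have "c *\<^sub>R (G *v x) = t *\<^sub>R x" using assms(2) by (simp add: eigenvec_def scaleR_matrix_vector_assoc)
  then have "(c' / c) *\<^sub>R (c *\<^sub>R (G *v x)) = (c' / c) *\<^sub>R (t *\<^sub>R x)" by (simp only:)
  then have "c' *\<^sub>R (G *v x) = (c' / c * t) *\<^sub>R x" using assms(1) by simp
  then show ?thesis using assms(2) by (simp add: eigenvec_def scaleR_matrix_vector_assoc)
qed

text \<open>In both normalizations 1 is the largest eigenvalue and all are positive, so the quotient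
  of the two factors and its inverse are both at most 1. This allows passing between two normal
  forms of the same polygon.\<close>

lemma normalized_spectrum_unique:
  assumes c: "c \<noteq> 0" "c' \<noteq> 0" and ab: "0 < b" "b < a" "a < 1" and ab': "0 < b'" "b' < a'" "a' < 1"
    and S: "{t. \<exists>x. eigenvec (c *\<^sub>R G) t x} = {1, a, b}" and S': "{t. \<exists>x. eigenvec (c' *\<^sub>R G) t x} = {1, a', b'}"
  shows "c' = c" and "a' = a"
proof -
  have "1 \<in> {t. \<exists>x. eigenvec (c *\<^sub>R G) t x}" "1 \<in> {t. \<exists>x. eigenvec (c' *\<^sub>R G) t x}" unfolding S S' by simp_all
  then have "c' / c * 1 \<in> {t. \<exists>x. eigenvec (c' *\<^sub>R G) t x}" "c / c' * 1 \<in> {t. \<exists>x. eigenvec (c *\<^sub>R G) t x}"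
    using eigenvec_rescale[OF c(1)] eigenvec_rescale[OF c(2)] by blast+
  then have "0 < c' / c" "c' / c \<le> 1" "c / c' \<le> 1" unfolding S S' using ab ab' by auto
  then show cc: "c' = c" using c by (simp add: divide_le_eq zero_less_divide_iff split: if_splits)
  have "{1, a, b} = {1, a', b'}" using S S' unfolding cc by simp
  then have "a \<in> {1, a', b'}" "a' \<in> {1, a, b}" by blast+
  then show "a' = a" using ab ab' by auto
qed


theorem corollary5p14:
  fixes n :: nat and P :: polygon and G :: "real^3^3"
  assumes "n \<ge> 5"
    and "strictly_convex_ngon n P"
    and "poncelet_polygon n P"
    and "\<not> projectively_regular n P"
    and "darboux_schwartz G P"
  shows "\<exists>c a b s d :: real. c \<noteq> 0 \<and> 1 > a \<and> a > b \<and> b > 0 \<and> s = a + b \<and> d = a * b \<and>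
    {t. \<exists>x. eigenvec (c *\<^sub>R G) t x} = {1, a, b} \<and>
    char_polynomial (c *\<^sub>R G) = [:-1, 1:] * [:d, - s, 1:] \<and>
    poly_disc (char_polynomial (c *\<^sub>R G)) = (s\<^sup>2 - 4 * d) * (1 - s + d)\<^sup>2 \<and>
    d > 0 \<and> s\<^sup>2 > 4 * d \<and> 1 - s + d > 0 \<and>
    (\<forall>X1 X2. eigenvec (c *\<^sub>R G) 1 X1 \<and> eigenvec (c *\<^sub>R G) a X2 \<longrightarrow>
      (\<exists>u. affine_direction X1 X2 u) \<and>
      (\<forall>u. affine_direction X1 X2 u \<longrightarrow>
        (\<lambda>k. Max ((\<lambda>i. infdist ((normalized_pentagram n ^^ k) P i) (affine_line (centroid n P) u)) ` {0..<int n}))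
          \<longlonglongrightarrow> 0 \<and>
        filterlim (\<lambda>k. diameter (range ((normalized_pentagram n ^^ k) P))) at_top sequentially \<and>
        (\<forall>r\<in>{0, 1}.
          (\<exists>v \<alpha> \<beta> a' b'. nondeg_two_scale_under n G ((pentagram ^^ r) P) u v \<alpha> \<beta> a' b') \<and>
          (\<forall>v \<alpha> \<beta> a' b' X Y (\<phi> :: nat \<Rightarrow> nat) \<sigma>.
            nondeg_two_scale_under n G ((pentagram ^^ r) P) u v \<alpha> \<beta> a' b' \<and>
            (\<forall>j i. compensated n P r j i - centroid n P = X j i *\<^sub>R u + Y j i *\<^sub>R v) \<and>
            strict_mono \<phi> \<and> \<sigma> \<in> {-1, 1} \<and> (\<forall>m. sgn (\<alpha> (\<phi> m) * \<beta> (\<phi> m)) = \<sigma>) \<longrightarrow>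
            (\<forall>i. (\<lambda>m. X (\<phi> m) i * Y (\<phi> m) i)
                   \<longlonglongrightarrow> \<sigma> * (area n P / \<bar>limit_area n u v a' b'\<bar>) * a' i * b' i \<and>
                 (a' i * b' i \<noteq> 0 \<longrightarrow>
                   asymptotic_to (\<lambda>m. compensated n P r (\<phi> m) i)
                     (hyperbola (centroid n P) u v
                       (\<sigma> * (area n P / \<bar>limit_area n u v a' b'\<bar>) * a' i * b' i))))))) \<and>
      (\<forall>\<epsilon> u0 u v. 0 < \<epsilon> \<and> \<epsilon> < 1 \<and> P = jacobi_polygon n \<epsilon> u0 \<and> u = vector [1, 0] \<and> v = vector [0, 1] \<longrightarrow>
        affine_direction X1 X2 u \<and>
        (\<forall>r\<in>{0, 1}.
          (\<exists>\<alpha> \<beta> a' b'. nondeg_two_scale_under n G ((pentagram ^^ r) P) u v \<alpha> \<beta> a' b') \<and>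
          (\<forall>\<alpha> \<beta> a' b' (\<phi> :: nat \<Rightarrow> nat) \<sigma>.
            nondeg_two_scale_under n G ((pentagram ^^ r) P) u v \<alpha> \<beta> a' b' \<and>
            strict_mono \<phi> \<and> \<sigma> \<in> {-1, 1} \<and> (\<forall>m. sgn (\<alpha> (\<phi> m) * \<beta> (\<phi> m)) = \<sigma>) \<longrightarrow>
            (\<forall>i. a' i * b' i \<noteq> 0 \<longrightarrow>
              (\<forall>j. compensated n P r j i \<in> hyperbola (centroid n P) u v
                     (\<sigma> * (area n P / \<bar>limit_area n u v a' b'\<bar>) * a' i * b' i)))))))"

proof -
  obtain M r \<alpha>0 \<beta>0 where "poncelet_normal_form n M r \<alpha>0 \<beta>0 P"
    using normal_form_exists assms(1-4) by blast
  then interpret N: poncelet_normal_form n M r \<alpha>0 \<beta>0 P .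
  obtain c where c: "c \<noteq> 0" and conj: "\<And>w. (c *\<^sub>R G) *v (M *v w) = M *v N.dil w"
    using N.darboux_schwartz_conjugate[OF assms(5)] by blast
  define a b where "a = N.lam\<^sup>2" and "b = N.mu\<^sup>2"
  have ab: "0 < b" "b < a" "a < 1" using N.lam_mu_sq by (simp_all add: a_def b_def)
  have spectrum: "{t. \<exists>x. eigenvec (c *\<^sub>R G) t x} = {1, a, b}"
    unfolding a_def b_def by (rule N.eigenvalues[OF conj])
  have char: "char_polynomial (c *\<^sub>R G) = [:-1, 1:] * [:a * b, - (a + b), 1:]"
    by (rule char_polynomial_eqI[OF N.M_inv]) (simp only: conj N.dil_def a_def b_def)
  have chamber: "a * b > 0" "(a + b)\<^sup>2 > 4 * (a * b)" "1 - (a + b) + a * b > 0"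
  proof -
    have "(a + b)\<^sup>2 - 4 * (a * b) = (a - b)\<^sup>2" by (simp add: power2_eq_square algebra_simps)
    moreover have "(a - b)\<^sup>2 > 0" using ab by simp
    ultimately show "(a + b)\<^sup>2 > 4 * (a * b)" by linarith
    have "1 - (a + b) + a * b = (1 - a) * (1 - b)" by (simp add: algebra_simps)
    also have "\<dots> > 0" using ab by simp
    finally show "1 - (a + b) + a * b > 0" .
  qed (use ab in simp)
  have iterates:
    "(\<lambda>k. Max ((\<lambda>i. infdist ((normalized_pentagram n ^^ k) P i) (affine_line (centroid n P) u)) ` {0..<int n})) \<longlonglongrightarrow> 0 \<and>
     filterlim (\<lambda>k. diameter (range ((normalized_pentagram n ^^ k) P))) at_top sequentially \<and>
     (\<forall>e. \<exists>v \<alpha> \<beta> a' b'. nondeg_two_scale_under n G ((pentagram ^^ e) P) u v \<alpha> \<beta> a' b')"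
    if X: "eigenvec (c *\<^sub>R G) 1 X1" "eigenvec (c *\<^sub>R G) a X2" and u: "affine_direction X1 X2 u" for X1 X2 u
  proof -
    obtain t where t: "t \<noteq> 0" "u = t *\<^sub>R N.dirU"
      using u N.affine_direction_iff[OF conj X(1) X(2)[unfolded a_def]] by blast
    have two: "\<exists>v \<alpha> \<beta> a' b'. nondeg_two_scale_under n G ((pentagram ^^ e) P) u v \<alpha> \<beta> a' b'" for e
      using N.two_scale_exists[OF c conj t(1), of e] unfolding t(2) by (rule exI)
    show ?thesis by (intro conjI allI N.flattening[OF c conj t] two)
  qed
  have direction: "\<exists>u. affine_direction X1 X2 u"
    if "eigenvec (c *\<^sub>R G) 1 X1" "eigenvec (c *\<^sub>R G) a X2" for X1 X2
  proof -
    have "affine_direction X1 X2 (1 *\<^sub>R N.dirU)"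
      using that by (subst N.affine_direction_iff[OF conj]) (auto simp: a_def intro: exI[of _ 1])
    then show ?thesis by blast
  qed
  \<comment> \<open>The eigenpoints and \<open>c\<close>, \<open>a\<close> were fixed by a normal
    form chosen without regard to Jacobi coordinates. Here a second normal form of the same polygon,
    with identity matrix, takes over.\<close>
  have jacobi: "affine_direction X1 X2 (vector [1, 0]) \<and>
      (\<forall>e. (\<exists>\<alpha> \<beta> a' b'. nondeg_two_scale_under n G ((pentagram ^^ e) P) (vector [1, 0]) (vector [0, 1]) \<alpha> \<beta> a' b') \<and>
        (\<forall>\<alpha> \<beta> a' b' (\<phi> :: nat \<Rightarrow> nat) \<sigma>.
          nondeg_two_scale_under n G ((pentagram ^^ e) P) (vector [1, 0]) (vector [0, 1]) \<alpha> \<beta> a' b' \<and>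
          strict_mono \<phi> \<and> \<sigma> \<in> {-1, 1} \<and> (\<forall>m. sgn (\<alpha> (\<phi> m) * \<beta> (\<phi> m)) = \<sigma>) \<longrightarrow>
          (\<forall>i j. compensated n P e j i \<in> hyperbola (centroid n P) (vector [1, 0]) (vector [0, 1])
             (\<sigma> * (area n P / \<bar>limit_area n (vector [1, 0]) (vector [0, 1]) a' b'\<bar>) * a' i * b' i))))"
    if \<epsilon>: "0 < \<epsilon>" "\<epsilon> < 1" "P = jacobi_polygon n \<epsilon> u0" and X: "eigenvec (c *\<^sub>R G) 1 X1" "eigenvec (c *\<^sub>R G) a X2"
    for \<epsilon> u0 X1 X2
  proof -
    interpret jacobi_modulus \<epsilon> by standard (use \<epsilon> in auto)
    define I :: "real^3^3" where "I = Finite_Cartesian_Product.mat 1"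
    obtain r' \<alpha>' \<beta>' where "poncelet_normal_form n I r' \<alpha>' \<beta>' P"
      using jacobi_normal_form[OF assms(1)] unfolding \<epsilon>(3) I_def by blast
    then interpret J: poncelet_normal_form n I r' \<alpha>' \<beta>' P .
    obtain c' where c': "c' \<noteq> 0" and conj': "\<And>w. (c' *\<^sub>R G) *v (I *v w) = I *v J.dil w"
      using J.darboux_schwartz_conjugate[OF assms(5)] by blast
    \<comment> \<open>By uniqueness both normal forms normalize \<open>G\<close> alike, so
      \<open>X1\<close> and \<open>X2\<close> are the same eigenpoints and the axes give the
      spectral direction.\<close>
    have eq: "c' = c" "J.lam\<^sup>2 = a"
      using normalized_spectrum_unique[OF c c' ab J.lam_mu_sq spectrum J.eigenvalues[OF conj']] by simp_all
    have UV: "J.dirU = vector [1, 0]" "J.dirV = vector [0, 1]"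
      unfolding J.dirU_def J.dirV_def J.ctr_def by (simp_all add: I_def Finite_Cartesian_Product.mat_def)
    have "affine_direction X1 X2 (1 *\<^sub>R J.dirU)"
      using X by (subst J.affine_direction_iff[OF conj']) (auto simp: eq intro: exI[of _ 1])
    then have "affine_direction X1 X2 (vector [1, 0])" by (simp add: UV)
    moreover have "\<exists>\<alpha> \<beta> a' b'. nondeg_two_scale_under n G ((pentagram ^^ e) P) (vector [1, 0]) (vector [0, 1]) \<alpha> \<beta> a' b'" for e
      using J.two_scale_exists[OF c' conj' zero_neq_one[symmetric], of e] by (simp add: UV)
    moreover have "compensated n P e j i \<in> hyperbola (centroid n P) (vector [1, 0]) (vector [0, 1])
        (\<sigma> * (area n P / \<bar>limit_area n (vector [1, 0]) (vector [0, 1]) a' b'\<bar>) * a' i * b' i)"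
      if "nondeg_two_scale_under n G ((pentagram ^^ e) P) (vector [1, 0]) (vector [0, 1]) \<alpha> \<beta> a' b' \<and>
          strict_mono \<phi> \<and> \<sigma> \<in> {-1, 1} \<and> (\<forall>m. sgn (\<alpha> (\<phi> m) * \<beta> (\<phi> m)) = \<sigma>)" for e i j \<alpha> \<beta> a' b' \<sigma> and \<phi> :: "nat \<Rightarrow> nat"
      using J.diagonal_exact[OF c' conj' I_def] that by blast
    ultimately show ?thesis by blast
  qed
  show ?thesis
  proof (rule exI[of _ c], rule exI[of _ a], rule exI[of _ b], rule exI[of _ "a + b"], rule exI[of _ "a * b"],
      intro conjI allI impI ballI)
    show "poly_disc (char_polynomial (c *\<^sub>R G)) = ((a + b)\<^sup>2 - 4 * (a * b)) * (1 - (a + b) + a * b)\<^sup>2"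
      unfolding char by (rule poly_disc_cubic)
  next
    fix X1 X2 u e v \<alpha> \<beta> a' b' X Y \<sigma> i and \<phi> :: "nat \<Rightarrow> nat"
    assume h: "nondeg_two_scale_under n G ((pentagram ^^ e) P) u v \<alpha> \<beta> a' b' \<and>
            (\<forall>j i. compensated n P e j i - centroid n P = X j i *\<^sub>R u + Y j i *\<^sub>R v) \<and>
            strict_mono \<phi> \<and> \<sigma> \<in> {-1, 1} \<and> (\<forall>m. sgn (\<alpha> (\<phi> m) * \<beta> (\<phi> m)) = \<sigma>)"
    note lim = N.two_scale_clause[OF c conj, of e u v \<alpha> \<beta> a' b' X Y \<phi> \<sigma> i]
    show "(\<lambda>m. X (\<phi> m) i * Y (\<phi> m) i) \<longlonglongrightarrow> \<sigma> * (area n P / \<bar>limit_area n u v a' b'\<bar>) * a' i * b' i"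
      by (rule lim(1)) (use h in auto)
    show "asymptotic_to (\<lambda>m. compensated n P e (\<phi> m) i)
        (hyperbola (centroid n P) u v (\<sigma> * (area n P / \<bar>limit_area n u v a' b'\<bar>) * a' i * b' i))"
      if "a' i * b' i \<noteq> 0"
      by (rule lim(2)) (use h that in auto)
  next
    fix X1 X2 \<epsilon> u0 and u v :: "real^2"
    assume X: "eigenvec (c *\<^sub>R G) 1 X1 \<and> eigenvec (c *\<^sub>R G) a X2"
      and h: "0 < \<epsilon> \<and> \<epsilon> < 1 \<and> P = jacobi_polygon n \<epsilon> u0 \<and> u = vector [1, 0] \<and> v = vector [0, 1]"
    then have "0 < \<epsilon>" "\<epsilon> < 1" "P = jacobi_polygon n \<epsilon> u0" and uv: "u = vector [1, 0]" "v = vector [0, 1]" by simp_all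
    note j = jacobi[OF this(1-3) conjunct1[OF X] conjunct2[OF X]]
    show "affine_direction X1 X2 u" unfolding uv by (rule j[THEN conjunct1])
    fix e
    note j = j[THEN conjunct2, THEN spec, of e]
    show "\<exists>\<alpha> \<beta> a' b'. nondeg_two_scale_under n G ((pentagram ^^ e) P) u v \<alpha> \<beta> a' b'" unfolding uv by (rule j[THEN conjunct1])
    fix \<alpha> \<beta> a' b' \<sigma> i j and \<phi> :: "nat \<Rightarrow> nat"
    assume d: "nondeg_two_scale_under n G ((pentagram ^^ e) P) u v \<alpha> \<beta> a' b' \<and>
            strict_mono \<phi> \<and> \<sigma> \<in> {-1, 1} \<and> (\<forall>m. sgn (\<alpha> (\<phi> m) * \<beta> (\<phi> m)) = \<sigma>)"
    show "compensated n P e j i \<in> hyperbola (centroid n P) u v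
                     (\<sigma> * (area n P / \<bar>limit_area n u v a' b'\<bar>) * a' i * b' i)"
      using j[THEN conjunct2, rule_format, OF d[unfolded uv]] unfolding uv .
  next
    fix X1 X2 u e
    assume X: "eigenvec (c *\<^sub>R G) 1 X1 \<and> eigenvec (c *\<^sub>R G) a X2"
    then show "\<exists>u. affine_direction X1 X2 u" using direction by blast
    assume "affine_direction X1 X2 u"
    note it = iterates[OF conjunct1[OF X] conjunct2[OF X] this]
    show "(\<lambda>k. Max ((\<lambda>i. infdist ((normalized_pentagram n ^^ k) P i) (affine_line (centroid n P) u)) ` {0..<int n})) \<longlonglongrightarrow> 0"
      by (rule it[THEN conjunct1])
    show "filterlim (\<lambda>k. diameter (range ((normalized_pentagram n ^^ k) P))) at_top sequentially"
      by (rule it[THEN conjunct2, THEN conjunct1])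
    show "\<exists>v \<alpha> \<beta> a' b'. nondeg_two_scale_under n G ((pentagram ^^ e) P) u v \<alpha> \<beta> a' b'"
      by (rule it[THEN conjunct2, THEN conjunct2, rule_format])
  qed (rule c ab spectrum char chamber refl)+
qed

end
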